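(* Let $C$ be a $p\times p$ correlation matrix and, for $\lambda\ge 0$ and $\alpha<1$, consider the problem of minimizing \[ F_{\lambda,\alpha}(R,D)=-\log\det(R)-2(1-\alpha)\log\det(D) +\operatorname{tr}( C DRD)+ \lambda \|R\|_{1,\mathrm{off}} \] over $(R,D)\in \mathrm{S}_{++}^{(1)}\times \mathrm{Diag}_+$. (i) If $\|C-I_p\|_{\infty} \leq (2(1-\alpha) p^3)^{-1/2}$, then for any $\lambda\geq 0$ the problem admits a unique local minimum. (ii) For any $C\in\mathrm{S}_{++}^{(1)}$, there exist $\lambda_0>0$ and $\alpha_0>0$ such that, for every $\lambda\in(0,\lambda_0)$ and $\alpha\in(-\infty,\alpha_0)$, the problem admits a unique local minimum.
   Context: $\mathrm{S}_{++}^{(1)}$ is the set of real symmetric positive definite $p\times p$ matrices with unit diagonal; $\mathrm{Diag}_+$ is the set of $p\times p$ diagonal matrices with strictly positive diagonal entries. A correlation matrix is a symmetric positive semidefinite matrix with unit diagonal. $\|R\|_{1,\mathrm{off}}=\sum_{i\ne j}|R_{ij}|$ and $\|A\|_\infty=\max_{i,j}|A_{ij}|$. The parameter $\alpha$ always satisfies $\alpha<1$. *)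

theory Defs
  imports "HOL-Analysis.Analysis"
begin

definition unit_diagonal :: "real^'p^'p \<Rightarrow> bool" where
  "unit_diagonal A \<longleftrightarrow> (\<forall>i. A $ i $ i = 1)"

definition sym_pos_semidef :: "real^'p^'p \<Rightarrow> bool" where
  "sym_pos_semidef A \<longleftrightarrow> transpose A = A \<and> (\<forall>x. 0 \<le> x \<bullet> (A *v x))"

definition sym_pos_def :: "real^'p^'p \<Rightarrow> bool" where
  "sym_pos_def A \<longleftrightarrow> transpose A = A \<and> (\<forall>x. x \<noteq> 0 \<longrightarrow> 0 < x \<bullet> (A *v x))"

definition correlation_matrix :: "real^'p^'p \<Rightarrow> bool" where
  "correlation_matrix A \<longleftrightarrow> sym_pos_semidef A \<and> unit_diagonal A"

definition S_pp1 :: "(real^'p^'p) set" where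
  "S_pp1 = {A. sym_pos_def A \<and> unit_diagonal A}"

definition Diag_plus :: "(real^'p^'p) set" where
  "Diag_plus = {D. (\<forall>i j. i \<noteq> j \<longrightarrow> D $ i $ j = 0) \<and> (\<forall>i. 0 < D $ i $ i)}"

definition norm1_off :: "real^'p^'p \<Rightarrow> real" where
  "norm1_off A = (\<Sum>(i, j) \<in> {(i, j). i \<noteq> j}. \<bar>A $ i $ j\<bar>)"

text \<open>The largest absolute value of an entry, not an operator norm.\<close>
definition max_entry_norm :: "real^'p^'p \<Rightarrow> real" where
  "max_entry_norm A = (MAX (i, j) \<in> UNIV. \<bar>A $ i $ j\<bar>)"

definition objective ::
  "real^'p^'p \<Rightarrow> real \<Rightarrow> real \<Rightarrow> (real^'p^'p) \<times> (real^'p^'p) \<Rightarrow> real" where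
  "objective C lam \<alpha> = (\<lambda>(R, D).
     - ln (det R) - 2 * (1 - \<alpha>) * ln (det D) + trace (C ** D ** R ** D) + lam * norm1_off R)"

text \<open>Local minimality is relative to the constraint set: the neighbourhoods are those
  of the subspace topology on \<open>S\<close>, and the minimum need not be strict.\<close>
definition local_minimum_on :: "('a::topological_space \<Rightarrow> real) \<Rightarrow> 'a set \<Rightarrow> 'a \<Rightarrow> bool" where
  "local_minimum_on f S x \<longleftrightarrow> x \<in> S \<and> (\<forall>\<^sub>F y in at x within S. f x \<le> f y)"

definition unique_local_minimum :: "real^'p^'p \<Rightarrow> real \<Rightarrow> real \<Rightarrow> bool" where
  "unique_local_minimum C lam \<alpha> \<longleftrightarrow>
     (\<exists>!x. local_minimum_on (objective C lam \<alpha>) (S_pp1 \<times> Diag_plus) x)"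

end

theory Submission
  imports Defs
begin

text \<open>
  The penalty is convex in \<open>R\<close> but not in \<open>D\<close>, so two local minima \<open>(R1, D1)\<close> and \<open>(R2, D2)\<close> are
  compared through the first-order conditions along a path joining them. The two inequalities are
  added, and a simultaneous diagonalization of two positive definite matrices turns the
  contribution of \<open>- ln det\<close> into an explicit sum over generalized eigenvalues.

  For the first part the path is the segment from \<open>R1\<close> to \<open>R2\<close> with \<open>D\<close> fixed. With
  \<open>H = R1 - R2 = W diag(k) W\<^sup>T\<close>, \<open>R1 + R2 = W W\<^sup>T\<close> and \<open>N\<close> the entrywise product of \<open>C\<close> and \<open>H\<close>, this gives
  \<open>L = 4 \<Sum> k\<^sup>2 / (1 - k\<^sup>2) \<le> T = d2\<^sup>T N d2 - d1\<^sup>T N d1\<close>, whereas stationarity in \<open>D\<close> makes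
  \<open>T\<close> a positive definite form in \<open>d1 - d2\<close> that is also \<open>- (d1 - d2)\<^sup>T N (d1 + d2)\<close>. A Schur product
  argument bounds \<open>T\<close> by \<open>2 p (1 - \<alpha>) L\<close>, which suffices if \<open>2 p (1 - \<alpha>) < 1\<close>. Otherwise
  \<open>\<theta> = (p - 1) \<parallel>C - I\<parallel>\<^sub>\<infinity> < 1\<close>; as \<open>H\<close> has zero diagonal, \<open>C\<close> may be replaced by \<open>C - (1 - \<theta>) I\<close> in \<open>N\<close>,
  and the bound improves to \<open>2 p (1 - \<alpha>) \<theta>\<^sup>2 L\<close>.

  For the second part the path is the segment in the variable \<open>S = D R D\<close>, in which the smooth part of the
  objective is convex for \<open>\<alpha> \<le> 0\<close>. The defect of convexity of the penalty, and of the term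
  \<open>\<alpha> \<Sum> ln S\<^sub>i\<^sub>i\<close> for small \<open>\<alpha> > 0\<close>, is controlled by the gap of \<open>- ln det\<close> uniformly in \<open>C\<close> and \<open>\<alpha>\<close>.
\<close>

section \<open>Simultaneous diagonalization\<close>

text \<open>A maximizer \<open>v\<close> of the Rayleigh quotient on the unit sphere of
  \<open>V\<close> is an eigenvector: the residual \<open>w\<close> would otherwise be a direction
  of first-order increase inside \<open>V\<close>.\<close>

lemma selfadjoint_eigenvector:
  fixes f :: "'a::euclidean_space \<Rightarrow> 'a"
  assumes lin: "linear f" and sa: "\<And>x y. f x \<bullet> y = x \<bullet> f y"
    and sub: "subspace V" and inv: "f ` V \<subseteq> V" and ne: "V \<noteq> {0}"
  shows "\<exists>v\<in>V. norm v = 1 \<and> (\<exists>c. f v = c *\<^sub>R v)"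
proof -
  let ?S = "sphere 0 1 \<inter> V"
  obtain u where u: "u \<in> V" "u \<noteq> 0"
    using ne subspace_0[OF sub] by blast
  have "u /\<^sub>R norm u \<in> ?S"
    using u sub by (simp add: subspace_mul)
  then have ne': "?S \<noteq> {}" by blast
  have "compact ?S"
    by (intro compact_Int_closed compact_sphere closed_subspace sub)
  moreover have "continuous_on ?S (\<lambda>x. f x \<bullet> x)"
    by (intro continuous_intros linear_continuous_on linear_conv_bounded_linear[THEN iffD1, OF lin])
  ultimately obtain v where v: "v \<in> ?S" and mx: "\<And>y. y \<in> ?S \<Longrightarrow> f y \<bullet> y \<le> f v \<bullet> v"
    using continuous_attains_sup[OF _ ne'] by blast
  define c where "c = f v \<bullet> v"
  have vV: "v \<in> V" and nv: "v \<bullet> v = 1"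
    using v by (auto simp: norm_eq_1)
  have le: "f y \<bullet> y \<le> c * (y \<bullet> y)" if "y \<in> V" for y
  proof (cases "y = 0")
    case True
    then show ?thesis by (simp add: linear_0[OF lin])
  next
    case False
    have "f (y /\<^sub>R norm y) \<bullet> (y /\<^sub>R norm y) \<le> c"
      unfolding c_def using that False sub by (intro mx) (auto simp: subspace_mul)
    then have "f y \<bullet> y / (norm y)\<^sup>2 \<le> c"
      by (simp add: linear_cmul[OF lin] power2_eq_square divide_inverse mult_ac)
    then show ?thesis
      using False by (simp add: dot_square_norm divide_le_eq)
  qed
  define w where "w = f v - c *\<^sub>R v"
  have wV: "w \<in> V"
    unfolding w_def using inv vV sub by (intro subspace_diff subspace_mul) auto
  have wv: "w \<bullet> v = 0"
    unfolding w_def c_def using nv by (simp add: inner_diff_left)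
  have fvw: "f v \<bullet> w = w \<bullet> w"
    using wv unfolding w_def by (simp add: inner_diff_left inner_diff_right inner_commute)
  \<comment> \<open>Maximality of \<open>c\<close> is tested at \<open>v + t *\<^sub>R w\<close>;
    since \<open>f v \<bullet> w = w \<bullet> w\<close>, the linear coefficient is
    \<open>2 * (w \<bullet> w)\<close>.\<close>
  have q: "2 * (w \<bullet> w) * t + (f w \<bullet> w - c * (w \<bullet> w)) * t\<^sup>2 \<le> 0" for t :: real
  proof -
    have "f (v + t *\<^sub>R w) \<bullet> (v + t *\<^sub>R w) \<le> c * ((v + t *\<^sub>R w) \<bullet> (v + t *\<^sub>R w))"
      by (intro le subspace_add subspace_mul sub vV wV)
    moreover have "f (v + t *\<^sub>R w) \<bullet> (v + t *\<^sub>R w) = c + 2 * t * (w \<bullet> w) + t\<^sup>2 * (f w \<bullet> w)"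
      using fvw sa[of w v]
      by (simp add: linear_add[OF lin] linear_cmul[OF lin] inner_add_left inner_add_right c_def
            power2_eq_square inner_commute algebra_simps)
    moreover have "(v + t *\<^sub>R w) \<bullet> (v + t *\<^sub>R w) = 1 + t\<^sup>2 * (w \<bullet> w)"
      using wv nv by (simp add: inner_add_left inner_add_right inner_commute power2_eq_square algebra_simps)
    ultimately have "c + 2 * t * (w \<bullet> w) + t\<^sup>2 * (f w \<bullet> w) \<le> c * (1 + t\<^sup>2 * (w \<bullet> w))"
      by (simp only:)
    then show ?thesis
      by (simp add: algebra_simps)
  qed
  have "w \<bullet> w = 0"
  proof (rule ccontr)
    assume "w \<bullet> w \<noteq> 0"
    then have pos: "w \<bullet> w > 0" using inner_ge_zero[of w] by linarith
    define k where "k = f w \<bullet> w - c * (w \<bullet> w)"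
    \<comment> \<open>Small enough that the second-order term takes back at most half of the
      first-order gain: \<open>\<bar>k * t\<bar> \<le> w \<bullet> w\<close>.\<close>
    define t where "t = (w \<bullet> w) / (1 + \<bar>k\<bar>)"
    have tp: "t > 0" using pos by (simp add: t_def add_pos_nonneg)
    have "2 * (w \<bullet> w) + k * t \<le> 0"
      using q[of t] tp unfolding k_def[symmetric] power2_eq_square
      by (metis (no_types, lifting) distrib_right mult.assoc mult_le_0_iff not_le)
    moreover have "- (k * t) \<le> w \<bullet> w"
    proof -
      have "- (k * t) \<le> (1 + \<bar>k\<bar>) * t" using tp mult_right_mono[of "-k" "1 + \<bar>k\<bar>" t] by simp
      also have "\<dots> = w \<bullet> w" unfolding t_def by (simp add: add_nonneg_eq_0_iff)
      finally show ?thesis .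
    qed
    ultimately show False using pos by linarith
  qed
  then have "f v = c *\<^sub>R v" by (simp add: w_def)
  then show ?thesis using v by (intro bexI[of _ v]) (auto)
qed

text \<open>Induction on the dimension: a unit eigenvector \<open>v\<close> is split off, and its
  orthogonal complement in \<open>V\<close> is again invariant because \<open>f\<close> is
  self-adjoint.\<close>

lemma selfadjoint_eigenbasis:
  fixes f :: "'a::euclidean_space \<Rightarrow> 'a"
  assumes lin: "linear f" and sa: "\<And>x y. f x \<bullet> y = x \<bullet> f y"
    and "subspace V" and "f ` V \<subseteq> V"
  shows "\<exists>B. span B = V \<and> pairwise orthogonal B \<and> (\<forall>b\<in>B. norm b = 1 \<and> (\<exists>c. f b = c *\<^sub>R b))"
  using assms(3,4)
proof (induction "dim V" arbitrary: V rule: less_induct)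
  case less
  show ?case
  proof (cases "V = {0}")
    case True
    then show ?thesis by (intro exI[of _ "{}"]) auto
  next
    case False
    obtain v c where v: "v \<in> V" "norm v = 1" and c: "f v = c *\<^sub>R v"
      using selfadjoint_eigenvector[OF lin sa less.prems False] by blast
    define V' where "V' = {x \<in> V. v \<bullet> x = 0}"
    have sub': "subspace V'"
      using less.prems(1) unfolding V'_def subspace_def by (auto simp: inner_add_right)
    have inv': "f ` V' \<subseteq> V'"
      using less.prems(2) sa[of v, symmetric] by (auto simp: V'_def c)
    have vv: "v \<bullet> v = 1" using v by (simp add: norm_eq_1)
    have "v \<notin> V'" using vv by (simp add: V'_def)
    moreover have "V' \<subseteq> V" by (auto simp: V'_def)
    ultimately have "V' \<subset> V" using v by blast
    then have "dim V' < dim V"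
      using sub' less.prems(1) by (metis dim_psubset span_eq_iff)
    then obtain B where B: "span B = V'" "pairwise orthogonal B"
      "\<forall>b\<in>B. norm b = 1 \<and> (\<exists>c. f b = c *\<^sub>R b)"
      using less.hyps sub' inv' by blast
    have BV: "B \<subseteq> V'" using B(1) span_superset by blast
    have "span (insert v B) = V"
    proof
      show "span (insert v B) \<subseteq> V"
        using BV v less.prems(1) by (intro span_minimal) (auto simp: V'_def)
      show "V \<subseteq> span (insert v B)"
      proof
        fix x assume "x \<in> V"
        have "x - (v \<bullet> x) *\<^sub>R v \<in> V'"
          using \<open>x \<in> V\<close> v vv less.prems(1)
          by (auto simp: V'_def inner_diff_right intro!: subspace_diff subspace_mul)
        then show "x \<in> span (insert v B)"
          using B(1) by (auto simp: span_insert)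
      qed
    qed
    moreover have "pairwise orthogonal (insert v B)"
      using B(2) BV by (auto simp: pairwise_insert V'_def orthogonal_def inner_commute)
    ultimately show ?thesis
      using B(3) v c by (intro exI[of _ "insert v B"]) auto
  qed
qed

section \<open>Congruences of diagonal matrices\<close>

text \<open>This is \<open>W diag(k) W^T\<close> for arbitrary \<open>W\<close>, kept as an
  entrywise sum because quadratic forms, diagonals and entrywise products are all split along the
  index \<open>j\<close>.\<close>

definition congr_diag :: "real^'p^'p \<Rightarrow> ('p \<Rightarrow> real) \<Rightarrow> real^'p^'p" where
  "congr_diag W k = (\<chi> i l. \<Sum>j\<in>UNIV. k j * W $ i $ j * W $ l $ j)"

lemma congr_diag_nth [simp]:
  "congr_diag W k $ i $ l = (\<Sum>j\<in>UNIV. k j * W $ i $ j * W $ l $ j)"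
  by (simp add: congr_diag_def)

lemma congr_diag_eq_mult:
  "congr_diag W k = W ** (\<chi> i j. if i = j then k i else 0) ** transpose W"
  by (simp add: vec_eq_iff matrix_matrix_mult_def transpose_def if_distrib if_distribR
        sum.delta cong: if_cong) (simp add: mult_ac)

lemma det_congr_diag: "det (congr_diag W k) = (det W)\<^sup>2 * (\<Prod>j\<in>UNIV. k j)"
proof -
  have "det (\<chi> i j. if i = j then k i else (0 :: real)) = (\<Prod>j\<in>UNIV. k j)"
    by (subst det_diagonal) auto
  then show ?thesis
    by (simp add: congr_diag_eq_mult det_mul power2_eq_square)
qed

lemma congr_diag_mult: "congr_diag (V ** W) k = V ** congr_diag W k ** transpose V"
  by (simp add: congr_diag_eq_mult matrix_mul_assoc matrix_transpose_mul)

lemma symmetric_spectral: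
  fixes A :: "real^'p^'p"
  assumes "transpose A = A"
  shows "\<exists>U k. orthogonal_matrix U \<and> A = congr_diag U k"
proof -
  have sa: "(A *v x) \<bullet> y = x \<bullet> (A *v y)" for x y
    by (metis assms dot_lmul_matrix inner_commute transpose_matrix_vector)
  obtain B where B: "span B = (UNIV :: (real^'p) set)" "pairwise orthogonal B"
    "\<forall>b\<in>B. norm b = 1 \<and> (\<exists>c. A *v b = c *\<^sub>R b)"
    using selfadjoint_eigenbasis[OF matrix_vector_mul_linear sa, of UNIV] by auto
  have "0 \<notin> B" using B(3) by auto
  then have ind: "independent B" using B(2) pairwise_orthogonal_independent by blast
  have "card B = CARD('p)"
    using dim_eq_card[OF _ ind, of UNIV] B(1) by (simp add: dim_UNIV)
  moreover have fB: "finite B" using ind independent_imp_finite by blast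
  ultimately obtain h where h: "bij_betw h (UNIV :: 'p set) B"
    using finite_same_card_bij[of "UNIV :: 'p set" B] by auto
  then have hB: "h j \<in> B" for j by (auto simp: bij_betw_def)
  define U where "U = (\<chi> i j. h j $ i)"
  have col: "column j U = h j" for j
    by (simp add: U_def column_def vec_eq_iff)
  have orth: "orthogonal_matrix U"
    unfolding orthogonal_matrix_orthonormal_columns col
  proof (intro conjI allI impI)
    show "norm (h i) = 1" for i using B(3) hB by blast
    show "orthogonal (h i) (h j)" if "i \<noteq> j" for i j
      using B(2) hB that h by (metis UNIV_I bij_betw_imp_inj_on inj_onD pairwiseD)
  qed
  have "\<forall>j. \<exists>c. A *v h j = c *\<^sub>R h j"
    using B(3) hB by blast
  then obtain k where k: "\<And>j. A *v h j = k j *\<^sub>R h j"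
    by metis
  let ?D = "\<chi> i j. if i = j then k i else (0 :: real)"
  have "A ** U = U ** ?D"
  proof -
    have "(A ** U) $ i $ j = (U ** ?D) $ i $ j" for i j
    proof -
      have "(A ** U) $ i $ j = (A *v h j) $ i"
        by (simp add: matrix_matrix_mult_def matrix_vector_mult_def U_def)
      also have "\<dots> = k j * h j $ i" by (simp add: k)
      also have "\<dots> = (U ** ?D) $ i $ j"
        by (simp add: matrix_matrix_mult_def U_def if_distrib sum.delta' cong: if_cong)
      finally show ?thesis .
    qed
    then show ?thesis by (simp add: vec_eq_iff)
  qed
  then have "A ** (U ** transpose U) = U ** ?D ** transpose U"
    by (simp add: matrix_mul_assoc)
  then have "A = congr_diag U k"
    using orth by (simp add: congr_diag_eq_mult orthogonal_matrix_def)
  then show ?thesis using orth by blast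
qed

lemma congr_diag_quadratic:
  "x \<bullet> (congr_diag W k *v x) = (\<Sum>j\<in>UNIV. k j * (\<Sum>i\<in>UNIV. W $ i $ j * x $ i)\<^sup>2)"
proof -
  have "x \<bullet> (congr_diag W k *v x)
      = (\<Sum>i\<in>UNIV. \<Sum>l\<in>UNIV. \<Sum>j\<in>UNIV. k j * (W $ i $ j * x $ i) * (W $ l $ j * x $ l))"
    by (simp add: inner_vec_def matrix_vector_mult_def sum_distrib_left sum_distrib_right mult_ac)
  also have "\<dots> = (\<Sum>i\<in>UNIV. \<Sum>j\<in>UNIV. \<Sum>l\<in>UNIV. k j * (W $ i $ j * x $ i) * (W $ l $ j * x $ l))"
    by (intro sum.cong refl sum.swap)
  also have "\<dots> = (\<Sum>j\<in>UNIV. \<Sum>i\<in>UNIV. \<Sum>l\<in>UNIV. k j * (W $ i $ j * x $ i) * (W $ l $ j * x $ l))"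
    by (rule sum.swap)
  also have "\<dots> = (\<Sum>j\<in>UNIV. k j * (\<Sum>i\<in>UNIV. W $ i $ j * x $ i)\<^sup>2)"
    by (simp add: power2_eq_square sum_product sum_distrib_left mult_ac)
  finally show ?thesis .
qed

text \<open>The solution of \<open>W^T x = e_j\<close> isolates \<open>k j\<close>, so each
  coefficient is a value of the form at a nonzero vector. Definiteness of the matrix thereby passes
  to its coefficients.\<close>

lemma congr_diag_quadratic_column:
  fixes W :: "real^'p^'p"
  assumes "det W \<noteq> 0"
  obtains x where "x \<noteq> 0" "x \<bullet> (congr_diag W k *v x) = k j"
proof -
  have "invertible (transpose W)"
    using assms by (simp add: invertible_det_nz det_transpose)
  then obtain V where V: "transpose W ** V = mat 1" by (auto simp: invertible_def)
  define x where "x = V *v axis j 1"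
  have e: "transpose W *v x = axis j 1"
    by (simp add: x_def matrix_vector_mul_assoc V)
  have eq: "(\<Sum>i\<in>UNIV. W $ i $ j' * x $ i) = (if j' = j then 1 else 0)" for j'
    using arg_cong[OF e, of "\<lambda>v. v $ j'"]
    by (simp add: matrix_vector_mult_def transpose_def axis_def)
  then have "x \<bullet> (congr_diag W k *v x) = k j"
    unfolding congr_diag_quadratic eq
    by (simp add: if_distrib[where f="\<lambda>x. x\<^sup>2"] if_distrib[where f="\<lambda>x. k _ * x"] cong: if_cong)
  moreover have "x \<noteq> 0"
  proof
    assume "x = 0"
    then have "axis j 1 = (0 :: real^'p)" using e by simp
    then show False by (simp add: axis_eq_0_iff)
  qed
  ultimately show ?thesis using that by blast
qed

lemma sym_pos_def_congr_diag_pos: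
  assumes "sym_pos_def (congr_diag W k)" "det W \<noteq> 0"
  shows "0 < k j"
  using congr_diag_quadratic_column[OF assms(2), of k j] assms(1)
  by (metis sym_pos_def_def)

text \<open>With \<open>A = V V^T\<close>, the matrix \<open>V^-1 H V^-T\<close> is symmetric, hence
  equal to \<open>Q diag(k) Q^T\<close> with \<open>Q\<close> orthogonal; \<open>W = V Q\<close>
  then serves both matrices.\<close>

lemma simultaneous_diagonalization:
  fixes A H :: "real^'p^'p"
  assumes A: "sym_pos_def A" and H: "transpose H = H"
  obtains W k where "det W \<noteq> 0" "A = congr_diag W (\<lambda>_. 1)" "H = congr_diag W k"
proof -
  obtain U l where U: "orthogonal_matrix U" and Al: "A = congr_diag U l"
    using symmetric_spectral A by (metis sym_pos_def_def)
  have dU: "det U \<noteq> 0" using det_orthogonal_matrix[OF U] by auto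
  have l: "0 < l j" for j
    using sym_pos_def_congr_diag_pos A Al dU by metis
  define V where "V = U ** (\<chi> i j. if i = j then sqrt (l i) else 0)"
  have Vn: "V $ i $ j = U $ i $ j * sqrt (l j)" for i j
    by (simp add: V_def matrix_matrix_mult_def if_distrib sum.delta' cong: if_cong)
  have AV: "A = congr_diag V (\<lambda>_. 1)"
  proof -
    have "l j * U $ i $ j * U $ i' $ j = 1 * (U $ i $ j * sqrt (l j)) * (U $ i' $ j * sqrt (l j))" for i i' j
      using real_sqrt_mult_self[of "l j"] l[of j] by (simp add: mult_ac)
    then show ?thesis by (simp only: Al vec_eq_iff Vn congr_diag_nth) simp
  qed
  have "det (\<chi> i j. if i = j then sqrt (l i) else 0) = (\<Prod>i\<in>UNIV. sqrt (l i))"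
    by (subst det_diagonal) auto
  then have dV: "det V \<noteq> 0"
    using dU l by (simp add: V_def det_mul less_imp_neq[symmetric])
  then obtain V' where V': "V ** V' = mat 1" "V' ** V = mat 1"
    using invertible_det_nz[of V] by (auto simp: invertible_def)
  define K where "K = V' ** H ** transpose V'"
  have "transpose K = K"
    by (simp add: K_def matrix_transpose_mul H matrix_mul_assoc)
  then obtain Q k where Q: "orthogonal_matrix Q" and K: "K = congr_diag Q k"
    using symmetric_spectral by blast
  have tV: "transpose V' ** transpose V = mat 1"
    using V'(1) by (metis matrix_transpose_mul transpose_mat)
  have "V ** K ** transpose V = (V ** V') ** H ** (transpose V' ** transpose V)"
    by (simp add: K_def matrix_mul_assoc)
  then have HK: "H = congr_diag (V ** Q) k"
    by (simp add: V' tV congr_diag_mult K)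
  have I: "(\<chi> i j. if i = j then 1 else 0) = (mat 1 :: real^'p^'p)" by (simp add: mat_def)
  have "A = congr_diag (V ** Q) (\<lambda>_. 1)"
    using Q by (simp add: AV congr_diag_eq_mult I matrix_transpose_mul orthogonal_matrix_def
        flip: matrix_mul_assoc) (simp add: matrix_mul_assoc orthogonal_matrix_def)
  moreover have "det (V ** Q) \<noteq> 0"
    using dV det_orthogonal_matrix[OF Q] by (auto simp: det_mul)
  ultimately show ?thesis using that HK by blast
qed

section \<open>Entrywise products and quadratic forms\<close>

lemma discriminant_bound:
  fixes A B C :: real
  assumes "\<And>t. 0 \<le> A + 2 * t * B + t\<^sup>2 * C"
  shows "B\<^sup>2 \<le> A * C"
proof (cases "C = 0")
  case True
  have "B = 0"
  proof (rule ccontr)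
    assume "B \<noteq> 0"
    then show False using assms[of "- (A + 1) / (2 * B)"] True by (simp add: field_simps)
  qed
  then show ?thesis using True by simp
next
  case False
  have C: "C > 0"
  proof (rule ccontr)
    assume "\<not> C > 0"
    then have C: "C < 0" using False by simp
    \<comment> \<open>So large that the quadratic term equals
      \<open>- t * (\<bar>A\<bar> + 2 * \<bar>B\<bar> + 1 - C)\<close>, which outweighs the other
      two terms because \<open>t \<ge> 1\<close>.\<close>
    define t where "t = (\<bar>A\<bar> + 2 * \<bar>B\<bar> + 1) / (-C) + 1"
    have t1: "t \<ge> 1" using C unfolding t_def by (simp add: divide_nonneg_neg add_nonneg_nonneg)
    have ct: "- C * t = \<bar>A\<bar> + 2 * \<bar>B\<bar> + 1 - C" using C by (simp add: t_def field_simps)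
    have "t\<^sup>2 * C = - t * (- C * t)" by (simp add: power2_eq_square)
    also have "\<dots> = - t * \<bar>A\<bar> - t * (2 * \<bar>B\<bar>) - t * (1 - C)" unfolding ct by (simp add: algebra_simps)
    finally have e: "t\<^sup>2 * C = - t * \<bar>A\<bar> - t * (2 * \<bar>B\<bar>) - t * (1 - C)" .
    have "A \<le> t * \<bar>A\<bar>" using t1 mult_right_mono[OF t1, of "\<bar>A\<bar>"] by linarith
    moreover have "2 * t * B \<le> t * (2 * \<bar>B\<bar>)" using t1 mult_left_mono[of B "\<bar>B\<bar>" "2 * t"] by simp
    moreover have "t * (1 - C) > 0" using t1 C by simp
    ultimately show False using assms[of t] e by linarith
  qed
  have "0 \<le> A + 2 * (- B / C) * B + (- B / C)\<^sup>2 * C" by (rule assms)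
  also have "\<dots> = A - B\<^sup>2 / C" using C by (simp add: power2_eq_square field_simps)
  finally show ?thesis using C by (simp add: field_simps)
qed

section \<open>Bilinear forms and the Schur product\<close>

text \<open>The arguments are functions rather than vectors, so that coordinate scalings such as
  \<open>\<lambda>i. W $ i $ j * x i\<close> can be inserted directly.\<close>

definition bil :: "real^'p^'p \<Rightarrow> ('p \<Rightarrow> real) \<Rightarrow> ('p \<Rightarrow> real) \<Rightarrow> real" where
  "bil A x y = (\<Sum>i\<in>UNIV. \<Sum>l\<in>UNIV. A $ i $ l * x i * y l)"

definition hadamard :: "real^'p^'p \<Rightarrow> real^'p^'p \<Rightarrow> real^'p^'p" where
  "hadamard A B = (\<chi> i l. A $ i $ l * B $ i $ l)"

lemma hadamard_nth [simp]: "hadamard A B $ i $ l = A $ i $ l * B $ i $ l"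
  by (simp add: hadamard_def)

lemma symmetric_nth:
  assumes "transpose A = A"
  shows "A $ i $ l = A $ l $ i"
  using assms by (metis transpose_def vec_lambda_beta)

lemma transpose_hadamard:
  assumes "transpose A = A" "transpose B = B"
  shows "transpose (hadamard A B) = hadamard A B"
proof -
  have "transpose (hadamard A B) $ i $ l = hadamard A B $ i $ l" for i l
    using symmetric_nth[OF assms(1), of l i] symmetric_nth[OF assms(2), of l i]
    by (simp add: transpose_def)
  then show ?thesis by (simp only: vec_eq_iff) simp
qed

lemma bil_add_left: "bil A (\<lambda>i. x i + y i) z = bil A x z + bil A y z"
  and bil_add_right: "bil A z (\<lambda>i. x i + y i) = bil A z x + bil A z y"
  and bil_diff_left: "bil A (\<lambda>i. x i - y i) z = bil A x z - bil A y z"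
  and bil_diff_right: "bil A z (\<lambda>i. x i - y i) = bil A z x - bil A z y"
  and bil_scale_left: "bil A (\<lambda>i. c * x i) z = c * bil A x z"
  and bil_scale_right: "bil A z (\<lambda>i. c * x i) = c * bil A z x"
  and bil_add_mat: "bil (A + B) x y = bil A x y + bil B x y"
  and bil_diff_mat: "bil (A - B) x y = bil A x y - bil B x y"
  by (simp_all add: bil_def algebra_simps sum.distrib sum_subtractf sum_distrib_left)

lemma bil_sym:
  assumes "transpose A = A"
  shows "bil A x y = bil A y x"
proof -
  have "A $ i $ l = A $ l $ i" for i l
    using assms by (metis transpose_def vec_lambda_beta)
  then show ?thesis
    unfolding bil_def by (subst sum.swap) (simp add: mult_ac)
qed

lemma bil_eq_inner: "bil A x x = (\<chi> i. x i) \<bullet> (A *v (\<chi> i. x i))"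
  by (simp add: bil_def inner_vec_def matrix_vector_mult_def sum_distrib_left mult_ac)

lemma bil_mat_1: "bil (mat 1) x y = (\<Sum>i\<in>UNIV. x i * y i)"
  by (simp add: bil_def mat_def if_distrib if_distribR cong: if_cong)

lemma bil_scaleR_mat: "bil (c *\<^sub>R A) x y = c * bil A x y"
  by (simp add: bil_def sum_distrib_left mult_ac)

text \<open>The mechanism of the Schur product theorem: each rank-one term of the congruence acts on
  the form of \<open>A\<close> by scaling coordinates with a column of \<open>W\<close>. Bounds on
  \<open>A\<close> and on \<open>k\<close> thus become bounds on the entrywise product.\<close>

lemma bil_hadamard_congr_diag:
  "bil (hadamard A (congr_diag W k)) x y
     = (\<Sum>j\<in>UNIV. k j * bil A (\<lambda>i. W $ i $ j * x i) (\<lambda>l. W $ l $ j * y l))"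
proof -
  have "bil (hadamard A (congr_diag W k)) x y
      = (\<Sum>i\<in>UNIV. \<Sum>l\<in>UNIV. \<Sum>j\<in>UNIV. k j * (A $ i $ l * (W $ i $ j * x i) * (W $ l $ j * y l)))"
    by (simp add: bil_def sum_distrib_left sum_distrib_right mult_ac)
  also have "\<dots> = (\<Sum>i\<in>UNIV. \<Sum>j\<in>UNIV. \<Sum>l\<in>UNIV. k j * (A $ i $ l * (W $ i $ j * x i) * (W $ l $ j * y l)))"
    by (intro sum.cong refl sum.swap)
  also have "\<dots> = (\<Sum>j\<in>UNIV. \<Sum>i\<in>UNIV. \<Sum>l\<in>UNIV. k j * (A $ i $ l * (W $ i $ j * x i) * (W $ l $ j * y l)))"
    by (rule sum.swap)
  finally show ?thesis by (simp add: bil_def sum_distrib_left)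
qed

text \<open>Discriminant of the nonnegative quadratic polynomial obtained by summing
  \<open>\<bar>k j\<bar>\<close> times the form at \<open>x j + t * sgn (k j) * y j\<close>. The
  sign enters the mixed term once, turning \<open>\<bar>k j\<bar>\<close> into \<open>k j\<close>,
  and is squared away in the last term.\<close>

lemma weighted_cauchy_schwarz:
  fixes k :: "'p::finite \<Rightarrow> real" and x y :: "'p \<Rightarrow> 'p \<Rightarrow> real"
  assumes psd: "\<And>x. 0 \<le> bil B x x" and sym: "transpose B = B"
  shows "(\<Sum>j\<in>UNIV. k j * bil B (x j) (y j))\<^sup>2
     \<le> (\<Sum>j\<in>UNIV. \<bar>k j\<bar> * bil B (x j) (x j)) * (\<Sum>j\<in>UNIV. \<bar>k j\<bar> * bil B (y j) (y j))"
proof (rule discriminant_bound)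
  fix t :: real
  have "0 \<le> (\<Sum>j\<in>UNIV. \<bar>k j\<bar> * bil B (\<lambda>i. x j i + (t * sgn (k j)) * y j i) (\<lambda>i. x j i + (t * sgn (k j)) * y j i))"
    by (intro sum_nonneg mult_nonneg_nonneg psd) auto
  also have "\<dots> = (\<Sum>j\<in>UNIV. \<bar>k j\<bar> * bil B (x j) (x j) + 2 * t * (k j * bil B (x j) (y j))
       + t\<^sup>2 * (\<bar>k j\<bar> * bil B (y j) (y j)))"
  proof (rule sum.cong[OF refl])
    fix j
    have a: "bil B (\<lambda>i. x j i + (t * sgn (k j)) * y j i) (\<lambda>i. x j i + (t * sgn (k j)) * y j i)
      = bil B (x j) (x j) + 2 * t * sgn (k j) * bil B (x j) (y j) + t\<^sup>2 * (sgn (k j))\<^sup>2 * bil B (y j) (y j)"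
      unfolding bil_add_left bil_add_right bil_scale_left bil_scale_right
      using bil_sym[OF sym, of "y j" "x j"] by (simp add: power2_eq_square algebra_simps)
    show "\<bar>k j\<bar> * bil B (\<lambda>i. x j i + (t * sgn (k j)) * y j i) (\<lambda>i. x j i + (t * sgn (k j)) * y j i)
      = \<bar>k j\<bar> * bil B (x j) (x j) + 2 * t * (k j * bil B (x j) (y j)) + t\<^sup>2 * (\<bar>k j\<bar> * bil B (y j) (y j))"
      unfolding a by (cases "k j" "0::real" rule: linorder_cases) (simp_all add: algebra_simps)
  qed
  also have "\<dots> = (\<Sum>j\<in>UNIV. \<bar>k j\<bar> * bil B (x j) (x j)) + 2 * t * (\<Sum>j\<in>UNIV. k j * bil B (x j) (y j))
      + t\<^sup>2 * (\<Sum>j\<in>UNIV. \<bar>k j\<bar> * bil B (y j) (y j))"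
    by (simp add: sum.distrib sum_distrib_left)
  finally show "0 \<le> \<dots>" .
qed

text \<open>Stationarity says that \<open>M d\<close> is entrywise \<open>a / d\<close>, so every
  form with \<open>d\<close> in one slot is explicit. Only \<open>bil M1 d2 d2\<close> and
  \<open>bil M2 d1 d1\<close> stay unknown, and \<open>T\<close>, \<open>X\<close> and the form at
  \<open>s\<close> contain them only through their sum.\<close>

lemma stationary_pair_identities:
  fixes M1 M2 :: "real^'p^'p" and d1 d2 :: "'p \<Rightarrow> real"
  assumes sym: "transpose M1 = M1" "transpose M2 = M2"
    and pos: "\<And>i. 0 < d1 i" "\<And>i. 0 < d2 i"
    and st1: "\<And>i. d1 i * (\<Sum>l\<in>UNIV. M1 $ i $ l * d1 l) = a"
    and st2: "\<And>i. d2 i * (\<Sum>l\<in>UNIV. M2 $ i $ l * d2 l) = a"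
  defines "\<delta> \<equiv> \<lambda>i. d1 i - d2 i" and "s \<equiv> \<lambda>i. d1 i + d2 i"
  defines "T \<equiv> bil (M1 - M2) d2 d2 - bil (M1 - M2) d1 d1"
    and "X \<equiv> bil (M1 + M2) \<delta> \<delta>" and "Y \<equiv> 2 * a * (\<Sum>i\<in>UNIV. (\<delta> i)\<^sup>2 / (d1 i * d2 i))"
  shows "T = - bil (M1 - M2) \<delta> s" and "T = X + Y"
    and "bil (M1 + M2) s s = 8 * (real CARD('p) * a) + X + 2 * Y"
proof -
  have b: "bil M x d = (\<Sum>i\<in>UNIV. a * (x i / d i))"
    if p: "\<And>i. 0 < d i" and st: "\<And>i. d i * (\<Sum>l\<in>UNIV. M $ i $ l * d l) = a" for M x and d :: "'p \<Rightarrow> real"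
  proof -
    have "(\<Sum>l\<in>UNIV. M $ i $ l * d l) = a / d i" for i
      using st[of i] p[of i] by (simp add: field_simps)
    then have "x i * (\<Sum>l\<in>UNIV. M $ i $ l * d l) = a * (x i / d i)" for i by simp
    then show ?thesis by (simp add: bil_def sum_distrib_left mult_ac)
  qed
  have ne: "d1 i \<noteq> 0" "d2 i \<noteq> 0" for i using pos by (simp_all add: less_imp_neq[symmetric])
  have b11: "bil M1 d1 d1 = real CARD('p) * a" unfolding b[OF pos(1) st1] using ne by simp
  have b22: "bil M2 d2 d2 = real CARD('p) * a" unfolding b[OF pos(2) st2] using ne by simp
  define P where "P = (\<Sum>i\<in>UNIV. d2 i / d1 i)"
  define Q where "Q = (\<Sum>i\<in>UNIV. d1 i / d2 i)"
  have b21: "bil M1 d2 d1 = a * P" "bil M1 d1 d2 = a * P"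
    unfolding bil_sym[OF sym(1), of d1 d2] b[OF pos(1) st1] P_def by (simp_all add: sum_distrib_left)
  have b12: "bil M2 d1 d2 = a * Q" "bil M2 d2 d1 = a * Q"
    unfolding bil_sym[OF sym(2), of d2 d1] b[OF pos(2) st2] Q_def by (simp_all add: sum_distrib_left)
  have "(\<Sum>i\<in>UNIV. (\<delta> i)\<^sup>2 / (d1 i * d2 i)) = (\<Sum>i\<in>UNIV. d1 i / d2 i + d2 i / d1 i - 2)"
    using ne by (intro sum.cong) (auto simp: \<delta>_def power2_eq_square field_simps)
  also have "\<dots> = Q + P - 2 * real CARD('p)"
    by (simp add: sum.distrib sum_subtractf P_def Q_def)
  finally have Y: "Y = 2 * a * (Q + P - 2 * real CARD('p))" by (simp add: Y_def)
  show "T = - bil (M1 - M2) \<delta> s"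
    unfolding T_def \<delta>_def s_def bil_add_left bil_add_right bil_diff_left bil_diff_right bil_diff_mat
      b11 b22 b21 b12 by simp
  show "T = X + Y"
    unfolding T_def X_def Y \<delta>_def s_def bil_add_left bil_add_right bil_diff_left bil_diff_right bil_diff_mat
      bil_add_mat b11 b22 b21 b12 by (simp add: algebra_simps)
  show "bil (M1 + M2) s s = 8 * (real CARD('p) * a) + X + 2 * Y"
    unfolding X_def Y \<delta>_def s_def bil_add_left bil_add_right bil_diff_left bil_diff_right bil_diff_mat
      bil_add_mat b11 b22 b21 b12 by (simp add: algebra_simps)
qed

text \<open>The constants \<open>r\<close> and \<open>\<eta>\<close> measure how far the form dominating \<open>N\<close> stays below \<open>C \<circ> (R1 + R2)\<close>; they are \<open>1\<close> for a general
  correlation matrix and of order \<open>\<theta>\<close> when \<open>C\<close> is close to the identity.\<close>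
lemma gap_upper_bound:
  fixes T :: real
  assumes TXY: "T = X + Y" and S: "S = 8 * \<kappa> + X + 2 * Y" and nn: "0 \<le> X" "0 \<le> Y" "0 \<le> g1" "0 \<le> \<kappa>"
    and par: "0 \<le> r" "0 \<le> \<eta>" "0 \<le> \<tau>"
    and T2: "T\<^sup>2 \<le> g1 * g2" and g1: "g1 \<le> \<tau> * X" "g1 \<le> r * \<tau> * T" and g2: "g2 \<le> \<eta> * \<tau> * S"
  shows "T * (1 - \<eta> * \<tau>\<^sup>2) \<le> 8 * \<kappa> * r * \<eta> * \<tau>\<^sup>2"
proof (cases "T = 0")
  case True
  then show ?thesis using nn par by simp
next
  case False
  then have T: "T > 0" using TXY nn by linarith
  have "T\<^sup>2 \<le> g1 * (\<eta> * \<tau> * S)"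
    using T2 mult_left_mono[OF g2 nn(3)] by linarith
  also have "\<dots> = \<eta> * \<tau> * (8 * \<kappa> * g1 + g1 * (X + 2 * Y))"
    by (simp add: S algebra_simps)
  \<comment> \<open>The two bounds on \<open>g1\<close> are spent on different terms:
    \<open>r * \<tau> * T\<close> on the one with \<open>\<kappa>\<close>, and
    \<open>\<tau> * X\<close> on the other, where \<open>X * (X + 2 * Y)\<close> is at most
    \<open>(X + Y)\<close> squared.\<close>
  also have "\<dots> \<le> \<eta> * \<tau> * (8 * \<kappa> * (r * \<tau> * T) + \<tau> * X * (X + 2 * Y))"
    using nn par g1 by (intro mult_left_mono add_mono mult_right_mono) auto
  also have "\<dots> \<le> \<eta> * \<tau> * (8 * \<kappa> * (r * \<tau> * T) + \<tau> * T\<^sup>2)"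
  proof -
    have "X * (X + 2 * Y) \<le> T\<^sup>2" by (simp add: TXY power2_eq_square algebra_simps)
    from mult_left_mono[OF this par(3)] show ?thesis
      using par nn by (intro mult_left_mono add_mono) (auto simp: mult_ac)
  qed
  also have "\<dots> = T * (\<eta> * \<tau>\<^sup>2 * (8 * \<kappa> * r) + \<eta> * \<tau>\<^sup>2 * T)"
    by (simp add: power2_eq_square algebra_simps)
  finally have "T * T \<le> T * (\<eta> * \<tau>\<^sup>2 * (8 * \<kappa> * r) + \<eta> * \<tau>\<^sup>2 * T)"
    by (simp add: power2_eq_square)
  then have "T \<le> \<eta> * \<tau>\<^sup>2 * (8 * \<kappa> * r) + \<eta> * \<tau>\<^sup>2 * T"
    using T by simp
  then show ?thesis by (simp add: algebra_simps)
qed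

text \<open>Converts the output of \<open>gap_upper_bound\<close> into a multiple of the
  \<open>- ln det\<close> gap. Here \<open>\<tau>\<close> and \<open>\<sigma>\<close> are the larger
  and the smaller of the two extreme absolute values of \<open>k\<close>, \<open>z * \<tau>\<close>
  is their harmonic mean, and the last factor is their share of that gap.\<close>

lemma large_ratio_inequality:
  fixes \<theta> \<tau> \<sigma> :: real
  assumes th: "0 \<le> \<theta>" "\<theta> < 1" and ts: "0 < \<sigma>" "\<sigma> \<le> \<tau>" "\<tau> < 1"
  defines "z \<equiv> 2 * \<sigma> / (\<tau> + \<sigma>)"
  defines "r \<equiv> \<theta> * z / (\<theta> * z + (1 - \<theta>))" and "\<eta> \<equiv> 2 * \<theta> * z / (2 * \<theta> * z + (1 - \<theta>))"
  shows "r * \<eta> * \<tau>\<^sup>2 \<le> \<theta>\<^sup>2 * (1 - \<eta> * \<tau>\<^sup>2) * (\<tau>\<^sup>2 / (1 - \<tau>\<^sup>2) + \<sigma>\<^sup>2 / (1 - \<sigma>\<^sup>2))"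
proof -
  have t: "0 < \<tau>" using ts by linarith
  have z: "0 < z" "z \<le> 1" using ts t by (auto simp: z_def)
  have t2: "\<tau>\<^sup>2 < 1" "\<sigma>\<^sup>2 < 1" using ts t by (simp_all add: power_less_one_iff)
  define v where "v = 1 - \<tau>\<^sup>2"
  have v: "0 < v" "v < 1" using t2 t by (auto simp: v_def)
  define E where "E = \<theta> * z + (1 - \<theta>)"
  define F where "F = 2 * \<theta> * z + (1 - \<theta>)"
  have EF: "0 < E" "0 < F" using th z by (auto simp: E_def F_def add_nonneg_pos)
  \<comment> \<open>The product of the two mean inequalities
    \<open>4 \<tau> \<sigma> \<le> (\<tau> + \<sigma>)^2\<close> and
    \<open>2 \<tau> \<sigma> \<le> \<tau>^2 + \<sigma>^2\<close>.\<close>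
  have zA: "2 * z\<^sup>2 * \<tau>\<^sup>2 \<le> \<tau>\<^sup>2 + \<sigma>\<^sup>2"
  proof -
    have "4 * (\<tau> * \<sigma>) \<le> (\<tau> + \<sigma>)\<^sup>2" "2 * (\<tau> * \<sigma>) \<le> \<tau>\<^sup>2 + \<sigma>\<^sup>2"
      using zero_le_power2[of "\<tau> - \<sigma>"] by (simp_all add: power2_eq_square algebra_simps)
    then have "4 * (\<tau> * \<sigma>) * (2 * (\<tau> * \<sigma>)) \<le> (\<tau> + \<sigma>)\<^sup>2 * (\<tau>\<^sup>2 + \<sigma>\<^sup>2)"
      using t ts by (intro mult_mono) auto
    then have "8 * \<sigma>\<^sup>2 * \<tau>\<^sup>2 / (\<tau> + \<sigma>)\<^sup>2 \<le> \<tau>\<^sup>2 + \<sigma>\<^sup>2"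
      using t ts by (subst divide_le_eq) (auto simp: power2_eq_square mult_ac)
    then show ?thesis by (simp add: z_def power_divide power_mult_distrib)
  qed
  define Q where "Q = \<tau>\<^sup>2 / v + \<sigma>\<^sup>2 / (1 - \<sigma>\<^sup>2)"
  \<comment> \<open>The two sides differ by a nonnegative multiple of \<open>(1 - z)^2\<close>;
    equality holds when \<open>\<tau> = \<sigma>\<close>.\<close>
  have key: "2 * z\<^sup>2 * \<tau>\<^sup>2 \<le> E * ((1 - \<theta>) * (2 * z\<^sup>2 * \<tau>\<^sup>2) + 2 * \<theta> * z * \<tau>\<^sup>2)"
  proof -
    have "E * ((1 - \<theta>) * (2 * z\<^sup>2 * \<tau>\<^sup>2) + 2 * \<theta> * z * \<tau>\<^sup>2) - 2 * z\<^sup>2 * \<tau>\<^sup>2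
       = 2 * z * \<tau>\<^sup>2 * (\<theta> * (1 - \<theta>) * (1 - z)\<^sup>2)"
      by (simp add: E_def power2_eq_square algebra_simps)
    moreover have "0 \<le> 2 * z * \<tau>\<^sup>2 * (\<theta> * (1 - \<theta>) * (1 - z)\<^sup>2)"
      using th z by simp
    ultimately show ?thesis by linarith
  qed
  also have "\<dots> \<le> E * ((1 - \<theta>) * (\<tau>\<^sup>2 + \<sigma>\<^sup>2) + 2 * \<theta> * z * \<tau>\<^sup>2)"
    using zA th EF z by (intro mult_left_mono add_mono) auto
  \<comment> \<open>\<open>Q\<close> is estimated from below in two ways: by dropping both
    denominators, and by dropping the term of \<open>\<sigma>\<close> while keeping
    \<open>v\<close>.\<close>
  also have "\<dots> \<le> E * ((1 - \<theta> + 2 * \<theta> * z * v) * Q)"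
  proof -
    have "\<tau>\<^sup>2 \<le> \<tau>\<^sup>2 / v" "\<sigma>\<^sup>2 \<le> \<sigma>\<^sup>2 / (1 - \<sigma>\<^sup>2)"
      using v t2 by (auto simp: le_divide_eq mult_left_le)
    then have 1: "\<tau>\<^sup>2 + \<sigma>\<^sup>2 \<le> Q" by (simp add: Q_def)
    have "0 \<le> \<sigma>\<^sup>2 / (1 - \<sigma>\<^sup>2)" using t2 by simp
    then have "0 \<le> v * (\<sigma>\<^sup>2 / (1 - \<sigma>\<^sup>2))" using v by (intro mult_nonneg_nonneg) auto
    then have 2: "\<tau>\<^sup>2 \<le> v * Q" using v by (simp add: Q_def distrib_left)
    have "(1 - \<theta>) * (\<tau>\<^sup>2 + \<sigma>\<^sup>2) + 2 * \<theta> * z * \<tau>\<^sup>2 \<le> (1 - \<theta>) * Q + 2 * \<theta> * z * (v * Q)"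
      using 1 2 th z by (intro add_mono mult_left_mono) auto
    then show ?thesis using EF by (intro mult_left_mono) (auto simp: algebra_simps)
  qed
  finally have k: "2 * z\<^sup>2 * \<tau>\<^sup>2 \<le> E * ((1 - \<theta> + 2 * \<theta> * z * v) * Q)" .
  have e1: "r * \<eta> * \<tau>\<^sup>2 = \<theta>\<^sup>2 * (2 * z\<^sup>2 * \<tau>\<^sup>2) / (E * F)"
    unfolding r_def \<eta>_def E_def[symmetric] F_def[symmetric] by (simp add: power2_eq_square)
  have e2: "1 - \<eta> * \<tau>\<^sup>2 = (1 - \<theta> + 2 * \<theta> * z * v) / F"
    unfolding \<eta>_def F_def[symmetric] using EF by (simp add: field_simps) (simp add: F_def v_def algebra_simps)
  have "\<theta>\<^sup>2 * (2 * z\<^sup>2 * \<tau>\<^sup>2) / (E * F) \<le> \<theta>\<^sup>2 * (E * ((1 - \<theta> + 2 * \<theta> * z * v) * Q)) / (E * F)"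
    using k EF by (intro divide_right_mono mult_left_mono) auto
  also have "\<dots> = \<theta>\<^sup>2 * ((1 - \<theta> + 2 * \<theta> * z * v) / F) * Q" using EF by (simp add: field_simps)
  finally show ?thesis unfolding e1 e2 Q_def v_def .
qed

section \<open>Pairs of stationary points\<close>

lemma offdiag_form_bound:
  fixes E :: "real^'p^'p"
  assumes E: "\<And>i l. i \<noteq> l \<Longrightarrow> \<bar>E $ i $ l\<bar> \<le> \<epsilon>" and "\<And>i. E $ i $ i = 0"
  shows "\<bar>bil E x x\<bar> \<le> \<epsilon> * (real CARD('p) - 1) * (\<Sum>i\<in>UNIV. (x i)\<^sup>2)"
proof -
  have "\<bar>bil E x x\<bar> \<le> (\<Sum>i\<in>UNIV. \<Sum>l\<in>UNIV. \<bar>E $ i $ l * x i * x l\<bar>)"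
    unfolding bil_def by (intro order_trans[OF sum_abs] sum_mono sum_abs)
  \<comment> \<open>The subtracted term cancels the mean inequality exactly at \<open>l = i\<close>,
    where \<open>E\<close> vanishes; this yields the factor \<open>p - 1\<close> instead of
    \<open>p\<close>.\<close>
  also have "\<dots> \<le> (\<Sum>i\<in>UNIV. \<Sum>l\<in>UNIV. \<epsilon> * (((x i)\<^sup>2 + (x l)\<^sup>2) / 2) - (if l = i then \<epsilon> * (x i)\<^sup>2 else 0))"
  proof (intro sum_mono)
    fix i l :: 'p
    show "\<bar>E $ i $ l * x i * x l\<bar> \<le> \<epsilon> * (((x i)\<^sup>2 + (x l)\<^sup>2) / 2) - (if l = i then \<epsilon> * (x i)\<^sup>2 else 0)"
    proof (cases "i = l")
      case True
      then show ?thesis using assms(2) by simp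
    next
      case False
      have "0 \<le> \<epsilon>" using E[OF False] by linarith
      moreover have "\<bar>x i * x l\<bar> \<le> ((x i)\<^sup>2 + (x l)\<^sup>2) / 2"
        using sum_squares_bound[of "\<bar>x i\<bar>" "\<bar>x l\<bar>"] by (simp add: abs_mult)
      ultimately have "\<bar>E $ i $ l\<bar> * \<bar>x i * x l\<bar> \<le> \<epsilon> * (((x i)\<^sup>2 + (x l)\<^sup>2) / 2)"
        using E[OF False] by (intro mult_mono) auto
      then show ?thesis using False by (simp add: abs_mult mult_ac)
    qed
  qed
  also have "\<dots> = \<epsilon> * (real CARD('p) - 1) * (\<Sum>i\<in>UNIV. (x i)\<^sup>2)"
  proof -
    have "(\<Sum>i\<in>UNIV. \<Sum>l\<in>(UNIV::'p set). \<epsilon> * (((x i)\<^sup>2 + (x l)\<^sup>2) / 2)) = \<epsilon> * (real CARD('p) * (\<Sum>i\<in>UNIV. (x i)\<^sup>2))"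
      by (simp add: sum.distrib add_divide_distrib flip: sum_distrib_left sum_divide_distrib)
    then show ?thesis
      by (simp add: sum_subtractf algebra_simps flip: sum_distrib_left)
  qed
  finally show ?thesis .
qed

text \<open>In the row of the largest coordinate \<open>m\<close> of \<open>d\<close>, the
  off-diagonal part is at least \<open>- \<epsilon> (p - 1) m\<close>. Stationarity in that row
  bounds \<open>m\<close>, hence every coordinate.\<close>

lemma stationary_bound:
  fixes M :: "real^'p^'p" and d :: "'p \<Rightarrow> real"
  assumes diag: "\<And>i. M $ i $ i = 1" and off: "\<And>i l. i \<noteq> l \<Longrightarrow> \<bar>M $ i $ l\<bar> \<le> \<epsilon>" and "0 \<le> \<epsilon>"
    and pos: "\<And>i. 0 < d i" and st: "\<And>i. d i * (\<Sum>l\<in>UNIV. M $ i $ l * d l) = a"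
    and th: "\<epsilon> * (real CARD('p) - 1) \<le> 1"
  shows "(d i)\<^sup>2 * (1 - \<epsilon> * (real CARD('p) - 1)) \<le> a"
proof -
  define m where "m = Max (range d)"
  have m: "d j \<le> m" for j unfolding m_def by (intro Max_ge) auto
  have "m \<in> range d" unfolding m_def by (intro Max_in) auto
  then obtain i0 where i0: "m = d i0" by auto
  have mp: "0 < m" using i0 pos by simp
  have "(\<Sum>l\<in>UNIV - {i0}. M $ i0 $ l * d l) \<ge> (\<Sum>l\<in>UNIV - {i0}. - (\<epsilon> * m))"
  proof (intro sum_mono)
    fix l assume "l \<in> UNIV - {i0}"
    then have "\<bar>M $ i0 $ l\<bar> * d l \<le> \<epsilon> * m"
      using off[of i0 l] m[of l] pos[of l] by (intro mult_mono) (auto simp: \<open>0 \<le> \<epsilon>\<close>)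
    moreover have "- (\<bar>M $ i0 $ l\<bar> * d l) \<le> M $ i0 $ l * d l"
      using pos[of l] mult_right_mono[of "- \<bar>M $ i0 $ l\<bar>" "M $ i0 $ l" "d l"] by simp
    ultimately show "- (\<epsilon> * m) \<le> M $ i0 $ l * d l" by linarith
  qed
  moreover have "(\<Sum>l\<in>UNIV - {i0}. - (\<epsilon> * m)) = - (\<epsilon> * (real CARD('p) - 1)) * m"
    by (simp add: card_Diff_singleton of_nat_diff Suc_leI)
  moreover have "(\<Sum>l\<in>UNIV. M $ i0 $ l * d l) = m + (\<Sum>l\<in>UNIV - {i0}. M $ i0 $ l * d l)"
    using diag by (subst sum.remove[of _ i0]) (auto simp: i0)
  ultimately have "(1 - \<epsilon> * (real CARD('p) - 1)) * m \<le> (\<Sum>l\<in>UNIV. M $ i0 $ l * d l)"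
    by (simp add: algebra_simps)
  from mult_left_mono[OF this, of m] have "m\<^sup>2 * (1 - \<epsilon> * (real CARD('p) - 1)) \<le> a"
    using mp st[of i0] by (simp add: i0 power2_eq_square mult_ac)
  moreover have "(d i)\<^sup>2 \<le> m\<^sup>2" using m[of i] pos[of i] by (intro power_mono) auto
  ultimately show ?thesis
    using th mult_right_mono[of "(d i)\<^sup>2" "m\<^sup>2" "1 - \<epsilon> * (real CARD('p) - 1)"] by linarith
qed

text \<open>The mean inequality for each \<open>j\<close>, weighted by \<open>g j\<close>, bounds an
  entry by the average of two diagonal entries.\<close>

lemma congr_diag_entry_le_1:
  assumes "unit_diagonal (congr_diag W g)" "\<And>j. 0 \<le> g j"
  shows "\<bar>congr_diag W g $ i $ l\<bar> \<le> 1"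
proof -
  have ud: "(\<Sum>j\<in>UNIV. g j * (W $ i $ j)\<^sup>2) = 1" for i
    using assms(1) by (auto simp: unit_diagonal_def power2_eq_square mult_ac)
  have "\<bar>congr_diag W g $ i $ l\<bar> \<le> (\<Sum>j\<in>UNIV. (g j * (W $ i $ j)\<^sup>2 + g j * (W $ l $ j)\<^sup>2) / 2)"
    unfolding congr_diag_nth
  proof (intro order_trans[OF sum_abs] sum_mono)
    fix j
    have "\<bar>W $ i $ j\<bar> * \<bar>W $ l $ j\<bar> \<le> ((W $ i $ j)\<^sup>2 + (W $ l $ j)\<^sup>2) / 2"
      using sum_squares_bound[of "\<bar>W $ i $ j\<bar>" "\<bar>W $ l $ j\<bar>"] by simp
    from mult_left_mono[OF this assms(2)[of j]]
    show "\<bar>g j * W $ i $ j * W $ l $ j\<bar> \<le> (g j * (W $ i $ j)\<^sup>2 + g j * (W $ l $ j)\<^sup>2) / 2"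
      using assms(2)[of j] by (simp add: abs_mult algebra_simps)
  qed
  also have "\<dots> = 1"
    by (simp add: ud sum.distrib flip: sum_divide_distrib)
  finally show ?thesis .
qed

text \<open>Here \<open>R1\<close> and \<open>R2\<close> are given by their half sum and half difference, diagonalized by the same \<open>W\<close>.\<close>
locale stationary_pair =
  fixes C W :: "real^'p^'p" and k d1 d2 :: "'p \<Rightarrow> real" and a :: real
  assumes C: "correlation_matrix C" and a: "0 < a" and dW: "det W \<noteq> 0" and k1: "\<And>j. \<bar>k j\<bar> < 1"
    and pos1: "\<And>i. 0 < d1 i" and pos2: "\<And>i. 0 < d2 i"
    and ud1: "unit_diagonal (congr_diag W (\<lambda>j. (1 + k j) / 2))"
    and ud2: "unit_diagonal (congr_diag W (\<lambda>j. (1 - k j) / 2))"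
    and st1: "\<And>i. d1 i * (\<Sum>l\<in>UNIV. hadamard C (congr_diag W (\<lambda>j. (1 + k j) / 2)) $ i $ l * d1 l) = a"
    and st2: "\<And>i. d2 i * (\<Sum>l\<in>UNIV. hadamard C (congr_diag W (\<lambda>j. (1 - k j) / 2)) $ i $ l * d2 l) = a"
    and gap: "4 * (\<Sum>j\<in>UNIV. (k j)\<^sup>2 / (1 - (k j)\<^sup>2))
       \<le> bil (hadamard C (congr_diag W k)) d2 d2 - bil (hadamard C (congr_diag W k)) d1 d1"
begin

definition "R1 = congr_diag W (\<lambda>j. (1 + k j) / 2)"
definition "R2 = congr_diag W (\<lambda>j. (1 - k j) / 2)"
definition "Rb = congr_diag W (\<lambda>j. 1)"
definition "H = congr_diag W k"
definition "\<delta> i = d1 i - d2 i"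
definition "s i = d1 i + d2 i"
text \<open>The contribution of the trace term when the two first-order inequalities are added. It
  dominates \<open>L\<close> by \<open>gap\<close> and splits into the nonnegative parts
  \<open>X\<close> and \<open>Y\<close>.\<close>

definition "T = bil (hadamard C H) d2 d2 - bil (hadamard C H) d1 d1"
definition "X = bil (hadamard C Rb) \<delta> \<delta>"
definition "Y = 2 * a * (\<Sum>i\<in>UNIV. (\<delta> i)\<^sup>2 / (d1 i * d2 i))"
definition "S = bil (hadamard C Rb) s s"
text \<open>The symmetrized gap of \<open>- ln det\<close> between \<open>R1\<close> and
  \<open>R2\<close>: for coefficients \<open>g = (1 + k) / 2\<close> and
  \<open>h = (1 - k) / 2\<close> each summand is \<open>(g - h)^2 / (g h)\<close>.\<close>

definition "L = 4 * (\<Sum>j\<in>UNIV. (k j)\<^sup>2 / (1 - (k j)\<^sup>2))"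
definition "\<kappa> = real CARD('p) * a"

lemma C_sym: "transpose C = C" and C_psd: "0 \<le> bil C x x" and C_diag: "C $ i $ i = 1"
  using C by (auto simp: correlation_matrix_def sym_pos_semidef_def bil_eq_inner unit_diagonal_def)

lemma C_swap: "C $ i $ l = C $ l $ i"
  using C_sym by (metis transpose_def vec_lambda_beta)

lemma had_diff: "hadamard C R1 - hadamard C R2 = hadamard C H"
  and had_add: "hadamard C R1 + hadamard C R2 = hadamard C Rb"
proof -
  have "R1 $ i $ l - R2 $ i $ l = H $ i $ l" "R1 $ i $ l + R2 $ i $ l = Rb $ i $ l" for i l
    by (simp_all add: R1_def R2_def H_def Rb_def field_simps flip: sum_subtractf sum.distrib)
  then show "hadamard C R1 - hadamard C R2 = hadamard C H" "hadamard C R1 + hadamard C R2 = hadamard C Rb"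
    by (simp_all add: vec_eq_iff flip: right_diff_distrib distrib_left)
qed

lemma had_sym: "transpose (hadamard C (congr_diag W g)) = hadamard C (congr_diag W g)"
  by (simp add: vec_eq_iff transpose_def C_swap mult_ac)

lemma T_eq: "T = - bil (hadamard C H) \<delta> s" and T_XY: "T = X + Y" and S_eq: "S = 8 * \<kappa> + X + 2 * Y"
proof -
  have e: "(\<lambda>i. d1 i - d2 i) = \<delta>" "(\<lambda>i. d1 i + d2 i) = s" by (auto simp: \<delta>_def s_def)
  note * = stationary_pair_identities[OF had_sym had_sym pos1 pos2 st1 st2, folded R1_def R2_def,
      unfolded had_diff had_add e]
  show "T = - bil (hadamard C H) \<delta> s" using *(1) by (simp add: T_def)
  show "T = X + Y" using *(2) by (simp add: T_def X_def Y_def \<delta>_def)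
  show "S = 8 * \<kappa> + X + 2 * Y" using *(3) by (simp add: S_def X_def Y_def \<kappa>_def \<delta>_def)
qed

lemma k2: "(k j)\<^sup>2 < 1"
  using k1[of j] by (simp add: abs_square_less_1)

lemma L_term: "0 \<le> (k j)\<^sup>2 / (1 - (k j)\<^sup>2)"
  using k2[of j] by simp

lemma L_nonneg: "0 \<le> L"
  unfolding L_def by (intro mult_nonneg_nonneg sum_nonneg L_term) auto

lemma L_le_T: "L \<le> T"
  using gap by (simp add: L_def T_def H_def)

lemma Y_nonneg: "0 \<le> Y"
  unfolding Y_def using a pos1 pos2 by (intro mult_nonneg_nonneg sum_nonneg divide_nonneg_pos mult_pos_pos) auto

lemma X_nonneg: "0 \<le> X"
  unfolding X_def Rb_def bil_hadamard_congr_diag by (intro sum_nonneg mult_nonneg_nonneg C_psd) auto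

lemma \<kappa>_nonneg: "0 \<le> \<kappa>" using a by (simp add: \<kappa>_def)

text \<open>From \<open>L \<le> T \<le> c * L\<close> with \<open>c < 1\<close> follows
  \<open>L = 0\<close>, which kills \<open>k\<close>. Then \<open>T \<le> 0\<close> forces
  \<open>Y = 0\<close>, which kills the differences of \<open>d1\<close> and
  \<open>d2\<close>.\<close>

lemma coincide:
  assumes "T \<le> c * L" "c < 1"
  shows "k j = 0" and "d1 i = d2 i"
proof -
  have "L \<le> c * L" using assms(1) L_le_T by linarith
  then have L0: "L = 0"
    using L_nonneg assms(2) by (metis eq_iff mult_right_le_one_le mult_le_cancel_right1 not_less order_less_irrefl
        mult_less_cancel_right1 linorder_neqE_linordered_idom)
  then have "\<forall>j\<in>UNIV. (k j)\<^sup>2 / (1 - (k j)\<^sup>2) = 0"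
    unfolding L_def using L_term by (subst (asm) mult_eq_0_iff, subst (asm) sum_nonneg_eq_0_iff) auto
  then show "k j = 0" using k2[of j] by (metis UNIV_I divide_eq_0_iff diff_gt_0_iff_gt order_less_irrefl power_eq_0_iff)
  have "Y = 0" using assms(1) L0 T_XY X_nonneg Y_nonneg by simp
  then have "(\<Sum>i\<in>UNIV. (\<delta> i)\<^sup>2 / (d1 i * d2 i)) = 0"
    using a by (simp add: Y_def)
  then have "\<forall>i\<in>UNIV. (\<delta> i)\<^sup>2 / (d1 i * d2 i) = 0"
    using pos1 pos2 by (subst (asm) sum_nonneg_eq_0_iff) (auto intro!: divide_nonneg_pos mult_pos_pos)
  then show "d1 i = d2 i" using pos1[of i] pos2[of i]
    by (auto simp: \<delta>_def dest!: bspec[of _ _ i])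
qed

text \<open>Cauchy-Schwarz applied to the mixed form \<open>- bil (hadamard C H) \<delta> s\<close>
  of \<open>T\<close>. The freedom in \<open>B\<close> allows the diagonal of \<open>C\<close> to be
  lowered.\<close>

lemma T_sq_le:
  assumes psd: "\<And>x. 0 \<le> bil B x x" and sym: "transpose B = B" and BH: "hadamard B H = hadamard C H"
  shows "T\<^sup>2 \<le> (\<Sum>j\<in>UNIV. \<bar>k j\<bar> * bil B (\<lambda>i. W $ i $ j * \<delta> i) (\<lambda>i. W $ i $ j * \<delta> i))
       * (\<Sum>j\<in>UNIV. \<bar>k j\<bar> * bil B (\<lambda>i. W $ i $ j * s i) (\<lambda>i. W $ i $ j * s i))"
proof -
  have "T\<^sup>2 = (bil (hadamard B H) \<delta> s)\<^sup>2" by (simp add: T_eq BH)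
  then show ?thesis
    unfolding H_def bil_hadamard_congr_diag
    using weighted_cauchy_schwarz[OF psd sym, of k "\<lambda>j i. W $ i $ j * \<delta> i" "\<lambda>j i. W $ i $ j * s i"] by simp
qed

text \<open>With \<open>B = C\<close> and \<open>\<tau>\<close> the maximum of
  \<open>\<bar>k\<bar>\<close>, the gap bound reads
  \<open>T (1 - \<tau>^2) \<le> 8 \<kappa> \<tau>^2\<close>. The single term of \<open>L\<close> at
  an index attaining \<open>\<tau>\<close> then gives
  \<open>T \<le> 2 * \<kappa> * L\<close>.\<close>

lemma small_case:
  assumes "2 * \<kappa> < 1"
  shows "k j = 0" and "d1 i = d2 i"
proof -
  define \<tau> where "\<tau> = Max (range (\<lambda>j. \<bar>k j\<bar>))"
  have \<tau>: "\<bar>k j\<bar> \<le> \<tau>" for j unfolding \<tau>_def by (intro Max_ge) auto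
  have "\<tau> \<in> range (\<lambda>j. \<bar>k j\<bar>)" unfolding \<tau>_def by (intro Max_in) auto
  then obtain j0 where j0: "\<tau> = \<bar>k j0\<bar>" by auto
  then have t0: "0 \<le> \<tau>" and t1: "\<tau>\<^sup>2 < 1" and Lt: "\<tau>\<^sup>2 = (k j0)\<^sup>2" using k2[of j0] by auto
  let ?g = "\<lambda>x. \<Sum>j\<in>UNIV. \<bar>k j\<bar> * bil C (\<lambda>i. W $ i $ j * x i) (\<lambda>i. W $ i $ j * x i)"
  have g: "?g x \<le> \<tau> * bil (hadamard C Rb) x x" for x
    unfolding Rb_def bil_hadamard_congr_diag sum_distrib_left
    by (intro sum_mono) (auto intro!: mult_right_mono \<tau> C_psd)
  have "T * (1 - 1 * \<tau>\<^sup>2) \<le> 8 * \<kappa> * 1 * 1 * \<tau>\<^sup>2"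
  proof (rule gap_upper_bound[OF T_XY S_eq X_nonneg Y_nonneg _ \<kappa>_nonneg _ _ t0 T_sq_le[OF C_psd C_sym refl]])
    show "0 \<le> ?g \<delta>" by (intro sum_nonneg mult_nonneg_nonneg C_psd) auto
    show "?g \<delta> \<le> \<tau> * X" using g[of \<delta>] by (simp add: X_def)
    moreover have "\<tau> * X \<le> \<tau> * T" using t0 T_XY Y_nonneg by (intro mult_left_mono) auto
    ultimately show "?g \<delta> \<le> 1 * \<tau> * T" by simp
    show "?g s \<le> 1 * \<tau> * S" using g[of s] by (simp add: S_def)
  qed auto
  then have "T \<le> 2 * \<kappa> * (4 * (\<tau>\<^sup>2 / (1 - \<tau>\<^sup>2)))"
    using t1 by (simp add: field_simps)
  also have "\<dots> \<le> 2 * \<kappa> * L"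
    unfolding L_def Lt using \<kappa>_nonneg L_term
    by (intro mult_left_mono member_le_sum) auto
  finally have "T \<le> 2 * \<kappa> * L" .
  from coincide[OF this assms] show "k j = 0" and "d1 i = d2 i" .
qed

lemma H_diag: "(\<Sum>j\<in>UNIV. k j * (W $ i $ j)\<^sup>2) = 0"
  and Rb_diag: "(\<Sum>j\<in>UNIV. (W $ i $ j)\<^sup>2) = 2"
proof -
  have "(\<Sum>j\<in>UNIV. (1 + k j) / 2 * (W $ i $ j)\<^sup>2) = 1" "(\<Sum>j\<in>UNIV. (1 - k j) / 2 * (W $ i $ j)\<^sup>2) = 1"
    using ud1 ud2 by (auto simp: unit_diagonal_def power2_eq_square mult_ac)
  note e = this
  have "(\<Sum>j\<in>UNIV. k j * (W $ i $ j)\<^sup>2)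
     = (\<Sum>j\<in>UNIV. (1 + k j) / 2 * (W $ i $ j)\<^sup>2) - (\<Sum>j\<in>UNIV. (1 - k j) / 2 * (W $ i $ j)\<^sup>2)"
    by (simp add: field_simps flip: sum_subtractf)
  then show "(\<Sum>j\<in>UNIV. k j * (W $ i $ j)\<^sup>2) = 0" by (simp only: e)
  have "(\<Sum>j\<in>UNIV. (W $ i $ j)\<^sup>2)
     = (\<Sum>j\<in>UNIV. (1 + k j) / 2 * (W $ i $ j)\<^sup>2) + (\<Sum>j\<in>UNIV. (1 - k j) / 2 * (W $ i $ j)\<^sup>2)"
    by (simp add: field_simps flip: sum.distrib)
  then show "(\<Sum>j\<in>UNIV. (W $ i $ j)\<^sup>2) = 2" by (simp only: e)
qed

text \<open>Since \<open>H\<close> has zero diagonal, its positive and negative parts have equal diagonals; replacing \<open>\<bar>k\<bar>\<close> by the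
  chord of the absolute value over \<open>[- m, p]\<close> yields the harmonic mean of \<open>p\<close> and \<open>m\<close>.\<close>
lemma abs_diag_le:
  assumes "0 < p" "0 < m" "\<And>j. k j \<le> p" "\<And>j. - k j \<le> m"
  shows "(\<Sum>j\<in>UNIV. \<bar>k j\<bar> * (W $ i $ j)\<^sup>2) \<le> 2 * (2 * p * m / (p + m))"
proof -
  have chord: "\<bar>k j\<bar> \<le> (2 * p * m + (p - m) * k j) / (p + m)" for j
  proof (cases "0 \<le> k j")
    case True
    have "m * k j \<le> m * p" using assms by simp
    then show ?thesis using True assms(1,2) by (simp add: le_divide_eq algebra_simps)
  next
    case False
    have "p * - k j \<le> p * m" using assms by (intro mult_left_mono) auto
    then show ?thesis using False assms(1,2) by (simp add: le_divide_eq algebra_simps)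
  qed
  have "(\<Sum>j\<in>UNIV. \<bar>k j\<bar> * (W $ i $ j)\<^sup>2) \<le> (\<Sum>j\<in>UNIV. (2 * p * m + (p - m) * k j) / (p + m) * (W $ i $ j)\<^sup>2)"
    by (intro sum_mono mult_right_mono chord) auto
  also have "\<dots> = (\<Sum>j\<in>UNIV. (2 * p * m / (p + m)) * (W $ i $ j)\<^sup>2 + ((p - m) / (p + m)) * (k j * (W $ i $ j)\<^sup>2))"
    by (simp add: add_divide_distrib distrib_right mult.assoc)
  also have "\<dots> = 2 * (2 * p * m / (p + m))"
    unfolding sum.distrib sum_distrib_left[symmetric] H_diag Rb_diag by simp
  finally show ?thesis .
qed

text \<open>Some row of the invertible \<open>W\<close> is nonzero in column \<open>j0\<close>. In
  that row the weighted sum of \<open>k\<close> is a diagonal entry of \<open>H\<close>, hence zero,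
  so \<open>k\<close> takes both signs.\<close>

lemma extremal_k:
  assumes "k j0 \<noteq> 0"
  obtains jp jm where "0 < k jp" "k jm < 0" "\<And>j. k j \<le> k jp" "\<And>j. k jm \<le> k j"
proof -
  have "\<exists>i. W $ i $ j0 \<noteq> 0"
  proof (rule ccontr)
    assume "\<not> ?thesis"
    then have "column j0 W = 0" by (simp add: column_def vec_eq_iff)
    then show False using dW det_zero_column by blast
  qed
  then obtain i where i: "W $ i $ j0 \<noteq> 0" by blast
  \<comment> \<open>The choices \<open>c = 1\<close> and \<open>c = -1\<close> produce a positive
    and a negative value.\<close>
  have ex: "\<exists>j. 0 < c * k j" if c: "c \<noteq> 0" for c :: real
  proof (rule ccontr)
    assume "\<not> ?thesis"
    then have le: "\<And>j. c * k j \<le> 0" by (simp add: not_less)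
    have "(\<Sum>j\<in>UNIV. - (c * k j) * (W $ i $ j)\<^sup>2) = - c * (\<Sum>j\<in>UNIV. k j * (W $ i $ j)\<^sup>2)"
      by (simp add: sum_distrib_left sum_negf mult_ac)
    then have "(\<Sum>j\<in>UNIV. - (c * k j) * (W $ i $ j)\<^sup>2) = 0" using H_diag by simp
    then have "\<forall>j\<in>UNIV. - (c * k j) * (W $ i $ j)\<^sup>2 = 0"
      using le by (subst (asm) sum_nonneg_eq_0_iff) (auto simp: mult_nonpos_nonneg)
    then have "- (c * k j0) * (W $ i $ j0)\<^sup>2 = 0" by blast
    then show False using c assms i by simp
  qed
  have "Max (range k) \<in> range k" "Min (range k) \<in> range k" by (intro Max_in Min_in; auto)+
  then obtain jp jm where j: "Max (range k) = k jp" "Min (range k) = k jm" by (metis imageE)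
  have p: "k j \<le> k jp" for j unfolding j(1)[symmetric] by (intro Max_ge) auto
  have m: "k jm \<le> k j" for j unfolding j(2)[symmetric] by (intro Min_le) auto
  have "0 < k jp" using ex[of 1] p by (auto intro: less_le_trans)
  moreover have "k jm < 0" using ex[of "-1"] m by (auto intro: le_less_trans)
  ultimately show ?thesis using p m that by blast
qed

text \<open>\<open>C\<close> is replaced by \<open>B\<close>, whose form lies between
  \<open>0\<close> and \<open>2 * \<theta>\<close> times the squared norm. The weight sums then have
  two bounds, one from \<open>\<bar>k\<bar> \<le> \<tau>\<close> and one from the diagonal of the
  absolute value of \<open>H\<close>; suitable combinations give \<open>r\<close> and
  \<open>\<eta>\<close>.\<close>

lemma large_case:
  assumes eps: "\<And>i l. i \<noteq> l \<Longrightarrow> \<bar>C $ i $ l\<bar> \<le> \<epsilon>" "0 \<le> \<epsilon>"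
    and th1: "\<epsilon> * (real CARD('p) - 1) < 1" and kap: "2 * \<kappa> * (\<epsilon> * (real CARD('p) - 1))\<^sup>2 < 1"
  shows "k j = 0" and "d1 i = d2 i"
proof -
  define \<theta> where "\<theta> = \<epsilon> * (real CARD('p) - 1)"
  have th: "0 \<le> \<theta>" "\<theta> < 1" using eps(2) th1 by (auto simp: \<theta>_def Suc_leI)
  \<comment> \<open>The largest multiple of the identity that the form bound on
    \<open>C - mat 1\<close> allows to be removed; the product with \<open>H\<close> does not change
    because \<open>H\<close> has zero diagonal.\<close>
  define B where "B = C - (1 - \<theta>) *\<^sub>R mat 1"
  have B_sym: "transpose B = B"
    by (simp add: B_def vec_eq_iff transpose_def C_swap mat_def)
  let ?n = "\<lambda>x::'p \<Rightarrow> real. \<Sum>i\<in>UNIV. (x i)\<^sup>2"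
  have B_eq: "bil B x x = bil (C - mat 1) x x + \<theta> * ?n x" for x
    unfolding B_def bil_diff_mat bil_scaleR_mat bil_mat_1 by (simp add: power2_eq_square algebra_simps)
  have off: "\<bar>bil (C - mat 1) x x\<bar> \<le> \<theta> * ?n x" for x
    unfolding \<theta>_def by (rule offdiag_form_bound) (auto simp: mat_def C_diag eps)
  have B_psd: "0 \<le> bil B x x" and B_le: "bil B x x \<le> 2 * \<theta> * ?n x" for x
    using off[of x, unfolded abs_le_iff] B_eq[of x] by linarith+
  have Hd: "H $ i $ i = 0" for i using H_diag[of i] by (simp add: H_def power2_eq_square mult_ac)
  have BH: "hadamard B H = hadamard C H"
    using Hd by (auto simp: vec_eq_iff B_def mat_def)
  have "Rb $ i $ i = 2" for i using Rb_diag[of i] by (simp add: Rb_def power2_eq_square mult_ac)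
  then have "hadamard B Rb = hadamard C Rb - (2 * (1 - \<theta>)) *\<^sub>R mat 1"
    by (auto simp: vec_eq_iff B_def mat_def algebra_simps)
  then have BR: "bil (hadamard B Rb) x x = bil (hadamard C Rb) x x - 2 * (1 - \<theta>) * ?n x" for x
    by (simp add: bil_diff_mat bil_scaleR_mat bil_mat_1 power2_eq_square)
  \<comment> \<open>Stationarity bounds the squares of \<open>d1\<close> and \<open>d2\<close> by
    \<open>a / (1 - \<theta>)\<close>, so the weights \<open>a / (d1 i * d2 i)\<close> in
    \<open>Y\<close> are at least \<open>1 - \<theta>\<close>.\<close>
  have Y_ge: "2 * (1 - \<theta>) * ?n \<delta> \<le> Y"
  proof -
    have ent: "\<bar>hadamard C (congr_diag W g) $ i $ l\<bar> \<le> \<epsilon>"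
      if "unit_diagonal (congr_diag W g)" "\<And>j. 0 \<le> g j" "i \<noteq> l" for g i l
      using mult_mono[OF eps(1)[OF that(3)] congr_diag_entry_le_1[OF that(1,2), of i l]] eps(2)
      by (simp add: abs_mult del: congr_diag_nth)
    have nn: "0 \<le> (1 + k j) / 2" "0 \<le> (1 - k j) / 2" for j using k1[of j] by auto
    have b1: "(d1 i)\<^sup>2 * (1 - \<theta>) \<le> a" for i unfolding \<theta>_def
      using ud1 th by (intro stationary_bound[OF _ ent[OF ud1 nn(1)] eps(2) pos1 st1])
        (auto simp: unit_diagonal_def C_diag \<theta>_def simp del: congr_diag_nth)
    have b2: "(d2 i)\<^sup>2 * (1 - \<theta>) \<le> a" for i unfolding \<theta>_def
      using ud2 th by (intro stationary_bound[OF _ ent[OF ud2 nn(2)] eps(2) pos2 st2])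
        (auto simp: unit_diagonal_def C_diag \<theta>_def simp del: congr_diag_nth)
    have "(1 - \<theta>) * (\<delta> i)\<^sup>2 \<le> a * ((\<delta> i)\<^sup>2 / (d1 i * d2 i))" for i
    proof -
      have "(d1 i * d2 i) * (1 - \<theta>) \<le> (((d1 i)\<^sup>2 + (d2 i)\<^sup>2) / 2) * (1 - \<theta>)"
        using sum_squares_bound[of "d1 i" "d2 i"] th by (intro mult_right_mono) auto
      also have "\<dots> \<le> a" using b1[of i] b2[of i] by (simp add: field_simps)
      finally have "(1 - \<theta>) \<le> a / (d1 i * d2 i)"
        using pos1[of i] pos2[of i] by (simp add: le_divide_eq mult_ac)
      from mult_right_mono[OF this, of "(\<delta> i)\<^sup>2"] show ?thesis by simp
    qed
    then have "(\<Sum>i\<in>UNIV. (1 - \<theta>) * (\<delta> i)\<^sup>2) \<le> (\<Sum>i\<in>UNIV. a * ((\<delta> i)\<^sup>2 / (d1 i * d2 i)))"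
      by (intro sum_mono)
    then have "(1 - \<theta>) * ?n \<delta> \<le> a * (\<Sum>i\<in>UNIV. (\<delta> i)\<^sup>2 / (d1 i * d2 i))"
      by (simp only: sum_distrib_left)
    then show ?thesis unfolding Y_def by linarith
  qed
  have "T \<le> 2 * \<kappa> * \<theta>\<^sup>2 * L"
  proof (cases "\<forall>j. k j = 0")
    case True
    then have "H = 0" by (simp add: H_def vec_eq_iff)
    then have "T = 0" by (simp add: T_def bil_def)
    then show ?thesis using L_nonneg \<kappa>_nonneg by simp
  next
    case False
    then obtain jp jm where jpm: "0 < k jp" "k jm < 0" "\<And>j. k j \<le> k jp" "\<And>j. k jm \<le> k j"
      using extremal_k by blast
    define \<tau> where "\<tau> = max (k jp) (- k jm)"
    define \<sigma> where "\<sigma> = min (k jp) (- k jm)"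
    have ts: "0 < \<sigma>" "\<sigma> \<le> \<tau>" "\<tau> < 1"
      using jpm k1[of jp] k1[of jm] by (auto simp: \<tau>_def \<sigma>_def)
    have \<tau>: "\<bar>k j\<bar> \<le> \<tau>" for j using jpm(3,4)[of j] by (auto simp: \<tau>_def)
    define z where "z = 2 * \<sigma> / (\<tau> + \<sigma>)"
    have z: "0 < z" using ts by (simp add: z_def)
    have hm: "2 * k jp * (- k jm) / (k jp + (- k jm)) = z * \<tau>"
      by (auto simp: z_def \<tau>_def \<sigma>_def max_def min_def mult_ac add_ac)
    have diag_le: "(\<Sum>j\<in>UNIV. \<bar>k j\<bar> * (W $ i $ j)\<^sup>2) \<le> 2 * (z * \<tau>)" for i
      using abs_diag_le[of "k jp" "- k jm" i] jpm unfolding hm by simp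
    let ?g = "\<lambda>x. \<Sum>j\<in>UNIV. \<bar>k j\<bar> * bil B (\<lambda>i. W $ i $ j * x i) (\<lambda>i. W $ i $ j * x i)"
    have "?g x \<le> \<tau> * bil (hadamard B Rb) x x" for x
      unfolding Rb_def bil_hadamard_congr_diag sum_distrib_left
      by (intro sum_mono) (auto intro!: mult_right_mono \<tau> B_psd)
    then have ga: "?g x \<le> \<tau> * (bil (hadamard C Rb) x x - 2 * (1 - \<theta>) * ?n x)" for x
      by (simp only: BR)
    \<comment> \<open>The upper bound on \<open>B\<close> reduces the sum to the diagonal entries
      bounded in \<open>diag_le\<close>, where the harmonic mean enters.\<close>
    have gb: "?g x \<le> 4 * \<theta> * z * \<tau> * ?n x" for x
    proof -
      have "?g x \<le> (\<Sum>j\<in>UNIV. \<bar>k j\<bar> * (2 * \<theta> * ?n (\<lambda>i. W $ i $ j * x i)))"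
        by (intro sum_mono mult_left_mono B_le) auto
      also have "\<dots> = (\<Sum>j\<in>UNIV. \<Sum>i\<in>UNIV. 2 * \<theta> * (x i)\<^sup>2 * (\<bar>k j\<bar> * (W $ i $ j)\<^sup>2))"
        by (simp add: sum_distrib_left power_mult_distrib mult_ac)
      also have "\<dots> = (\<Sum>i\<in>UNIV. 2 * \<theta> * (x i)\<^sup>2 * (\<Sum>j\<in>UNIV. \<bar>k j\<bar> * (W $ i $ j)\<^sup>2))"
        by (subst sum.swap) (simp add: sum_distrib_left)
      also have "\<dots> \<le> (\<Sum>i\<in>UNIV. 2 * \<theta> * (x i)\<^sup>2 * (2 * (z * \<tau>)))"
        using th by (intro sum_mono mult_left_mono diag_le) auto
      also have "\<dots> = 4 * \<theta> * z * \<tau> * ?n x" by (simp add: sum_distrib_left mult_ac)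
      finally show ?thesis .
    qed
    define E where "E = \<theta> * z + (1 - \<theta>)"
    define F where "F = 2 * \<theta> * z + (1 - \<theta>)"
    have EF: "0 < E" "0 < F" using th z by (auto simp: E_def F_def add_nonneg_pos)
    define r where "r = \<theta> * z / E"
    define \<eta> where "\<eta> = 2 * \<theta> * z / F"
    have re: "0 \<le> r" "0 \<le> \<eta>" using th z EF by (auto simp: r_def \<eta>_def)
    have main: "T * (1 - \<eta> * \<tau>\<^sup>2) \<le> 8 * \<kappa> * r * \<eta> * \<tau>\<^sup>2"
    proof (rule gap_upper_bound[OF T_XY S_eq X_nonneg Y_nonneg _ \<kappa>_nonneg re _ T_sq_le[OF B_psd B_sym BH]])
      show "0 \<le> ?g \<delta>" by (intro sum_nonneg mult_nonneg_nonneg B_psd) auto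
      show "0 \<le> \<tau>" using ts by linarith
      have "0 \<le> \<tau> * (2 * (1 - \<theta>) * ?n \<delta>)" using th \<open>0 \<le> \<tau>\<close> by (intro mult_nonneg_nonneg sum_nonneg) auto
      then show "?g \<delta> \<le> \<tau> * X" using ga[of \<delta>] by (simp add: X_def right_diff_distrib)
      \<comment> \<open>With weights \<open>\<theta> * z\<close> on \<open>ga\<close> and
        \<open>1 - \<theta>\<close> on \<open>gb\<close>, the norm terms combine to
        \<open>2 * (1 - \<theta>) * ?n \<delta>\<close>, just what \<open>Y\<close> absorbs.\<close>
      have "E * ?g \<delta> = \<theta> * z * ?g \<delta> + (1 - \<theta>) * ?g \<delta>" by (simp add: E_def algebra_simps)
      also have "\<dots> \<le> \<theta> * z * (\<tau> * (X - 2 * (1 - \<theta>) * ?n \<delta>)) + (1 - \<theta>) * (4 * \<theta> * z * \<tau> * ?n \<delta>)"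
        using ga[of \<delta>] gb[of \<delta>] th z unfolding X_def by (intro add_mono mult_left_mono) auto
      also have "\<dots> = \<theta> * z * \<tau> * (X + 2 * (1 - \<theta>) * ?n \<delta>)" by (simp add: algebra_simps)
      also have "\<dots> \<le> \<theta> * z * \<tau> * T"
        using Y_ge T_XY th z ts by (intro mult_left_mono) auto
      finally have "?g \<delta> \<le> \<theta> * z * \<tau> * T / E" using EF by (simp add: le_divide_eq mult_ac)
      then show "?g \<delta> \<le> r * \<tau> * T" by (simp add: r_def)
      \<comment> \<open>Doubling the weight of \<open>ga\<close> makes the norm terms cancel
        completely, since no analogue of \<open>Y\<close> is at hand to absorb a remainder in
        \<open>s\<close>.\<close>
      have "F * ?g s = 2 * \<theta> * z * ?g s + (1 - \<theta>) * ?g s" by (simp add: F_def algebra_simps)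
      also have "\<dots> \<le> 2 * \<theta> * z * (\<tau> * (S - 2 * (1 - \<theta>) * ?n s)) + (1 - \<theta>) * (4 * \<theta> * z * \<tau> * ?n s)"
        using ga[of s] gb[of s] th z unfolding S_def by (intro add_mono mult_left_mono) auto
      also have "\<dots> = 2 * \<theta> * z * \<tau> * S" by (simp add: algebra_simps)
      finally have "?g s \<le> 2 * \<theta> * z * \<tau> * S / F" using EF by (simp add: le_divide_eq mult_ac)
      then show "?g s \<le> \<eta> * \<tau> * S" by (simp add: \<eta>_def)
    qed
    let ?Q = "\<tau>\<^sup>2 / (1 - \<tau>\<^sup>2) + \<sigma>\<^sup>2 / (1 - \<sigma>\<^sup>2)"
    have "r * \<eta> * \<tau>\<^sup>2 \<le> \<theta>\<^sup>2 * (1 - \<eta> * \<tau>\<^sup>2) * ?Q"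
      unfolding r_def \<eta>_def E_def F_def z_def by (rule large_ratio_inequality[OF th ts])
    then have "8 * \<kappa> * (r * \<eta> * \<tau>\<^sup>2) \<le> 8 * \<kappa> * (\<theta>\<^sup>2 * (1 - \<eta> * \<tau>\<^sup>2) * ?Q)"
      using \<kappa>_nonneg by (intro mult_left_mono) auto
    then have "T * (1 - \<eta> * \<tau>\<^sup>2) \<le> (2 * \<kappa> * \<theta>\<^sup>2 * (4 * ?Q)) * (1 - \<eta> * \<tau>\<^sup>2)"
    proof -
      have "8 * \<kappa> * (\<theta>\<^sup>2 * x * q) = (2 * \<kappa> * \<theta>\<^sup>2 * (4 * q)) * x" for x q by simp
      then show ?thesis
        using main \<open>8 * \<kappa> * (r * \<eta> * \<tau>\<^sup>2) \<le> _\<close> by (simp only: mult.assoc)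
    qed
    moreover have "0 < 1 - \<eta> * \<tau>\<^sup>2"
    proof -
      have "\<eta> \<le> 1" using EF th by (simp add: \<eta>_def) (simp add: F_def)
      moreover have "\<tau>\<^sup>2 < 1" using ts by (simp add: power_less_one_iff)
      ultimately show ?thesis using re(2) mult_right_mono[of \<eta> 1 "\<tau>\<^sup>2"] by simp
    qed
    ultimately have "T \<le> 2 * \<kappa> * \<theta>\<^sup>2 * (4 * ?Q)" by simp
    also have "\<dots> \<le> 2 * \<kappa> * \<theta>\<^sup>2 * L"
    proof -
      \<comment> \<open>The extreme values have opposite signs, so both of their terms may be
        counted in \<open>L\<close>.\<close>
      have ne: "jp \<noteq> jm" using jpm by auto
      have "?Q = (\<Sum>j\<in>{jp, jm}. (k j)\<^sup>2 / (1 - (k j)\<^sup>2))"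
        using ne by (auto simp: \<tau>_def \<sigma>_def max_def min_def)
      also have "\<dots> \<le> (\<Sum>j\<in>UNIV. (k j)\<^sup>2 / (1 - (k j)\<^sup>2))"
        by (intro sum_mono2 L_term) auto
      finally show ?thesis using \<kappa>_nonneg unfolding L_def by (intro mult_left_mono) auto
    qed
    finally show ?thesis .
  qed
  moreover have "2 * \<kappa> * \<theta>\<^sup>2 < 1" using kap by (simp add: \<theta>_def)
  ultimately show "k j = 0" and "d1 i = d2 i" using coincide[of "2 * \<kappa> * \<theta>\<^sup>2"] by auto
qed

end

section \<open>First-order conditions along paths\<close>

lemma ln_prod_pos:
  fixes f :: "'a \<Rightarrow> real"
  assumes "finite I" "\<And>i. 0 < f i"
  shows "ln (\<Prod>i\<in>I. f i) = (\<Sum>i\<in>I. ln (f i))"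
proof (rule ln_prod[OF assms(1)])
  show "f i \<noteq> 0" for i using assms(2)[of i] by simp
qed

text \<open>The differentiable function \<open>G\<close> only has to majorize \<open>f\<close> along
  the curve and touch it at the start. This admits the nonsmooth penalty, for which \<open>G\<close>
  uses a chord.\<close>

lemma local_minimum_curve:
  fixes \<gamma> :: "real \<Rightarrow> 'a::topological_space" and G :: "real \<Rightarrow> real"
  assumes lm: "local_minimum_on f A x" and lim: "(\<gamma> \<longlongrightarrow> x) (at_right 0)"
    and le: "\<forall>\<^sub>F t in at_right 0. \<gamma> t \<in> A \<and> f (\<gamma> t) \<le> G t"
    and G0: "G 0 = f x" and deriv: "(G has_real_derivative g) (at 0)"
  shows "0 \<le> g"
proof (rule ccontr)
  assume "\<not> 0 \<le> g"
  then have "g < 0" by simp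
  from DERIV_neg_dec_right[OF deriv this]
  obtain e where e: "e > 0" "\<And>h. 0 < h \<Longrightarrow> h < e \<Longrightarrow> G h < G 0" by auto
  have "\<forall>\<^sub>F y in nhds x. y \<in> A \<longrightarrow> f x \<le> f y"
    using lm unfolding local_minimum_on_def eventually_at_filter
    by (auto elim!: eventually_mono)
  then have "\<forall>\<^sub>F t in at_right 0. \<gamma> t \<in> A \<longrightarrow> f x \<le> f (\<gamma> t)"
    using lim unfolding filterlim_iff by blast
  moreover have "\<forall>\<^sub>F t in at_right 0. G t < G 0"
    using e by (intro eventually_at_rightI[of 0 e]) auto
  ultimately have "\<forall>\<^sub>F t in at_right (0::real). False"
    using le by eventually_elim (use G0 in auto)
  then show False by simp
qed

section \<open>The objective in coordinates\<close>

definition diag_mat :: "('p \<Rightarrow> real) \<Rightarrow> real^'p^'p" where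
  "diag_mat d = (\<chi> i j. if i = j then d i else 0)"

definition dg :: "real^'p^'p \<Rightarrow> 'p \<Rightarrow> real" where
  "dg A i = A $ i $ i"

lemma Diag_plus_pos: "D \<in> Diag_plus \<Longrightarrow> 0 < dg D i"
  by (simp add: Diag_plus_def dg_def)

lemma Diag_plus_eq: "D \<in> Diag_plus \<Longrightarrow> D = diag_mat (dg D)"
  by (auto simp: Diag_plus_def dg_def diag_mat_def vec_eq_iff)

lemma diag_mat_in_Diag_plus: "(\<And>i. 0 < d i) \<Longrightarrow> diag_mat d \<in> Diag_plus"
  by (simp add: Diag_plus_def diag_mat_def)

definition off :: "real^'p^'p \<Rightarrow> real" where
  "off A = (\<Sum>i\<in>UNIV. \<Sum>l\<in>UNIV. if i = l then 0 else \<bar>A $ i $ l\<bar>)"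

lemma norm1_off_eq: "norm1_off A = off A"
proof -
  have "norm1_off A = (\<Sum>(i, l)\<in>UNIV. if i = l then 0 else \<bar>A $ i $ l\<bar>)"
    unfolding norm1_off_def by (intro sum.mono_neutral_cong_left) (auto split: if_splits)
  then show ?thesis
    by (simp add: off_def sum.cartesian_product)
qed

lemma trace_mult_diag:
  fixes C R :: "real^'p^'p"
  assumes "transpose R = R"
  shows "trace (C ** diag_mat d ** R ** diag_mat d) = bil (hadamard C R) d d"
proof -
  have R: "R $ l $ i = R $ i $ l" for i l using assms by (metis transpose_def vec_lambda_beta)
  have "(A ** diag_mat d) $ i $ l = A $ i $ l * d l" for A :: "real^'p^'p" and i l
    by (simp add: matrix_matrix_mult_def diag_mat_def if_distrib cong: if_cong)
  then have "(C ** diag_mat d ** R ** diag_mat d) $ i $ i = (\<Sum>l\<in>UNIV. C $ i $ l * d l * R $ l $ i) * d i" for i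
    by (simp add: matrix_matrix_mult_def[of "C ** diag_mat d" R])
  then show ?thesis
    by (simp add: trace_def bil_def R sum_distrib_right sum_distrib_left mult_ac)
qed

lemma ln_det_diag_mat:
  assumes "\<And>i. 0 < d i"
  shows "ln (det (diag_mat d)) = (\<Sum>i\<in>UNIV. ln (d i))"
proof -
  have "det (diag_mat d) = (\<Prod>i\<in>UNIV. d i)"
    unfolding diag_mat_def by (subst det_diagonal) auto
  moreover have "ln (\<Prod>i\<in>UNIV. d i) = (\<Sum>i\<in>UNIV. ln (d i))"
    using assms by (intro ln_prod_pos) auto
  ultimately show ?thesis by simp
qed

lemma objective_eq:
  assumes "transpose R = R" "\<And>i. 0 < d i"
  shows "objective C lam \<alpha> (R, diag_mat d)
    = - ln (det R) - 2 * (1 - \<alpha>) * (\<Sum>i\<in>UNIV. ln (d i)) + bil (hadamard C R) d d + lam * off R"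
  by (simp add: objective_def ln_det_diag_mat assms trace_mult_diag norm1_off_eq)

lemma transpose_congr_diag: "transpose (congr_diag W k) = congr_diag W k"
  by (simp add: vec_eq_iff transpose_def mult_ac)

lemma sym_pos_def_congr_diag:
  fixes W :: "real^'p^'p"
  assumes W: "det W \<noteq> 0" and g: "\<And>j. 0 < g j"
  shows "sym_pos_def (congr_diag W g)"
  unfolding sym_pos_def_def transpose_congr_diag congr_diag_quadratic
proof (intro conjI refl allI impI)
  fix x :: "real^'p"
  assume "x \<noteq> 0"
  have inv: "invertible (transpose W)" using W by (simp add: invertible_det_nz det_transpose)
  have "transpose W *v x \<noteq> 0"
    using \<open>x \<noteq> 0\<close> inv by (metis invertible_def matrix_vector_mul_assoc matrix_vector_mul_lid matrix_vector_mult_0_right)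
  then obtain j where "(\<Sum>i\<in>UNIV. W $ i $ j * x $ i) \<noteq> 0"
    by (auto simp: vec_eq_iff matrix_vector_mult_def transpose_def)
  then have "0 < g j * (\<Sum>i\<in>UNIV. W $ i $ j * x $ i)\<^sup>2" using g by simp
  also have "\<dots> \<le> (\<Sum>j\<in>UNIV. g j * (\<Sum>i\<in>UNIV. W $ i $ j * x $ i)\<^sup>2)"
    using g by (intro member_le_sum) (auto simp: less_imp_le)
  finally show "0 < (\<Sum>j\<in>UNIV. g j * (\<Sum>i\<in>UNIV. W $ i $ j * x $ i)\<^sup>2)" .
qed

lemma ln_det_congr_diag:
  assumes W: "det W \<noteq> 0" and g: "\<And>j. 0 < g j"
  shows "ln (det (congr_diag W g)) = ln ((det W)\<^sup>2) + (\<Sum>j\<in>UNIV. ln (g j))"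
proof -
  have "0 < (\<Prod>j\<in>UNIV. g j)" using g by (intro prod_pos) auto
  moreover have "ln (\<Prod>j\<in>UNIV. g j) = (\<Sum>j\<in>UNIV. ln (g j))"
    using g by (intro ln_prod_pos) auto
  ultimately show ?thesis using W by (simp add: det_congr_diag ln_mult_pos)
qed

lemma tendsto_mat:
  fixes F :: "'b \<Rightarrow> real^'p^'q"
  assumes "\<And>i l. ((\<lambda>t. F t $ i $ l) \<longlongrightarrow> A $ i $ l) net"
  shows "(F \<longlongrightarrow> A) net"
  by (intro vec_tendstoI assms)

section \<open>First-order conditions in \<open>R\<close>, \<open>D\<close> and
  \<open>D R D\<close>\<close>

text \<open>Along the segment of coefficients from \<open>g1\<close> to \<open>g2\<close> with
  \<open>d\<close> fixed, \<open>ln det\<close> is a sum of scalar logarithms, the trace term is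
  affine, and convexity puts the penalty below its chord.\<close>

lemma local_minimum_R_direction:
  fixes W :: "real^'p^'p"
  assumes lm: "local_minimum_on (objective C lam \<alpha>) (S_pp1 \<times> Diag_plus) (congr_diag W g1, diag_mat d)"
    and R2: "unit_diagonal (congr_diag W g2)"
    and W: "det W \<noteq> 0" and g: "\<And>j. 0 < g1 j" "\<And>j. 0 < g2 j" and d: "\<And>i. 0 < d i" and lam: "0 \<le> lam"
  shows "0 \<le> - (\<Sum>j\<in>UNIV. (g2 j - g1 j) / g1 j)
     + (bil (hadamard C (congr_diag W g2)) d d - bil (hadamard C (congr_diag W g1)) d d)
     + lam * (off (congr_diag W g2) - off (congr_diag W g1))"
proof -
  define g where "g t j = (1 - t) * g1 j + t * g2 j" for t j
  let ?b = "\<lambda>g. bil (hadamard C (congr_diag W g)) d d"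
  let ?o = "\<lambda>g. off (congr_diag W g)"
  define G where "G t = - (ln ((det W)\<^sup>2) + (\<Sum>j\<in>UNIV. ln (g t j))) - 2 * (1 - \<alpha>) * (\<Sum>i\<in>UNIV. ln (d i))
      + ((1 - t) * ?b g1 + t * ?b g2) + lam * ((1 - t) * ?o g1 + t * ?o g2)" for t
  have R1: "unit_diagonal (congr_diag W g1)" using lm by (simp add: local_minimum_on_def S_pp1_def)
  have ent: "congr_diag W (g t) $ i $ l = (1 - t) * congr_diag W g1 $ i $ l + t * congr_diag W g2 $ i $ l" for t i l
    by (simp add: g_def algebra_simps sum.distrib sum_subtractf sum_distrib_left)
  have gpos: "0 < g t j" if "0 \<le> t" "t < 1" for t j
    unfolding g_def using g that by (intro add_pos_nonneg mult_pos_pos mult_nonneg_nonneg) (auto simp: less_imp_le)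
  show ?thesis
  proof (rule local_minimum_curve[OF lm, where \<gamma> = "\<lambda>t. (congr_diag W (g t), diag_mat d)" and G = G])
    show "((\<lambda>t. (congr_diag W (g t), diag_mat d)) \<longlongrightarrow> (congr_diag W g1, diag_mat d)) (at_right 0)"
    proof (intro tendsto_Pair tendsto_const tendsto_mat)
      fix i l
      have "((\<lambda>t. congr_diag W (g t) $ i $ l) \<longlongrightarrow>
           (1 - 0) * congr_diag W g1 $ i $ l + 0 * congr_diag W g2 $ i $ l) (at_right 0)"
        unfolding ent by (intro tendsto_intros)
      then show "((\<lambda>t. congr_diag W (g t) $ i $ l) \<longlongrightarrow> congr_diag W g1 $ i $ l) (at_right 0)"
        by simp
    qed
    show "\<forall>\<^sub>F t in at_right 0. (congr_diag W (g t), diag_mat d) \<in> S_pp1 \<times> Diag_plus \<and>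
        objective C lam \<alpha> (congr_diag W (g t), diag_mat d) \<le> G t"
    proof (rule eventually_at_rightI[of 0 1])
      fix t :: real assume "t \<in> {0<..<1}"
      then have t: "0 \<le> t" "t < 1" by auto
      have "unit_diagonal (congr_diag W (g t))"
        using R1 R2 unfolding unit_diagonal_def ent by (simp del: congr_diag_nth)
      then have "(congr_diag W (g t), diag_mat d) \<in> S_pp1 \<times> Diag_plus"
        using sym_pos_def_congr_diag[OF W gpos[OF t]] diag_mat_in_Diag_plus[OF d] by (simp add: S_pp1_def)
      moreover have "?b (g t) = (1 - t) * ?b g1 + t * ?b g2"
        unfolding bil_def hadamard_nth ent
        by (simp add: sum_distrib_left algebra_simps del: congr_diag_nth flip: sum.distrib sum_subtractf)
      moreover have "?o (g t) \<le> (1 - t) * ?o g1 + t * ?o g2"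
      proof -
        have "\<bar>(1 - t) * x + t * y\<bar> \<le> (1 - t) * \<bar>x\<bar> + t * \<bar>y\<bar>" for x y :: real
          using t abs_triangle_ineq[of "(1 - t) * x" "t * y"] by (simp add: abs_mult)
        then have "?o (g t) \<le> (\<Sum>i\<in>UNIV. \<Sum>l\<in>UNIV. (1 - t) * (if i = l then 0 else \<bar>congr_diag W g1 $ i $ l\<bar>)
            + t * (if i = l then 0 else \<bar>congr_diag W g2 $ i $ l\<bar>))"
          unfolding off_def ent by (intro sum_mono) (auto simp del: congr_diag_nth)
        then show ?thesis
          unfolding off_def sum_distrib_left sum.distrib[symmetric] .
      qed
      then have "lam * ?o (g t) \<le> lam * ((1 - t) * ?o g1 + t * ?o g2)" using lam by (intro mult_left_mono)
      ultimately show "(congr_diag W (g t), diag_mat d) \<in> S_pp1 \<times> Diag_plus \<and>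
          objective C lam \<alpha> (congr_diag W (g t), diag_mat d) \<le> G t"
        by (simp add: objective_eq[OF transpose_congr_diag d] ln_det_congr_diag[OF W gpos[OF t]] G_def)
    qed auto
    show "G 0 = objective C lam \<alpha> (congr_diag W g1, diag_mat d)"
      by (simp add: objective_eq[OF transpose_congr_diag d] ln_det_congr_diag[OF W g(1)] G_def g_def)
    show "(G has_real_derivative - (\<Sum>j\<in>UNIV. (g2 j - g1 j) / g1 j)
     + (?b g2 - ?b g1) + lam * (?o g2 - ?o g1)) (at 0)"
      unfolding G_def[abs_def] g_def using g
      by (auto intro!: derivative_eq_intros simp: less_imp_neq[symmetric] sum_negf[symmetric] intro!: sum.cong)
  qed
qed

text \<open>Only coordinate \<open>i\<close> of \<open>d\<close> is moved. The derivative is linear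
  in the speed \<open>c\<close>, so \<open>c = 1\<close> and \<open>c = -1\<close> together make it
  vanish.\<close>

lemma local_minimum_stationary:
  fixes R :: "real^'p^'p"
  assumes lm: "local_minimum_on (objective C lam \<alpha>) (S_pp1 \<times> Diag_plus) (R, diag_mat d)"
    and d: "\<And>i. 0 < d i" and C: "transpose C = C"
  shows "d i * (\<Sum>l\<in>UNIV. hadamard C R $ i $ l * d l) = 1 - \<alpha>"
proof -
  have R: "R \<in> S_pp1" using lm by (simp add: local_minimum_on_def)
  then have Rs: "transpose R = R" by (simp add: S_pp1_def sym_pos_def_def)
  have Ms: "transpose (hadamard C R) = hadamard C R"
    by (rule transpose_hadamard[OF C Rs])
  define u where "u l = (if l = i then 1 else 0 :: real)" for l
  define M where "M = (\<Sum>l\<in>UNIV. hadamard C R $ i $ l * d l)"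
  have bu: "bil (hadamard C R) u d = M"
    by (simp add: bil_def u_def M_def if_distrib if_distribR sum.If_cases flip: sum_distrib_left cong: if_cong)
  have "0 \<le> c * (2 * M - 2 * (1 - \<alpha>) / d i)" for c
  proof -
    define e where "e t l = d l + t * (c * u l)" for t l
    define G where "G t = - ln (det R) - 2 * (1 - \<alpha>) * (\<Sum>l\<in>UNIV. ln (e t l))
      + (bil (hadamard C R) d d + 2 * t * c * M + t\<^sup>2 * (c\<^sup>2 * bil (hadamard C R) u u)) + lam * off R" for t
    show ?thesis
    proof (rule local_minimum_curve[OF lm, where \<gamma> = "\<lambda>t. (R, diag_mat (e t))" and G = G])
      have lime: "((\<lambda>t. e t l) \<longlongrightarrow> d l) (at_right 0)" for l
      proof -
        have "((\<lambda>t. e t l) \<longlongrightarrow> d l + 0 * (c * u l)) (at_right 0)"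
          unfolding e_def by (intro tendsto_intros)
        then show ?thesis by simp
      qed
      show "((\<lambda>t. (R, diag_mat (e t))) \<longlongrightarrow> (R, diag_mat d)) (at_right 0)"
        by (intro tendsto_Pair tendsto_const tendsto_mat) (auto simp: diag_mat_def lime)
      have "\<forall>\<^sub>F t in at_right 0. \<forall>l\<in>UNIV. 0 < e t l"
        by (intro eventually_ball_finite ballI order_tendstoD(1)[OF lime d]) auto
      then show "\<forall>\<^sub>F t in at_right 0. (R, diag_mat (e t)) \<in> S_pp1 \<times> Diag_plus \<and>
          objective C lam \<alpha> (R, diag_mat (e t)) \<le> G t"
      proof eventually_elim
        case (elim t)
        then have p: "\<And>l. 0 < e t l" by simp
        have "bil (hadamard C R) (e t) (e t)
            = bil (hadamard C R) d d + 2 * t * c * M + t\<^sup>2 * (c\<^sup>2 * bil (hadamard C R) u u)"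
          unfolding e_def bil_add_left bil_add_right bil_scale_left bil_scale_right
          using bu bil_sym[OF Ms, of d u] by (simp add: power2_eq_square algebra_simps)
        then show ?case
          using R diag_mat_in_Diag_plus[OF p] by (simp add: objective_eq[OF Rs p] G_def)
      qed
      show "G 0 = objective C lam \<alpha> (R, diag_mat d)"
        by (simp add: objective_eq[OF Rs d] G_def e_def)
      have "(\<Sum>l\<in>UNIV. c * u l / d l) = c / d i"
        by (simp add: u_def if_distrib if_distribR cong: if_cong)
      then show "(G has_real_derivative c * (2 * M - 2 * (1 - \<alpha>) / d i)) (at 0)"
        unfolding G_def[abs_def] e_def using d
        by (auto intro!: derivative_eq_intros simp: less_imp_neq[symmetric]) (simp add: algebra_simps)
    qed
  qed
  from this[of 1] this[of "-1"] have "2 * M = 2 * (1 - \<alpha>) / d i" by simp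
  then have "M * d i = 1 - \<alpha>" using d[of i] by (simp add: field_simps)
  then show ?thesis by (simp add: M_def mult.commute)
qed

text \<open>Derivative of one penalty entry when \<open>D R D\<close> moves along a segment and
  \<open>R\<close> is recovered by dividing by the square roots of the moving diagonal.\<close>

lemma scaled_entry_derivative:
  fixes x y u v u' v' :: real
  assumes "0 < u" "0 < v"
  shows "((\<lambda>t. ((1 - t) * (x * u * v) + t * (y * u' * v')) /
      (sqrt ((1 - t) * u\<^sup>2 + t * u'\<^sup>2) * sqrt ((1 - t) * v\<^sup>2 + t * v'\<^sup>2)))
    has_real_derivative y * (u' / u) * (v' / v) - x * ((u' / u)\<^sup>2 + (v' / v)\<^sup>2) / 2) (at 0)"
  using assms
  by (auto intro!: derivative_eq_intros) (simp add: field_simps power2_eq_square)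

text \<open>In the variable \<open>S = D R D\<close> the trace term is affine, and the determinants
  combine to \<open>- ln det S + 2 \<alpha> \<Sum> ln e\<close> with \<open>e\<close> the roots of
  the diagonal of \<open>S\<close>. Only the \<open>\<alpha>\<close> term and the penalty feel the
  normalization by \<open>e\<close>.\<close>

lemma local_minimum_S_direction:
  fixes W :: "real^'p^'p"
  assumes lm: "local_minimum_on (objective C lam \<alpha>) (S_pp1 \<times> Diag_plus) (R1, diag_mat d1)"
    and R2: "R2 \<in> S_pp1"
    and S1: "\<And>i l. congr_diag W g1 $ i $ l = R1 $ i $ l * d1 i * d1 l"
    and S2: "\<And>i l. congr_diag W g2 $ i $ l = R2 $ i $ l * d2 i * d2 l"
    and W: "det W \<noteq> 0" and g: "\<And>j. 0 < g1 j" "\<And>j. 0 < g2 j"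
    and d1: "\<And>i. 0 < d1 i" and d2: "\<And>i. 0 < d2 i" and lam: "0 \<le> lam"
  shows "0 \<le> - (\<Sum>j\<in>UNIV. (g2 j - g1 j) / g1 j) + \<alpha> * (\<Sum>i\<in>UNIV. (d2 i / d1 i)\<^sup>2 - 1)
     + (bil (hadamard C R2) d2 d2 - bil (hadamard C R1) d1 d1)
     + lam * (\<Sum>i\<in>UNIV. \<Sum>l\<in>UNIV. if i = l then 0 else
          \<bar>R2 $ i $ l\<bar> * (d2 i / d1 i) * (d2 l / d1 l) - \<bar>R1 $ i $ l\<bar> * ((d2 i / d1 i)\<^sup>2 + (d2 l / d1 l)\<^sup>2) / 2)"
proof -
  define g where "g t j = (1 - t) * g1 j + t * g2 j" for t j
  define e where "e t i = sqrt ((1 - t) * (d1 i)\<^sup>2 + t * (d2 i)\<^sup>2)" for t i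
  \<comment> \<open>Dividing row \<open>i\<close> of \<open>W\<close> by \<open>e t i\<close> turns
    the congruence for \<open>S\<close> into one for the normalized matrix
    \<open>R t\<close>.\<close>
  define V where "V t = (\<chi> i j. W $ i $ j / e t i)" for t
  define R where "R t = congr_diag (V t) (g t)" for t
  have R1: "R1 \<in> S_pp1" using lm by (simp add: local_minimum_on_def)
  have ud: "R1 $ i $ i = 1" "R2 $ i $ i = 1" for i
    using R1 R2 by (auto simp: S_pp1_def unit_diagonal_def)
  let ?b = "\<lambda>R d. bil (hadamard C R) d d"
  \<comment> \<open>The triangle inequality is used in the numerator only; the normalizing
    denominator stays exact, so this majorant agrees with the penalty entry at
    \<open>t = 0\<close>.\<close>
  let ?n = "\<lambda>t i l. ((1 - t) * (\<bar>R1 $ i $ l\<bar> * d1 i * d1 l) + t * (\<bar>R2 $ i $ l\<bar> * d2 i * d2 l)) / (e t i * e t l)"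
  define G where "G t = - (ln ((det W)\<^sup>2) + (\<Sum>j\<in>UNIV. ln (g t j))) + 2 * \<alpha> * (\<Sum>i\<in>UNIV. ln (e t i))
      + ((1 - t) * ?b R1 d1 + t * ?b R2 d2) + lam * (\<Sum>i\<in>UNIV. \<Sum>l\<in>UNIV. if i = l then 0 else ?n t i l)" for t
  have epos: "0 < e t i" if "0 \<le> t" "t < 1" for t i
    unfolding e_def using d1[of i] that by (intro real_sqrt_gt_zero add_pos_nonneg mult_pos_pos mult_nonneg_nonneg) auto
  have e0: "e 0 i = d1 i" for i using d1[of i] by (simp add: e_def)
  have gpos: "0 < g t j" if "0 \<le> t" "t < 1" for t j
    unfolding g_def using g that by (intro add_pos_nonneg mult_pos_pos mult_nonneg_nonneg) (auto simp: less_imp_le)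
  have ent: "R t $ i $ l = ((1 - t) * (R1 $ i $ l * d1 i * d1 l) + t * (R2 $ i $ l * d2 i * d2 l)) / (e t i * e t l)"
    for t i l
    unfolding S1[symmetric] S2[symmetric] R_def
    by (simp add: g_def V_def algebra_simps add_divide_distrib diff_divide_distrib sum.distrib sum_subtractf
        sum_distrib_left sum_divide_distrib)
  have R0: "R 0 = R1"
    using d1 by (simp add: vec_eq_iff ent e0 less_imp_neq[symmetric])
  have detV: "det (V t) = det W / (\<Prod>i\<in>UNIV. e t i)" for t
  proof -
    have "V t = (\<chi> i. (1 / e t i) *s W $ i)" by (simp add: V_def vec_eq_iff)
    then have "det (V t) = (\<Prod>i\<in>UNIV. 1 / e t i) * det (\<chi> i. W $ i)" by (simp only: det_rows_mul)
    then show ?thesis by (simp add: prod_dividef)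
  qed
  have obj: "objective C lam \<alpha> (R t, diag_mat (e t)) \<le> G t" and inP: "R t \<in> S_pp1"
    if t: "0 \<le> t" "t < 1" for t
  proof -
    have ep: "0 < e t i" and en: "e t i \<noteq> 0" for i using epos[OF t, of i] by auto
    have pe: "0 < (\<Prod>i\<in>UNIV. e t i)" by (intro prod_pos ep)
    have dV: "det (V t) \<noteq> 0" using W pe en by (simp add: detV)
    have sq: "(e t i)\<^sup>2 = (1 - t) * (d1 i)\<^sup>2 + t * (d2 i)\<^sup>2" for i
      unfolding e_def using t by (simp add: add_nonneg_nonneg)
    have "R t $ i $ i = 1" for i
    proof -
      have "R t $ i $ i = (e t i)\<^sup>2 / (e t i * e t i)"
        unfolding ent sq by (simp add: ud power2_eq_square mult_ac)
      then show ?thesis using en[of i] by (simp add: power2_eq_square)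
    qed
    then show inP: "R t \<in> S_pp1"
      using sym_pos_def_congr_diag[OF dV gpos[OF t]] by (simp add: S_pp1_def unit_diagonal_def R_def)
    have "ln (det (R t)) = ln ((det W)\<^sup>2) - 2 * (\<Sum>i\<in>UNIV. ln (e t i)) + (\<Sum>j\<in>UNIV. ln (g t j))"
    proof -
      have "ln ((det (V t))\<^sup>2) = ln ((det W)\<^sup>2) - 2 * ln (\<Prod>i\<in>UNIV. e t i)"
        using W pe en by (simp add: detV power_divide ln_div ln_realpow)
      then show ?thesis
        unfolding R_def ln_det_congr_diag[OF dV gpos[OF t]] using ln_prod_pos[OF finite ep] by simp
    qed
    moreover have "bil (hadamard C (R t)) (e t) (e t) = (1 - t) * ?b R1 d1 + t * ?b R2 d2"
    proof -
      have *: "C $ i $ l * R t $ i $ l * e t i * e t l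
         = (1 - t) * (C $ i $ l * R1 $ i $ l * d1 i * d1 l) + t * (C $ i $ l * R2 $ i $ l * d2 i * d2 l)" for i l
        unfolding ent using en[of i] en[of l] by (simp add: field_simps)
      show ?thesis
        unfolding bil_def hadamard_nth * by (simp add: sum.distrib sum_distrib_left)
    qed
    moreover have "off (R t) \<le> (\<Sum>i\<in>UNIV. \<Sum>l\<in>UNIV. if i = l then 0 else ?n t i l)"
    proof -
      have "\<bar>R t $ i $ l\<bar> \<le> ?n t i l" for i l
      proof -
        have "\<bar>(1 - t) * (R1 $ i $ l * d1 i * d1 l) + t * (R2 $ i $ l * d2 i * d2 l)\<bar>
           \<le> (1 - t) * (\<bar>R1 $ i $ l\<bar> * d1 i * d1 l) + t * (\<bar>R2 $ i $ l\<bar> * d2 i * d2 l)"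
          using t d1[of i] d1[of l] d2[of i] d2[of l]
          by (intro order_trans[OF abs_triangle_ineq]) (simp add: abs_mult)
        from divide_right_mono[OF this, of "e t i * e t l"] show ?thesis
          unfolding ent using ep[of i] ep[of l] by (simp add: abs_mult less_imp_le)
      qed
      then show ?thesis unfolding off_def by (intro sum_mono) auto
    qed
    then have "lam * off (R t) \<le> lam * (\<Sum>i\<in>UNIV. \<Sum>l\<in>UNIV. if i = l then 0 else ?n t i l)"
      using lam by (intro mult_left_mono)
    ultimately show "objective C lam \<alpha> (R t, diag_mat (e t)) \<le> G t"
      unfolding objective_eq[OF transpose_congr_diag[of "V t" "g t", folded R_def] ep] G_def
      by (simp add: algebra_simps)
  qed
  show ?thesis
  proof (rule local_minimum_curve[OF lm, where \<gamma> = "\<lambda>t. (R t, diag_mat (e t))" and G = G])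
    have lime: "((\<lambda>t. e t l) \<longlongrightarrow> d1 l) (at_right 0)" for l
    proof -
      have "((\<lambda>t. e t l) \<longlongrightarrow> sqrt ((1 - 0) * (d1 l)\<^sup>2 + 0 * (d2 l)\<^sup>2)) (at_right 0)"
        unfolding e_def by (intro tendsto_intros)
      then show ?thesis using d1[of l] by simp
    qed
    show "((\<lambda>t. (R t, diag_mat (e t))) \<longlongrightarrow> (R1, diag_mat d1)) (at_right 0)"
    proof (intro tendsto_Pair tendsto_mat)
      fix i l
      have "((\<lambda>t. R t $ i $ l) \<longlongrightarrow> ((1 - 0) * (R1 $ i $ l * d1 i * d1 l) + 0 * (R2 $ i $ l * d2 i * d2 l)) / (d1 i * d1 l)) (at_right 0)"
        unfolding ent using d1[of i] d1[of l] by (intro tendsto_intros lime) auto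
      then show "((\<lambda>t. R t $ i $ l) \<longlongrightarrow> R1 $ i $ l) (at_right 0)"
        using d1[of i] d1[of l] by simp
    qed (auto simp: diag_mat_def lime)
    show "\<forall>\<^sub>F t in at_right 0. (R t, diag_mat (e t)) \<in> S_pp1 \<times> Diag_plus \<and>
        objective C lam \<alpha> (R t, diag_mat (e t)) \<le> G t"
      by (rule eventually_at_rightI[of 0 1]) (auto intro!: obj inP diag_mat_in_Diag_plus epos)
    show "G 0 = objective C lam \<alpha> (R1, diag_mat d1)"
    proof -
      have Rs: "transpose R1 = R1" using R1 by (simp add: S_pp1_def sym_pos_def_def)
      have "det (V 0) \<noteq> 0" using W d1 by (simp add: detV e0 less_imp_neq[symmetric])
      then have l: "ln (det R1) = ln ((det (V 0))\<^sup>2) + (\<Sum>j\<in>UNIV. ln (g 0 j))"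
        unfolding R0[symmetric] R_def by (rule ln_det_congr_diag) (simp add: gpos)
      have pe: "0 < (\<Prod>i\<in>UNIV. d1 i)" by (intro prod_pos d1)
      have dne: "d1 i \<noteq> 0" for i using d1[of i] by simp
      have "ln ((det (V 0))\<^sup>2) = ln ((det W)\<^sup>2) - 2 * ln (\<Prod>i\<in>UNIV. d1 i)"
        using W pe dne by (simp add: detV power_divide ln_div ln_realpow e0)
      then have "ln (det R1) = ln ((det W)\<^sup>2) - 2 * (\<Sum>i\<in>UNIV. ln (d1 i)) + (\<Sum>j\<in>UNIV. ln (g 0 j))"
        unfolding l by (simp add: ln_prod_pos[OF finite d1])
      moreover have "(\<Sum>i\<in>UNIV. \<Sum>l\<in>UNIV. if i = l then 0 else ?n 0 i l) = off R1"
        unfolding off_def using d1 by (intro sum.cong refl) (auto simp: e0 less_imp_neq[symmetric])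
      ultimately show ?thesis
        by (simp add: objective_eq[OF Rs d1] G_def e0 algebra_simps)
    qed
    have dn: "((\<lambda>t. if i = l then 0 else ?n t i l) has_real_derivative (if i = l then 0 else
          \<bar>R2 $ i $ l\<bar> * (d2 i / d1 i) * (d2 l / d1 l) - \<bar>R1 $ i $ l\<bar> * ((d2 i / d1 i)\<^sup>2 + (d2 l / d1 l)\<^sup>2) / 2)) (at 0)"
      for i l
      using scaled_entry_derivative[OF d1[of i] d1[of l], of "\<bar>R1 $ i $ l\<bar>" "\<bar>R2 $ i $ l\<bar>" "d2 i" "d2 l"]
      by (simp add: e_def)
    have de: "((\<lambda>t. ln (e t i)) has_real_derivative ((d2 i / d1 i)\<^sup>2 - 1) / 2) (at 0)" for i
      unfolding e_def using d1[of i]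
      by (auto intro!: derivative_eq_intros) (simp add: field_simps power2_eq_square)
    have dl: "((\<lambda>t. ln (g t j)) has_real_derivative (g2 j - g1 j) / g1 j) (at 0)" for j
      unfolding g_def using g(1)[of j]
      by (auto intro!: derivative_eq_intros)
    show "(G has_real_derivative - (\<Sum>j\<in>UNIV. (g2 j - g1 j) / g1 j) + \<alpha> * (\<Sum>i\<in>UNIV. (d2 i / d1 i)\<^sup>2 - 1)
     + (?b R2 d2 - ?b R1 d1)
     + lam * (\<Sum>i\<in>UNIV. \<Sum>l\<in>UNIV. if i = l then 0 else
          \<bar>R2 $ i $ l\<bar> * (d2 i / d1 i) * (d2 l / d1 l) - \<bar>R1 $ i $ l\<bar> * ((d2 i / d1 i)\<^sup>2 + (d2 l / d1 l)\<^sup>2) / 2)) (at 0)"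
      unfolding G_def[abs_def]
      by (rule derivative_eq_intros dn de dl refl)+ (simp add: sum_divide_distrib[symmetric])
  qed
qed

section \<open>Existence of a minimum\<close>

lemma S_pp1_spectral:
  assumes "R \<in> S_pp1"
  obtains U k where "orthogonal_matrix U" "R = congr_diag U k" "\<And>j. 0 < k j" "det R = (\<Prod>j\<in>UNIV. k j)"
proof -
  have R: "sym_pos_def R" using assms by (simp add: S_pp1_def)
  then obtain U k where U: "orthogonal_matrix U" and k: "R = congr_diag U k"
    using symmetric_spectral by (metis sym_pos_def_def)
  have dU: "det U \<noteq> 0" "(det U)\<^sup>2 = 1" using det_orthogonal_matrix[OF U] by auto
  have "\<And>j. 0 < k j" using sym_pos_def_congr_diag_pos R k dU(1) by metis
  moreover have "det R = (\<Prod>j\<in>UNIV. k j)" by (simp add: k det_congr_diag dU)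
  ultimately show ?thesis using that U k by blast
qed

lemma S_pp1_entry_le_1:
  assumes "R \<in> S_pp1"
  shows "\<bar>R $ i $ l\<bar> \<le> 1"
proof -
  obtain U k where R: "R = congr_diag U k" and k: "\<And>j. 0 < k j"
    using S_pp1_spectral[OF assms] by blast
  have "unit_diagonal (congr_diag U k)" using assms R by (simp add: S_pp1_def)
  then show ?thesis unfolding R by (rule congr_diag_entry_le_1) (simp add: k less_imp_le)
qed

lemma congr_diag_orthogonal_1:
  assumes "orthogonal_matrix U"
  shows "congr_diag U (\<lambda>_. 1) = mat 1"
proof -
  have I: "(\<chi> i j. if i = j then 1 else 0) = (mat 1 :: real^'a^'a)" by (simp add: mat_def)
  show ?thesis using assms by (simp add: congr_diag_eq_mult I orthogonal_matrix_def)
qed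

text \<open>The eigenvalues are positive with sum the trace \<open>p\<close>, so each is at most
  \<open>p\<close>. Dividing the determinant by the other eigenvalues bounds each one from
  below.\<close>

lemma S_pp1_eigenvalue_bounds:
  fixes R :: "real^'p^'p"
  assumes R: "R \<in> S_pp1" and U: "orthogonal_matrix U" and k: "R = congr_diag U k" "\<And>j. 0 < k j"
    and det: "det R = (\<Prod>j\<in>UNIV. k j)"
  shows "det R \<le> real CARD('p) ^ CARD('p)" and "det R / real CARD('p) ^ CARD('p) \<le> k j"
proof -
  let ?p = "real CARD('p)"
  have p1: "1 \<le> ?p" by (simp add: Suc_leI)
  have "(\<Sum>j\<in>UNIV. k j) = ?p"
  proof -
    have col: "(\<Sum>i\<in>UNIV. U $ i $ j * U $ i $ j) = 1" for j
    proof -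
      have "(transpose U ** U) $ j $ j = 1" using U by (simp add: orthogonal_matrix_def mat_def)
      then show ?thesis by (simp add: matrix_matrix_mult_def transpose_def)
    qed
    have "?p = (\<Sum>i\<in>UNIV. R $ i $ i)" using R by (simp add: S_pp1_def unit_diagonal_def)
    also have "\<dots> = (\<Sum>i\<in>UNIV. \<Sum>j\<in>UNIV. k j * (U $ i $ j * U $ i $ j))"
      by (simp add: k mult.assoc)
    also have "\<dots> = (\<Sum>j\<in>UNIV. k j * (\<Sum>i\<in>UNIV. U $ i $ j * U $ i $ j))"
      by (subst sum.swap) (simp add: sum_distrib_left)
    finally show ?thesis by (simp add: col)
  qed
  then have kp: "k j \<le> ?p" for j
    using member_le_sum[of j UNIV k] k(2) by (simp add: less_imp_le)
  show "det R \<le> ?p ^ CARD('p)"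
    unfolding det using prod_mono[of UNIV k "\<lambda>_. ?p"] kp k(2) by (simp add: less_imp_le)
  have "det R = k j * (\<Prod>i\<in>UNIV - {j}. k i)"
    unfolding det by (subst prod.remove[of _ j]) auto
  also have "(\<Prod>i\<in>UNIV - {j}. k i) \<le> ?p ^ (CARD('p) - 1)"
    using prod_mono[of "UNIV - {j}" k "\<lambda>_. ?p"] kp k(2) by (simp add: less_imp_le)
  also have "\<dots> \<le> ?p ^ CARD('p)" using p1 by (intro power_increasing) auto
  finally have "det R \<le> k j * ?p ^ CARD('p)" using k(2) by (simp add: mult_left_mono less_imp_le)
  then show "det R / ?p ^ CARD('p) \<le> k j" using p1 by (simp add: divide_le_eq)
qed

lemma norm_mat_le:
  fixes A :: "real^'p^'p"
  assumes "\<And>i l. \<bar>A $ i $ l\<bar> \<le> b"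
  shows "norm A \<le> real CARD('p) * (real CARD('p) * b)"
proof -
  have "norm A \<le> (\<Sum>i\<in>UNIV. norm (A $ i))"
    unfolding norm_vec_def[of A] by (rule L2_set_le_sum) auto
  also have "\<dots> \<le> (\<Sum>i\<in>(UNIV::'p set). real CARD('p) * b)"
  proof (rule sum_mono)
    fix i
    have "norm (A $ i) \<le> (\<Sum>l\<in>UNIV. \<bar>A $ i $ l\<bar>)" by (rule norm_le_l1_cart)
    also have "\<dots> \<le> (\<Sum>l\<in>(UNIV::'p set). b)" by (intro sum_mono assms)
    finally show "norm (A $ i) \<le> real CARD('p) * b" by simp
  qed
  finally show ?thesis by simp
qed

lemma continuous_on_det [continuous_intros]:
  fixes f :: "'a::topological_space \<Rightarrow> real^'p^'p"
  assumes "continuous_on S f"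
  shows "continuous_on S (\<lambda>x. det (f x))"
  unfolding det_def by (intro continuous_intros assms)

lemma continuous_on_objective:
  assumes "\<And>R D. (R, D) \<in> K \<Longrightarrow> det R \<noteq> 0 \<and> det D \<noteq> 0"
  shows "continuous_on K (objective C lam \<alpha>)"
  unfolding objective_def case_prod_unfold trace_def norm1_off_def matrix_matrix_mult_def vec_lambda_beta
  using assms by (intro continuous_intros) auto

section \<open>Barrier terms and compact sublevel sets\<close>

text \<open>The left side is the minimum over \<open>d > 0\<close>, attained where
  \<open>r d^2 = a\<close>; it comes from \<open>ln x \<le> x - 1\<close> at
  \<open>x = r d^2 / a\<close>.\<close>

lemma scalar_barrier_lower_bound:
  fixes a r d :: real
  assumes "0 < a" "0 < r" "0 < d"
  shows "a + a * ln (r / a) \<le> r * d\<^sup>2 - 2 * a * ln d"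
proof -
  have "ln (r * d\<^sup>2 / a) \<le> r * d\<^sup>2 / a - 1" using assms by (intro ln_le_minus_one) simp
  moreover have "ln (r * d\<^sup>2 / a) = ln (r / a) + 2 * ln d"
    using assms by (simp add: ln_mult ln_div ln_realpow)
  ultimately have "a * (ln (r / a) + 2 * ln d) \<le> a * (r * d\<^sup>2 / a - 1)"
    using assms by (intro mult_left_mono) auto
  then show ?thesis using assms by (simp add: algebra_simps)
qed

text \<open>The logarithm keeps \<open>d\<close> away from zero, and \<open>ln d \<le> d - 1\<close>
  lets the quadratic term keep it bounded.\<close>

lemma scalar_barrier_sublevel:
  fixes a r K d :: real
  assumes "0 < a" "0 < r" "0 < d" "r * d\<^sup>2 - 2 * a * ln d \<le> K"
  shows "exp (- K / (2 * a)) \<le> d" and "d \<le> (2 * a + \<bar>K\<bar>) / r + 1"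
proof -
  have "- K / (2 * a) \<le> ln d"
  proof -
    have "0 \<le> r * d\<^sup>2" using assms by simp
    then have "- K \<le> 2 * a * ln d" using assms by linarith
    then have "- K / (2 * a) \<le> 2 * a * ln d / (2 * a)"
      using assms by (intro divide_right_mono) auto
    then show ?thesis using assms by simp
  qed
  then show "exp (- K / (2 * a)) \<le> d" using assms by (metis exp_le_cancel_iff exp_ln)
  show "d \<le> (2 * a + \<bar>K\<bar>) / r + 1"
  proof (rule ccontr)
    assume "\<not> ?thesis"
    then have d: "(2 * a + \<bar>K\<bar>) / r + 1 < d" by simp
    have q: "0 \<le> (2 * a + \<bar>K\<bar>) / r" using assms by simp
    then have d1: "1 < d" using d by linarith
    have "(2 * a + \<bar>K\<bar>) / r < d" using d by linarith
    then have "2 * a + \<bar>K\<bar> < r * d" using assms by (simp add: divide_less_eq mult_ac)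
    then have K: "\<bar>K\<bar> < r * d - 2 * a" by simp
    then have "1 * (r * d - 2 * a) \<le> d * (r * d - 2 * a)"
      using d1 by (intro mult_right_mono) auto
    also have "\<dots> = r * d\<^sup>2 - 2 * a * d" by (simp add: power2_eq_square algebra_simps)
    also have "\<dots> \<le> r * d\<^sup>2 - 2 * a * ln d"
      using assms ln_le_minus_one[of d] by simp
    finally show False using K assms(4) by simp
  qed
qed

lemma off_nonneg: "0 \<le> off A"
  unfolding off_def by (intro sum_nonneg) auto

text \<open>It suffices to control the points no worse than the pair of identity matrices: a lower
  bound on \<open>det R\<close> and coercivity in \<open>d\<close> confine them to a compact part of
  the domain, where continuity gives a global minimum.\<close>

lemma objective_attains_minimum:
  fixes C :: "real^'p^'p"
  assumes a: "\<alpha> < 1" and lam: "0 \<le> lam" and r0: "0 < r0" and c0: "0 < c0"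
    and sub: "\<And>R d. R \<in> S_pp1 \<Longrightarrow> (\<And>i. 0 < d i) \<Longrightarrow>
      objective C lam \<alpha> (R, diag_mat d) \<le> objective C lam \<alpha> (mat 1, diag_mat (\<lambda>_. 1)) \<Longrightarrow>
      c0 \<le> det R \<and> r0 * (\<Sum>i\<in>UNIV. (d i)\<^sup>2) \<le> bil (hadamard C R) d d"
  shows "\<exists>x. local_minimum_on (objective C lam \<alpha>) (S_pp1 \<times> Diag_plus) x"
proof -
  let ?f = "objective C lam \<alpha>" and ?p = "real CARD('p)"
  let ?I = "(mat 1, diag_mat (\<lambda>_. 1)) :: (real^'p^'p) \<times> (real^'p^'p)"
  let ?P = "S_pp1 \<times> Diag_plus :: ((real^'p^'p) \<times> (real^'p^'p)) set"
  define b where "b = (1 - \<alpha>) + (1 - \<alpha>) * ln (r0 / (1 - \<alpha>))"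
  \<comment> \<open>Bound for one barrier term: the bound on the sum of all of them, with each of
    the others estimated below by \<open>- \<bar>b\<bar>\<close>.\<close>
  define K where "K = ?f ?I + ln (?p ^ CARD('p)) + ?p * \<bar>b\<bar>"
  define lo where "lo = exp (- K / (2 * (1 - \<alpha>)))"
  define hi where "hi = (2 * (1 - \<alpha>) + \<bar>K\<bar>) / r0 + 1"
  have lo: "0 < lo" by (simp add: lo_def)
  \<comment> \<open>Semidefiniteness with \<open>c0 \<le> det R\<close> is a closed condition and
    still implies definiteness, as no eigenvalue can vanish.\<close>
  define Q where "Q = {R :: real^'p^'p. transpose R = R \<and> (\<forall>x. 0 \<le> x \<bullet> (R *v x)) \<and> (\<forall>i. R $ i $ i = 1) \<and> c0 \<le> det R}
    \<times> {D :: real^'p^'p. \<forall>i j. (i \<noteq> j \<longrightarrow> D $ i $ j = 0) \<and> lo \<le> D $ i $ i \<and> D $ i $ i \<le> hi}"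
  have QP: "Q \<subseteq> ?P"
  proof
    fix x assume "x \<in> Q"
    then obtain R D where x: "x = (R, D)" and R: "transpose R = R" "\<And>x. 0 \<le> x \<bullet> (R *v x)" "\<And>i. R $ i $ i = 1" "c0 \<le> det R"
      and D: "\<And>i j. i \<noteq> j \<Longrightarrow> D $ i $ j = 0" "\<And>i. lo \<le> D $ i $ i"
      unfolding Q_def by blast
    obtain U k where U: "orthogonal_matrix U" and k: "R = congr_diag U k"
      using symmetric_spectral[OF R(1)] by blast
    have dU: "det U \<noteq> 0" "(det U)\<^sup>2 = 1" using det_orthogonal_matrix[OF U] by auto
    have "0 < k j" for j
    proof -
      have "0 \<le> k j" using congr_diag_quadratic_column[OF dU(1), of k j] R(2) unfolding k by metis
      moreover have "k j \<noteq> 0"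
      proof
        assume "k j = 0"
        then have "det R = 0" by (auto simp: k det_congr_diag)
        then show False using R(4) c0 by simp
      qed
      ultimately show ?thesis by simp
    qed
    then have "sym_pos_def R" unfolding k by (intro sym_pos_def_congr_diag dU)
    then show "x \<in> ?P"
      using R D lo by (auto simp: x S_pp1_def unit_diagonal_def Diag_plus_def intro: less_le_trans)
  qed
  have "compact Q"
  proof (unfold compact_eq_bounded_closed, intro conjI)
    have "\<bar>R $ i $ l\<bar> \<le> 1 \<and> \<bar>D $ i $ l\<bar> \<le> \<bar>hi\<bar>" if "(R, D) \<in> Q" for R D i l
    proof
      show "\<bar>R $ i $ l\<bar> \<le> 1" using that QP by (intro S_pp1_entry_le_1) auto
      have "D $ i $ l = 0 \<or> i = l \<and> lo \<le> D $ i $ i \<and> D $ i $ i \<le> hi" using that by (auto simp: Q_def)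
      then show "\<bar>D $ i $ l\<bar> \<le> \<bar>hi\<bar>" using lo by auto
    qed
    then have *: "norm (fst x) \<le> ?p * (?p * 1) \<and> norm (snd x) \<le> ?p * (?p * \<bar>hi\<bar>)" if "x \<in> Q" for x
      using that by (intro conjI norm_mat_le) (cases x; auto)+
    have "norm x \<le> ?p * (?p * 1) + ?p * (?p * \<bar>hi\<bar>)" if "x \<in> Q" for x
      using *[OF that] norm_Pair_le[of "fst x" "snd x"] by (simp del: mult_1_right)
    then show "bounded Q" unfolding bounded_iff by blast
    show "closed Q"
      unfolding Q_def
    proof (rule closed_Times)
      have "closed {R :: real^'p^'p. \<forall>i l. R $ l $ i = R $ i $ l}"
        by (intro closed_Collect_all closed_Collect_eq continuous_intros)
      moreover have "{R :: real^'p^'p. \<forall>i l. R $ l $ i = R $ i $ l} = {R. transpose R = R}"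
        by (auto simp: transpose_def vec_eq_iff)
      ultimately have "closed {R :: real^'p^'p. transpose R = R}" by simp
      note cl = this
      show "closed {R :: real^'p^'p. transpose R = R \<and> (\<forall>x. 0 \<le> x \<bullet> (R *v x)) \<and> (\<forall>i. R $ i $ i = 1) \<and> c0 \<le> det R}"
        unfolding inner_vec_def matrix_vector_mult_def vec_lambda_beta inner_real_def
        by (rule closed_Collect_conj[OF cl])
          (intro closed_Collect_conj closed_Collect_all closed_Collect_le closed_Collect_eq continuous_intros)
      show "closed {D :: real^'p^'p. \<forall>i j. (i \<noteq> j \<longrightarrow> D $ i $ j = 0) \<and> lo \<le> D $ i $ i \<and> D $ i $ i \<le> hi}"
      proof (intro closed_Collect_all closed_Collect_conj closed_Collect_le continuous_intros)
        fix i j :: 'p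
        show "closed {D :: real^'p^'p. i \<noteq> j \<longrightarrow> D $ i $ j = 0}"
          by (cases "i = j") (auto intro!: closed_Collect_eq continuous_intros)
      qed
    qed
  qed
  have inQ: "y \<in> Q" if y: "y \<in> ?P" and le: "?f y \<le> ?f ?I" for y
  proof -
    obtain R D where yRD: "y = (R, D)" "R \<in> S_pp1" "D \<in> Diag_plus" using y by auto
    define d where "d = dg D"
    have D: "D = diag_mat d" and d: "\<And>i. 0 < d i"
      using yRD(3) Diag_plus_eq Diag_plus_pos by (auto simp: d_def)
    have Rs: "transpose R = R" using yRD(2) by (simp add: S_pp1_def sym_pos_def_def)
    obtain U k where "orthogonal_matrix U" "R = congr_diag U k" "\<And>j. 0 < k j" "det R = (\<Prod>j\<in>UNIV. k j)"
      using S_pp1_spectral[OF yRD(2)] by blast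
    note det_le = S_pp1_eigenvalue_bounds(1)[OF yRD(2) this]
    have s: "c0 \<le> det R" "r0 * (\<Sum>i\<in>UNIV. (d i)\<^sup>2) \<le> bil (hadamard C R) d d"
      using sub[OF yRD(2) d] le by (simp_all add: yRD D)
    let ?h = "\<lambda>i. r0 * (d i)\<^sup>2 - 2 * (1 - \<alpha>) * ln (d i)"
    have hb: "b \<le> ?h i" for i
      unfolding b_def using scalar_barrier_lower_bound[of "1 - \<alpha>" r0 "d i"] a r0 d by simp
    have "(\<Sum>i\<in>UNIV. ?h i) = r0 * (\<Sum>i\<in>UNIV. (d i)\<^sup>2) - 2 * (1 - \<alpha>) * (\<Sum>i\<in>UNIV. ln (d i))"
      by (simp add: sum_subtractf sum_distrib_left)
    moreover have "ln (det R) \<le> ln (?p ^ CARD('p))"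
      using det_le s(1) c0 by (subst ln_le_cancel_iff) auto
    moreover have "0 \<le> lam * off R" by (rule mult_nonneg_nonneg[OF lam off_nonneg])
    ultimately have sumh: "(\<Sum>i\<in>UNIV. ?h i) \<le> ?f ?I + ln (?p ^ CARD('p))"
      using le s(2) unfolding yRD(1) D objective_eq[OF Rs d] by linarith
    have hK: "?h i \<le> K" for i
    proof -
      have "(\<Sum>j\<in>UNIV. ?h j) = ?h i + (\<Sum>j\<in>UNIV - {i}. ?h j)" by (subst sum.remove[of _ i]) auto
      moreover have "(\<Sum>j\<in>UNIV - {i}. - \<bar>b\<bar>) \<le> (\<Sum>j\<in>UNIV - {i}. ?h j)"
        using hb by (intro sum_mono) (smt (verit))
      moreover have "- (?p * \<bar>b\<bar>) \<le> (\<Sum>j\<in>UNIV - {i}. - \<bar>b\<bar>)"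
        by (simp add: card_Diff_singleton mult_right_mono)
      ultimately show ?thesis using sumh by (simp add: K_def)
    qed
    have "lo \<le> d i" "d i \<le> hi" for i
      unfolding lo_def hi_def using scalar_barrier_sublevel[OF _ r0 d[of i] hK[of i]] a by auto
    moreover have "D $ i $ j = 0" if "i \<noteq> j" for i j using that by (simp add: D diag_mat_def)
    moreover have "0 \<le> x \<bullet> (R *v x)" for x
      using yRD(2) by (cases "x = 0") (simp_all add: S_pp1_def sym_pos_def_def less_imp_le)
    moreover have "R $ i $ i = 1" for i
      using yRD(2) by (simp add: S_pp1_def unit_diagonal_def)
    ultimately show "y \<in> Q"
      unfolding yRD(1) Q_def mem_Times_iff fst_conv snd_conv mem_Collect_eq
      using Rs s(1) by (simp add: d_def dg_def)
  qed
  have "?I \<in> ?P"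
  proof -
    have "sym_pos_def (mat 1 :: real^'p^'p)"
      by (simp add: sym_pos_def_def transpose_mat)
    moreover have "unit_diagonal (mat 1 :: real^'p^'p)"
      by (simp add: unit_diagonal_def mat_def)
    ultimately show ?thesis
      by (simp add: S_pp1_def diag_mat_in_Diag_plus)
  qed
  then have "?I \<in> Q" using inQ by simp
  moreover have "continuous_on Q ?f"
  proof (rule continuous_on_objective)
    fix R D assume "(R, D) \<in> Q"
    then have "c0 \<le> det R" "D \<in> Diag_plus" using QP by (auto simp: Q_def)
    moreover have "det (diag_mat (dg D)) \<noteq> 0"
    proof -
      have "det (diag_mat (dg D)) = (\<Prod>i\<in>UNIV. dg D i)"
        unfolding diag_mat_def by (subst det_diagonal) auto
      also have "\<dots> > 0" using Diag_plus_pos[OF \<open>D \<in> Diag_plus\<close>] by (intro prod_pos) auto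
      finally show ?thesis by simp
    qed
    moreover have "det (diag_mat (dg D)) = det D"
      using Diag_plus_eq[OF \<open>D \<in> Diag_plus\<close>] by (rule arg_cong[OF sym])
    ultimately show "det R \<noteq> 0 \<and> det D \<noteq> 0" using c0 by auto
  qed
  ultimately obtain x where x: "x \<in> Q" "\<And>y. y \<in> Q \<Longrightarrow> ?f x \<le> ?f y"
    using continuous_attains_inf[OF \<open>compact Q\<close>] by blast
  \<comment> \<open>A point outside the sublevel set is worse than \<open>?I\<close>, which itself
    lies in \<open>Q\<close>.\<close>
  have "?f x \<le> ?f y" if "y \<in> ?P" for y
    using x(2)[OF \<open>?I \<in> Q\<close>] x(2)[OF inQ[OF that]] by (cases "?f y \<le> ?f ?I") auto
  then show ?thesis
    using x(1) QP unfolding local_minimum_on_def eventually_at_topological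
    by (intro exI[of _ x]) auto
qed

text \<open>The Schur product with the unit diagonal matrix \<open>R\<close> keeps the coercivity
  constant \<open>c\<close>. The trace and \<open>D\<close> terms are then bounded below, so the
  sublevel condition bounds \<open>ln (det R)\<close> below.\<close>

lemma exists_minimum_definite:
  fixes C :: "real^'p^'p"
  assumes a: "\<alpha> < 1" and lam: "0 \<le> lam" and c: "0 < c" and C: "\<And>x. c * (\<Sum>i\<in>UNIV. (x i)\<^sup>2) \<le> bil C x x"
  shows "\<exists>x. local_minimum_on (objective C lam \<alpha>) (S_pp1 \<times> Diag_plus) x"
proof -
  let ?f = "objective C lam \<alpha>" and ?I = "(mat 1, diag_mat (\<lambda>_. 1)) :: (real^'p^'p) \<times> (real^'p^'p)"
  define b where "b = (1 - \<alpha>) + (1 - \<alpha>) * ln (c / (1 - \<alpha>))"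
  show ?thesis
  proof (rule objective_attains_minimum[OF a lam c])
    fix R :: "real^'p^'p" and d
    assume R: "R \<in> S_pp1" and d: "\<And>i. 0 < d i" and le: "?f (R, diag_mat d) \<le> ?f ?I"
    obtain U k where U: "R = congr_diag U k" "\<And>j. 0 < k j" "det R = (\<Prod>j\<in>UNIV. k j)"
      using S_pp1_spectral[OF R] by blast
    have Rs: "transpose R = R" using R by (simp add: S_pp1_def sym_pos_def_def)
    have dpos: "0 < det R" unfolding U(3) by (intro prod_pos U(2))
    have low: "c * (\<Sum>i\<in>UNIV. (d i)\<^sup>2) \<le> bil (hadamard C R) d d"
    proof -
      have "(\<Sum>j\<in>UNIV. k j * (c * (\<Sum>i\<in>UNIV. (U $ i $ j * d i)\<^sup>2))) \<le> bil (hadamard C R) d d"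
        unfolding U(1) bil_hadamard_congr_diag using U(2)
        by (intro sum_mono mult_left_mono C) (auto simp: less_imp_le)
      also have "(\<Sum>j\<in>UNIV. k j * (c * (\<Sum>i\<in>UNIV. (U $ i $ j * d i)\<^sup>2)))
          = (\<Sum>i\<in>UNIV. \<Sum>j\<in>UNIV. k j * (c * (U $ i $ j * d i)\<^sup>2))"
        by (subst sum.swap) (simp add: sum_distrib_left)
      also have "\<dots> = (\<Sum>i\<in>UNIV. c * (d i)\<^sup>2 * (R $ i $ i))"
        by (simp add: U(1) sum_distrib_left power2_eq_square mult_ac)
      also have "\<dots> = c * (\<Sum>i\<in>UNIV. (d i)\<^sup>2)"
        using R by (simp add: S_pp1_def unit_diagonal_def sum_distrib_left)
      finally show ?thesis .
    qed
    have "real CARD('p) * b \<le> (\<Sum>i\<in>UNIV. c * (d i)\<^sup>2 - 2 * (1 - \<alpha>) * ln (d i))"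
      using sum_mono[of UNIV "\<lambda>_. b" "\<lambda>i. c * (d i)\<^sup>2 - 2 * (1 - \<alpha>) * ln (d i)"]
        scalar_barrier_lower_bound[of "1 - \<alpha>" c] a c d by (simp add: b_def)
    also have "\<dots> = c * (\<Sum>i\<in>UNIV. (d i)\<^sup>2) - 2 * (1 - \<alpha>) * (\<Sum>i\<in>UNIV. ln (d i))"
      by (simp add: sum_subtractf sum_distrib_left)
    finally have "real CARD('p) * b - ?f ?I \<le> ln (det R)"
      using le low mult_nonneg_nonneg[OF lam off_nonneg[of R]] unfolding objective_eq[OF Rs d] by linarith
    then have "exp (real CARD('p) * b - ?f ?I) \<le> det R" using dpos by (metis exp_le_cancel_iff exp_ln)
    then show "exp (real CARD('p) * b - ?f ?I) \<le> det R \<and> c * (\<Sum>i\<in>UNIV. (d i)\<^sup>2) \<le> bil (hadamard C R) d d"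
      using low by simp
  qed simp
qed

text \<open>Coercivity in \<open>d\<close> comes from the least eigenvalue of \<open>R\<close>, at
  least \<open>det R / q\<close>, and the unit diagonal of \<open>C\<close>. It degenerates with
  \<open>det R\<close> at a cost of \<open>p (1 - \<alpha>) ln (det R)\<close>, which
  \<open>- ln (det R)\<close> absorbs as \<open>p (1 - \<alpha>) < 1\<close>.\<close>

lemma exists_minimum_semidefinite:
  fixes C :: "real^'p^'p"
  assumes a: "\<alpha> < 1" and lam: "0 \<le> lam" and C: "correlation_matrix C" and pa: "real CARD('p) * (1 - \<alpha>) < 1"
  shows "\<exists>x. local_minimum_on (objective C lam \<alpha>) (S_pp1 \<times> Diag_plus) x"
proof -
  let ?f = "objective C lam \<alpha>" and ?I = "(mat 1, diag_mat (\<lambda>_. 1)) :: (real^'p^'p) \<times> (real^'p^'p)"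
  let ?p = "real CARD('p)"
  have C_psd: "0 \<le> bil C x x" and C_diag: "C $ i $ i = 1" for x i
    using C by (auto simp: correlation_matrix_def sym_pos_semidef_def bil_eq_inner unit_diagonal_def)
  define q where "q = ?p ^ CARD('p)"
  have q: "0 < q" by (simp add: q_def)
  \<comment> \<open>The minimum of the scalar barrier at \<open>r = det R / q\<close>, with its
    summand \<open>(1 - \<alpha>) * ln (det R)\<close> removed.\<close>
  define b where "b = (1 - \<alpha>) * (1 - ln q - ln (1 - \<alpha>))"
  define c0 where "c0 = exp ((?p * b - ?f ?I) / (1 - ?p * (1 - \<alpha>)))"
  have c0: "0 < c0" by (simp add: c0_def)
  have r0: "0 < c0 / q" using c0 q by simp
  show ?thesis
  proof (rule objective_attains_minimum[OF a lam r0 c0])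
    fix R :: "real^'p^'p" and d
    assume R: "R \<in> S_pp1" and d: "\<And>i. 0 < d i" and le: "?f (R, diag_mat d) \<le> ?f ?I"
    obtain U k where U: "orthogonal_matrix U" "R = congr_diag U k" "\<And>j. 0 < k j" "det R = (\<Prod>j\<in>UNIV. k j)"
      using S_pp1_spectral[OF R] by blast
    note kr = S_pp1_eigenvalue_bounds(2)[OF R U, folded q_def]
    have Rs: "transpose R = R" using R by (simp add: S_pp1_def sym_pos_def_def)
    have dpos: "0 < det R" unfolding U(4) by (intro prod_pos U(3))
    define r where "r = det R / q"
    have r: "0 < r" using dpos q by (simp add: r_def)
    have low: "r * (\<Sum>i\<in>UNIV. (d i)\<^sup>2) \<le> bil (hadamard C R) d d"
    proof -
      have "hadamard C (mat 1) = mat 1" by (auto simp: vec_eq_iff mat_def C_diag)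
      then have "r * (\<Sum>i\<in>UNIV. (d i)\<^sup>2) = r * bil (hadamard C (congr_diag U (\<lambda>_. 1))) d d"
        by (simp add: congr_diag_orthogonal_1[OF U(1)] bil_mat_1 power2_eq_square)
      also have "\<dots> \<le> bil (hadamard C R) d d"
        unfolding U(2) bil_hadamard_congr_diag sum_distrib_left
      proof (rule sum_mono)
        fix j
        show "r * (1 * bil C (\<lambda>i. U $ i $ j * d i) (\<lambda>l. U $ l $ j * d l))
            \<le> k j * bil C (\<lambda>i. U $ i $ j * d i) (\<lambda>l. U $ l $ j * d l)"
          using mult_right_mono[OF kr[of j, folded r_def] C_psd] by (simp only: mult_1)
      qed
      finally show ?thesis .
    qed
    define B where "B = (1 - \<alpha>) + (1 - \<alpha>) * ln (r / (1 - \<alpha>))"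
    have "?p * B \<le> (\<Sum>i\<in>UNIV. r * (d i)\<^sup>2 - 2 * (1 - \<alpha>) * ln (d i))"
      using sum_mono[of UNIV "\<lambda>_. B" "\<lambda>i. r * (d i)\<^sup>2 - 2 * (1 - \<alpha>) * ln (d i)"]
        scalar_barrier_lower_bound[of "1 - \<alpha>" r] a r d by (simp add: B_def)
    also have "\<dots> = r * (\<Sum>i\<in>UNIV. (d i)\<^sup>2) - 2 * (1 - \<alpha>) * (\<Sum>i\<in>UNIV. ln (d i))"
      by (simp add: sum_subtractf sum_distrib_left)
    finally have "?p * B - ?f ?I \<le> ln (det R)"
      using le low mult_nonneg_nonneg[OF lam off_nonneg[of R]] unfolding objective_eq[OF Rs d] by linarith
    moreover have "B = b + (1 - \<alpha>) * ln (det R)"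
    proof -
      have eq: "ln (r / (1 - \<alpha>)) = ln (det R) - ln q - ln (1 - \<alpha>)"
        using a q dpos by (simp add: r_def ln_divide_pos ln_mult_pos)
      show ?thesis unfolding B_def b_def eq by (simp add: algebra_simps)
    qed
    ultimately have "?p * b - ?f ?I \<le> (1 - ?p * (1 - \<alpha>)) * ln (det R)"
      by (simp add: algebra_simps)
    then have "(?p * b - ?f ?I) / (1 - ?p * (1 - \<alpha>)) \<le> ln (det R)"
      using pa by (simp add: divide_le_eq mult_ac)
    then have cd: "c0 \<le> det R" unfolding c0_def using dpos by (metis exp_le_cancel_iff exp_ln)
    then have "c0 / q \<le> r" using q by (simp add: r_def divide_right_mono)
    then have "c0 / q * (\<Sum>i\<in>UNIV. (d i)\<^sup>2) \<le> r * (\<Sum>i\<in>UNIV. (d i)\<^sup>2)"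
      by (intro mult_right_mono sum_nonneg) auto
    then show "c0 \<le> det R \<and> c0 / q * (\<Sum>i\<in>UNIV. (d i)\<^sup>2) \<le> bil (hadamard C R) d d"
      using cd low by linarith
  qed
qed

section \<open>Uniqueness\<close>

lemma local_minimum_coordinates:
  assumes "local_minimum_on f (S_pp1 \<times> Diag_plus) x"
  obtains R d where "x = (R, diag_mat d)" "R \<in> S_pp1" "\<And>i. 0 < d i"
proof -
  have "fst x \<in> S_pp1" "snd x \<in> Diag_plus"
    using assms by (auto simp: local_minimum_on_def)
  then show ?thesis
    using that[of "fst x" "dg (snd x)"] Diag_plus_eq[of "snd x"] Diag_plus_pos[of "snd x"]
    by (metis prod.collapse)
qed

lemma sym_pos_def_add:
  assumes "sym_pos_def A" "sym_pos_def B"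
  shows "sym_pos_def (A + B)"
proof -
  have "transpose (A + B) = A + B"
    using assms by (simp add: sym_pos_def_def vec_eq_iff transpose_def)
  then show ?thesis
    using assms by (simp add: sym_pos_def_def matrix_vector_mult_add_rdistrib inner_add_right add_pos_pos)
qed

lemma sym_pos_def_scale:
  assumes A: "sym_pos_def A" and e: "\<And>i. 0 < e i"
  shows "sym_pos_def (\<chi> i l. A $ i $ l * e i * e l)"
proof -
  let ?B = "\<chi> i l. A $ i $ l * e i * e l"
  have As: "A $ l $ i = A $ i $ l" for i l
    using A symmetric_nth[of A] by (simp add: sym_pos_def_def)
  have "transpose ?B = ?B" by (simp add: vec_eq_iff transpose_def As mult_ac)
  moreover have "0 < x \<bullet> (?B *v x)" if "x \<noteq> 0" for x
  proof -
    let ?y = "\<chi> i. e i * x $ i"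
    have "\<exists>i. x $ i \<noteq> 0" using that by (simp add: vec_eq_iff)
    then have "?y \<noteq> 0" using e by (auto simp: vec_eq_iff less_imp_neq[symmetric])
    then have "0 < ?y \<bullet> (A *v ?y)" using A by (simp add: sym_pos_def_def)
    also have "\<dots> = x \<bullet> (?B *v x)"
      by (simp add: inner_vec_def matrix_vector_mult_def sum_distrib_left mult_ac)
    finally show ?thesis .
  qed
  ultimately show ?thesis by (simp add: sym_pos_def_def)
qed

section \<open>Two local minima joined by a segment in \<open>R\<close>\<close>

text \<open>Diagonalizing the sum and the difference, rather than \<open>R1\<close> and
  \<open>R2\<close> themselves, makes the coefficients symmetric, \<open>(1 + k) / 2\<close> and
  \<open>(1 - k) / 2\<close>; positivity of both is \<open>\<bar>k\<bar> < 1\<close>.\<close>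

lemma local_minima_stationary_pair:
  fixes C :: "real^'p^'p"
  assumes C: "correlation_matrix C" and a: "\<alpha> < 1" and lam: "0 \<le> lam"
    and lm1: "local_minimum_on (objective C lam \<alpha>) (S_pp1 \<times> Diag_plus) (R1, diag_mat d1)"
    and lm2: "local_minimum_on (objective C lam \<alpha>) (S_pp1 \<times> Diag_plus) (R2, diag_mat d2)"
    and d: "\<And>i. 0 < d1 i" "\<And>i. 0 < d2 i"
  obtains W k where "stationary_pair C W k d1 d2 (1 - \<alpha>)"
    "R1 = congr_diag W (\<lambda>j. (1 + k j) / 2)" "R2 = congr_diag W (\<lambda>j. (1 - k j) / 2)"
proof -
  have R: "R1 \<in> S_pp1" "R2 \<in> S_pp1" using lm1 lm2 by (auto simp: local_minimum_on_def)
  have pd: "sym_pos_def (R1 + R2)" using R by (auto simp: S_pp1_def intro: sym_pos_def_add)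
  have "transpose (R1 - R2) = R1 - R2"
    using R by (simp add: S_pp1_def sym_pos_def_def vec_eq_iff transpose_def)
  then obtain W k where W: "det W \<noteq> 0" and s: "R1 + R2 = congr_diag W (\<lambda>_. 1)" and m: "R1 - R2 = congr_diag W k"
    using simultaneous_diagonalization[OF pd] by metis
  let ?g1 = "\<lambda>j. (1 + k j) / 2" and ?g2 = "\<lambda>j. (1 - k j) / 2"
  have e: "R1 $ i $ l + R2 $ i $ l = congr_diag W (\<lambda>_. 1) $ i $ l"
    "R1 $ i $ l - R2 $ i $ l = congr_diag W k $ i $ l" for i l
    unfolding s[symmetric] m[symmetric] by simp_all
  have R1: "R1 = congr_diag W ?g1"
  proof -
    have "congr_diag W ?g1 $ i $ l = (congr_diag W (\<lambda>_. 1) $ i $ l + congr_diag W k $ i $ l) / 2" for i l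
      by (simp add: sum_divide_distrib add_divide_distrib distrib_right flip: sum.distrib)
    then show ?thesis unfolding vec_eq_iff e[symmetric] by simp
  qed
  have R2: "R2 = congr_diag W ?g2"
  proof -
    have "congr_diag W ?g2 $ i $ l = (congr_diag W (\<lambda>_. 1) $ i $ l - congr_diag W k $ i $ l) / 2" for i l
      by (simp add: sum_divide_distrib diff_divide_distrib left_diff_distrib flip: sum_subtractf)
    then show ?thesis unfolding vec_eq_iff e[symmetric] by simp
  qed
  have g: "0 < ?g1 j" "0 < ?g2 j" for j
    using sym_pos_def_congr_diag_pos[OF _ W] R R1 R2 by (metis (no_types, lifting) S_pp1_def mem_Collect_eq)+
  have k1: "\<bar>k j\<bar> < 1" for j using g[of j] by auto
  have Cs: "transpose C = C" using C by (simp add: correlation_matrix_def sym_pos_semidef_def)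
  have ud: "unit_diagonal (congr_diag W ?g1)" "unit_diagonal (congr_diag W ?g2)"
    using R R1 R2 by (simp_all add: S_pp1_def)
  let ?b = "\<lambda>g d. bil (hadamard C (congr_diag W g)) d d"
  have bk: "?b k d = ?b ?g1 d - ?b ?g2 d" for d
  proof -
    have "k j * x = ?g1 j * x - ?g2 j * x" for j x by (simp add: field_simps)
    then show ?thesis unfolding bil_hadamard_congr_diag sum_subtractf[symmetric] by simp
  qed
  have i1: "0 \<le> - (\<Sum>j\<in>UNIV. (?g2 j - ?g1 j) / ?g1 j) + (?b ?g2 d1 - ?b ?g1 d1) + lam * (off (congr_diag W ?g2) - off (congr_diag W ?g1))"
    by (rule local_minimum_R_direction[OF lm1[unfolded R1] ud(2) W g d(1) lam])
  have i2: "0 \<le> - (\<Sum>j\<in>UNIV. (?g1 j - ?g2 j) / ?g2 j) + (?b ?g1 d2 - ?b ?g2 d2) + lam * (off (congr_diag W ?g1) - off (congr_diag W ?g2))"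
    by (rule local_minimum_R_direction[OF lm2[unfolded R2] ud(1) W g(2) g(1) d(2) lam])
  have "(\<Sum>j\<in>UNIV. (?g2 j - ?g1 j) / ?g1 j) + (\<Sum>j\<in>UNIV. (?g1 j - ?g2 j) / ?g2 j)
      = 4 * (\<Sum>j\<in>UNIV. (k j)\<^sup>2 / (1 - (k j)\<^sup>2))"
    unfolding sum.distrib[symmetric] sum_distrib_left
  proof (rule sum.cong[OF refl])
    fix j
    have "1 + k j \<noteq> 0" "1 - k j \<noteq> 0" using k1[of j] by auto
    moreover have "1 - (k j)\<^sup>2 = (1 + k j) * (1 - k j)" by (simp add: power2_eq_square algebra_simps)
    ultimately show "(?g2 j - ?g1 j) / ?g1 j + (?g1 j - ?g2 j) / ?g2 j = 4 * ((k j)\<^sup>2 / (1 - (k j)\<^sup>2))"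
      by (simp add: divide_simps) (simp add: power2_eq_square algebra_simps)
  qed
  \<comment> \<open>In the sum of \<open>i1\<close> and \<open>i2\<close> the two penalty
    differences cancel, which is why \<open>lam\<close> disappears.\<close>
  then have gap: "4 * (\<Sum>j\<in>UNIV. (k j)\<^sup>2 / (1 - (k j)\<^sup>2)) \<le> ?b k d2 - ?b k d1"
    using i1 i2 unfolding bk right_diff_distrib by linarith
  have "stationary_pair C W k d1 d2 (1 - \<alpha>)"
    by (unfold_locales; (fact C | fact W | fact k1 | fact d | fact ud | fact gap |
      rule local_minimum_stationary[OF lm1[unfolded R1] d(1) Cs] |
      rule local_minimum_stationary[OF lm2[unfolded R2] d(2) Cs])?) (use a in simp)
  then show ?thesis using that R1 R2 by blast
qed

lemma unique_local_minimumI: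
  assumes "\<exists>x. local_minimum_on (objective C lam \<alpha>) (S_pp1 \<times> Diag_plus) x"
    and "\<And>R1 R2 d1 d2. local_minimum_on (objective C lam \<alpha>) (S_pp1 \<times> Diag_plus) (R1, diag_mat d1) \<Longrightarrow>
      local_minimum_on (objective C lam \<alpha>) (S_pp1 \<times> Diag_plus) (R2, diag_mat d2) \<Longrightarrow>
      (\<And>i. 0 < d1 i) \<Longrightarrow> (\<And>i. 0 < d2 i) \<Longrightarrow> R1 = R2 \<and> d1 = d2"
  shows "unique_local_minimum C lam \<alpha>"
  unfolding unique_local_minimum_def
proof (rule ex_ex1I[OF assms(1)])
  fix x y
  assume x: "local_minimum_on (objective C lam \<alpha>) (S_pp1 \<times> Diag_plus) x"
    and y: "local_minimum_on (objective C lam \<alpha>) (S_pp1 \<times> Diag_plus) y"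
  obtain R1 d1 where 1: "x = (R1, diag_mat d1)" "\<And>i. 0 < d1 i"
    using local_minimum_coordinates[OF x] by blast
  obtain R2 d2 where 2: "y = (R2, diag_mat d2)" "\<And>i. 0 < d2 i"
    using local_minimum_coordinates[OF y] by blast
  show "x = y" using assms(2)[of R1 d1 R2 d2] x y 1 2 by blast
qed

lemma unique_local_minimum_small:
  fixes C :: "real^'p^'p"
  assumes C: "correlation_matrix C" and a: "\<alpha> < 1" and lam: "0 \<le> lam"
    and pa: "2 * (real CARD('p) * (1 - \<alpha>)) < 1"
  shows "unique_local_minimum C lam \<alpha>"
proof (rule unique_local_minimumI)
  have "0 \<le> real CARD('p) * (1 - \<alpha>)" using a by simp
  then have "real CARD('p) * (1 - \<alpha>) < 1" using pa by linarith
  then show "\<exists>x. local_minimum_on (objective C lam \<alpha>) (S_pp1 \<times> Diag_plus) x"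
    by (rule exists_minimum_semidefinite[OF a lam C])
next
  fix R1 R2 d1 d2
  assume "local_minimum_on (objective C lam \<alpha>) (S_pp1 \<times> Diag_plus) (R1, diag_mat d1)"
    "local_minimum_on (objective C lam \<alpha>) (S_pp1 \<times> Diag_plus) (R2, diag_mat d2)"
    "\<And>i. 0 < d1 i" "\<And>i. 0 < d2 i"
  from local_minima_stationary_pair[OF C a lam this]
  obtain W k where sp: "stationary_pair C W k d1 d2 (1 - \<alpha>)"
    and R: "R1 = congr_diag W (\<lambda>j. (1 + k j) / 2)" "R2 = congr_diag W (\<lambda>j. (1 - k j) / 2)" by blast
  interpret stationary_pair C W k d1 d2 "1 - \<alpha>" by (rule sp)
  have "2 * \<kappa> < 1" using pa by (simp add: \<kappa>_def)
  from small_case[OF this] have "k j = 0" "d1 i = d2 i" for i j by auto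
  then show "R1 = R2 \<and> d1 = d2" by (auto simp: R)
qed

lemma unique_local_minimum_large:
  fixes C :: "real^'p^'p"
  assumes C: "correlation_matrix C" and a: "\<alpha> < 1" and lam: "0 \<le> lam"
    and eps: "\<And>i l. i \<noteq> l \<Longrightarrow> \<bar>C $ i $ l\<bar> \<le> \<epsilon>" "0 \<le> \<epsilon>"
    and th: "\<epsilon> * (real CARD('p) - 1) < 1"
    and kap: "2 * (real CARD('p) * (1 - \<alpha>)) * (\<epsilon> * (real CARD('p) - 1))\<^sup>2 < 1"
  shows "unique_local_minimum C lam \<alpha>"
proof (rule unique_local_minimumI)
  let ?\<theta> = "\<epsilon> * (real CARD('p) - 1)"
  show "\<exists>x. local_minimum_on (objective C lam \<alpha>) (S_pp1 \<times> Diag_plus) x"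
  \<comment> \<open>The form of \<open>C - mat 1\<close> is at most \<open>?\<theta>\<close> in
    absolute value on unit vectors, so \<open>1 - ?\<theta>\<close> is a coercivity constant for
    \<open>C\<close>.\<close>
  proof (rule exists_minimum_definite[OF a lam])
    show "0 < 1 - ?\<theta>" using th by simp
    have Cd: "C $ i $ i = 1" for i using C by (simp add: correlation_matrix_def unit_diagonal_def)
    fix x :: "'p \<Rightarrow> real"
    have "\<bar>bil (C - mat 1) x x\<bar> \<le> ?\<theta> * (\<Sum>i\<in>UNIV. (x i)\<^sup>2)"
      by (rule offdiag_form_bound) (auto simp: mat_def Cd eps)
    then show "(1 - ?\<theta>) * (\<Sum>i\<in>UNIV. (x i)\<^sup>2) \<le> bil C x x"
      unfolding bil_diff_mat bil_mat_1 power2_eq_square left_diff_distrib abs_le_iff by linarith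
  qed
next
  fix R1 R2 d1 d2
  assume "local_minimum_on (objective C lam \<alpha>) (S_pp1 \<times> Diag_plus) (R1, diag_mat d1)"
    "local_minimum_on (objective C lam \<alpha>) (S_pp1 \<times> Diag_plus) (R2, diag_mat d2)"
    "\<And>i. 0 < d1 i" "\<And>i. 0 < d2 i"
  from local_minima_stationary_pair[OF C a lam this]
  obtain W k where sp: "stationary_pair C W k d1 d2 (1 - \<alpha>)"
    and R: "R1 = congr_diag W (\<lambda>j. (1 + k j) / 2)" "R2 = congr_diag W (\<lambda>j. (1 - k j) / 2)" by blast
  interpret stationary_pair C W k d1 d2 "1 - \<alpha>" by (rule sp)
  have "2 * \<kappa> * (\<epsilon> * (real CARD('p) - 1))\<^sup>2 < 1" using kap by (simp add: \<kappa>_def)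
  from large_case[OF eps th this] have "k j = 0" "d1 i = d2 i" for i j by auto
  then show "R1 = R2 \<and> d1 = d2" by (auto simp: R)
qed

section \<open>Two local minima joined by a segment in \<open>D R D\<close>\<close>

lemma ratio_gap_mono:
  fixes L x :: real
  assumes "0 < L" "1 / L \<le> x" "x \<le> L"
  shows "0 \<le> x + 1 / x - 2" and "x + 1 / x - 2 \<le> L + 1 / L - 2" and "\<bar>x - 1 / x\<bar> \<le> L - 1 / L"
proof -
  have "0 < 1 / L" using assms by simp
  then have x: "0 < x" using assms by linarith
  have "0 \<le> (x - 1)\<^sup>2 / x" using x by simp
  also have "(x - 1)\<^sup>2 / x = x + 1 / x - 2" using x by (simp add: power2_eq_square field_simps)
  finally show "0 \<le> x + 1 / x - 2" .
  have "1 \<le> x * L" using assms by (simp add: divide_le_eq)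
  then have "0 \<le> (L - x) * (x * L - 1) / (x * L)" using assms x by simp
  also have "\<dots> = L + 1 / L - (x + 1 / x)" using x assms by (simp add: field_simps)
  finally show "x + 1 / x - 2 \<le> L + 1 / L - 2" by simp
  have "1 / x \<le> L" "1 / L \<le> 1 / x"
    using assms x \<open>1 \<le> x * L\<close> by (simp_all add: divide_le_eq frac_le mult.commute)
  then show "\<bar>x - 1 / x\<bar> \<le> L - 1 / L" using assms by (simp add: abs_le_iff)
qed

text \<open>Both sides contain \<open>(L - 1) / L\<close>. For \<open>L \<ge> 2\<close> the bound
  \<open>2\<close> on the change and \<open>L + 1 \<le> 3 (L - 1)\<close> suffice; for
  \<open>L < 2\<close> the bound \<open>2 (L - 1)\<close> and \<open>L + 1 \<le> 3\<close>
  do.\<close>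

lemma correlation_change_bound:
  fixes L w \<Delta> :: real
  assumes L: "1 \<le> L" and w: "1 / L \<le> w" "w \<le> L" and D: "\<bar>\<Delta>\<bar> \<le> 2" "\<bar>\<Delta>\<bar> \<le> 2 * (L - 1)"
  shows "\<bar>\<Delta>\<bar> * \<bar>w - 1 / w\<bar> \<le> 6 * (L + 1 / L - 2)"
proof -
  have "\<bar>w - 1 / w\<bar> \<le> L - 1 / L" using L w by (intro ratio_gap_mono) auto
  also have e1: "L - 1 / L = (L - 1) * (L + 1) / L" using L by (simp add: field_simps)
  finally have w': "\<bar>w - 1 / w\<bar> \<le> (L - 1) * (L + 1) / L" .
  have e2: "6 * (L + 1 / L - 2) = (L - 1) * (6 * (L - 1)) / L" using L by (simp add: field_simps power2_eq_square)
  show ?thesis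
  proof (cases "2 \<le> L")
    case True
    have "\<bar>\<Delta>\<bar> * \<bar>w - 1 / w\<bar> \<le> 2 * ((L - 1) * (L + 1) / L)"
      using D w' by (intro mult_mono) auto
    also have "\<dots> = (L - 1) * (2 * (L + 1)) / L" by simp
    also have "\<dots> \<le> (L - 1) * (6 * (L - 1)) / L"
      using True by (intro divide_right_mono mult_left_mono) auto
    finally show ?thesis unfolding e2 .
  next
    case False
    have "\<bar>\<Delta>\<bar> * \<bar>w - 1 / w\<bar> \<le> 2 * (L - 1) * ((L - 1) * (L + 1) / L)"
      using D w' L by (intro mult_mono) auto
    also have "\<dots> = (L - 1) * (2 * (L - 1) * (L + 1)) / L" by simp
    also have "\<dots> \<le> (L - 1) * (2 * (L - 1) * 3) / L"
      using False L by (intro divide_right_mono mult_left_mono) auto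
    finally show ?thesis unfolding e2 by simp
  qed
qed

text \<open>The left side adds the penalty derivatives at the two ends of a path. The mean
  inequality in both negative terms leaves a product of two differences, which is of second order
  when the ends are close.\<close>

lemma penalty_symmetrized_bound:
  fixes x y r s :: real
  assumes "0 \<le> x" "0 \<le> y" "0 < r" "0 < s"
  shows "(y * r * s - x * (r\<^sup>2 + s\<^sup>2) / 2) + (x * (1 / r) * (1 / s) - y * ((1 / r)\<^sup>2 + (1 / s)\<^sup>2) / 2)
     \<le> (y - x) * (r * s - 1 / (r * s))"
proof -
  have "x * (r * s) \<le> x * ((r\<^sup>2 + s\<^sup>2) / 2)"
    using assms sum_squares_bound[of r s] by (intro mult_left_mono) auto
  moreover have "y * ((1 / r) * (1 / s)) \<le> y * (((1 / r)\<^sup>2 + (1 / s)\<^sup>2) / 2)"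
    using assms sum_squares_bound[of "1 / r" "1 / s"] by (intro mult_left_mono) auto
  moreover have "(y - x) * (r * s - 1 / (r * s)) = y * (r * s) - x * (r * s) - y * ((1 / r) * (1 / s)) + x * ((1 / r) * (1 / s))"
    by (simp add: algebra_simps diff_divide_distrib)
  ultimately show ?thesis by (simp only: mult.assoc times_divide_eq_right[symmetric])
qed

text \<open>The largest term \<open>\<Lambda>\<close> of the symmetrized gap of
  \<open>- ln det\<close> bounds all the harmful contributions, giving
  \<open>\<Lambda> \<le> c * \<Lambda>\<close> with \<open>c\<close> the left side of
  \<open>small\<close>. Hence \<open>\<Lambda> = 0\<close> and all generalized eigenvalues are
  \<open>1\<close>.\<close>

lemma local_minima_coincide:
  fixes C :: "real^'p^'p"
  assumes lam: "0 \<le> lam" and small: "max \<alpha> 0 * real CARD('p) + 6 * lam * (real CARD('p))\<^sup>2 < 1"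
    and lm1: "local_minimum_on (objective C lam \<alpha>) (S_pp1 \<times> Diag_plus) (R1, diag_mat d1)"
    and lm2: "local_minimum_on (objective C lam \<alpha>) (S_pp1 \<times> Diag_plus) (R2, diag_mat d2)"
    and d1: "\<And>i. 0 < d1 i" and d2: "\<And>i. 0 < d2 i"
  shows "R1 = R2 \<and> d1 = d2"
proof -
  let ?p = "real CARD('p)"
  have R: "R1 \<in> S_pp1" "R2 \<in> S_pp1" using lm1 lm2 by (auto simp: local_minimum_on_def)
  have diag: "R1 $ i $ i = 1" "R2 $ i $ i = 1" for i using R by (auto simp: S_pp1_def unit_diagonal_def)
  define S1 where "S1 = (\<chi> i l. R1 $ i $ l * d1 i * d1 l)"
  define S2 where "S2 = (\<chi> i l. R2 $ i $ l * d2 i * d2 l)"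
  have S: "sym_pos_def S1" "sym_pos_def S2"
    unfolding S1_def S2_def using R by (auto simp: S_pp1_def intro!: sym_pos_def_scale d1 d2)
  obtain W \<nu> where W: "det W \<noteq> 0" and S1: "S1 = congr_diag W (\<lambda>_. 1)" and S2: "S2 = congr_diag W \<nu>"
    using simultaneous_diagonalization[OF S(1), of S2] S(2) by (metis sym_pos_def_def)
  have e1: "congr_diag W (\<lambda>_. 1) $ i $ l = R1 $ i $ l * d1 i * d1 l" for i l
    unfolding S1[symmetric] by (simp add: S1_def)
  have e2: "congr_diag W \<nu> $ i $ l = R2 $ i $ l * d2 i * d2 l" for i l
    unfolding S2[symmetric] by (simp add: S2_def)
  have \<nu>: "0 < \<nu> j" for j using sym_pos_def_congr_diag_pos[OF S(2)[unfolded S2] W] .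
  \<comment> \<open>The least \<open>L\<close> for which all generalized eigenvalues of
    \<open>S2\<close> relative to \<open>S1\<close> lie in \<open>[1 / L, L]\<close>.\<close>
  define L where "L = Max (range (\<lambda>j. max (\<nu> j) (1 / \<nu> j)))"
  have mL: "max (\<nu> j) (1 / \<nu> j) \<le> L" for j unfolding L_def by (intro Max_ge) auto
  have \<nu>L: "\<nu> j \<le> L" "1 / \<nu> j \<le> L" for j using mL[of j] by simp_all
  have "L \<in> range (\<lambda>j. max (\<nu> j) (1 / \<nu> j))" unfolding L_def by (intro Max_in) auto
  then obtain j0 where j0: "L = max (\<nu> j0) (1 / \<nu> j0)" by auto
  have L1: "1 \<le> L"
  proof (cases "1 \<le> \<nu> j0")
    case True
    then show ?thesis using \<nu>L(1)[of j0] by linarith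
  next
    case False
    then have "1 \<le> 1 / \<nu> j0" using \<nu>[of j0] by simp
    then show ?thesis using \<nu>L(2)[of j0] by linarith
  qed
  have L\<nu>: "1 / L \<le> \<nu> j" for j using \<nu>L(2)[of j] \<nu>[of j] L1 by (simp add: divide_le_eq mult.commute)
  define \<Lambda> where "\<Lambda> = L + 1 / L - 2"
  have "1 / L \<le> L" using L1 by (intro order_trans[of "1 / L" 1 L]) auto
  then have \<Lambda>0: "0 \<le> \<Lambda>" unfolding \<Lambda>_def using L1 by (intro ratio_gap_mono(1)[of L]) auto
  have sq1: "(\<Sum>j\<in>UNIV. (W $ i $ j)\<^sup>2) = (d1 i)\<^sup>2" for i
    using e1[of i i] by (simp add: diag power2_eq_square)
  have sq2: "(\<Sum>j\<in>UNIV. \<nu> j * (W $ i $ j)\<^sup>2) = (d2 i)\<^sup>2" for i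
    using e2[of i i] by (simp add: diag power2_eq_square mult.assoc)
  \<comment> \<open>The diagonals of \<open>S1\<close> and \<open>S2\<close> are the squares of
    \<open>d1\<close> and \<open>d2\<close>, so their ratios inherit the eigenvalue bounds.\<close>
  have up: "(d2 i)\<^sup>2 \<le> L * (d1 i)\<^sup>2" for i
    unfolding sq1[symmetric] sq2[symmetric] sum_distrib_left by (intro sum_mono mult_right_mono \<nu>L) auto
  have dn: "(d1 i)\<^sup>2 \<le> L * (d2 i)\<^sup>2" for i
  proof -
    have "1 / L * (d1 i)\<^sup>2 \<le> (d2 i)\<^sup>2"
      unfolding sq1[symmetric] sq2[symmetric] sum_distrib_left by (intro sum_mono mult_right_mono L\<nu>) auto
    then show ?thesis using L1 by (simp add: divide_le_eq mult.commute)
  qed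
  define \<rho> where "\<rho> i = d2 i / d1 i" for i
  have \<rho>: "0 < \<rho> i" for i using d1 d2 by (simp add: \<rho>_def)
  have \<rho>inv: "d1 i / d2 i = 1 / \<rho> i" for i by (simp add: \<rho>_def)
  have \<omega>: "1 / L \<le> (\<rho> i)\<^sup>2" "(\<rho> i)\<^sup>2 \<le> L" for i
    using up[of i] dn[of i] d1[of i] L1 by (simp_all add: \<rho>_def power_divide divide_le_eq le_divide_eq mult.commute)
  have w: "1 / L \<le> \<rho> i * \<rho> l" "\<rho> i * \<rho> l \<le> L" for i l
  proof -
    have "(\<rho> i * \<rho> l)\<^sup>2 \<le> L\<^sup>2"
      unfolding power_mult_distrib power2_eq_square[of L] using \<omega> L1 by (intro mult_mono) auto
    then show "\<rho> i * \<rho> l \<le> L" by (rule power2_le_imp_le) (use L1 in simp)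
    have "(1 / L)\<^sup>2 \<le> (\<rho> i * \<rho> l)\<^sup>2"
      unfolding power_mult_distrib power2_eq_square[of "1 / L"] using \<omega> L1 by (intro mult_mono) auto
    then show "1 / L \<le> \<rho> i * \<rho> l" by (rule power2_le_imp_le) (use \<rho> in \<open>simp add: less_imp_le\<close>)
  qed
  \<comment> \<open>Entries of \<open>S2 - S1\<close> normalized by \<open>d1\<close>:
    \<open>\<bar>\<nu> j - 1\<bar> \<le> L - 1\<close>, as \<open>2 - L \<le> 1 / L\<close>, and
    Cauchy-Schwarz over \<open>j\<close> gives the factor \<open>d1 i * d1 l\<close>.\<close>
  have S_diff: "\<bar>R2 $ i $ l * (\<rho> i * \<rho> l) - R1 $ i $ l\<bar> \<le> L - 1" for i l
  proof -
    have "\<nu> j - 1 \<le> L - 1" "- (\<nu> j - 1) \<le> L - 1" for j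
    proof -
      show "\<nu> j - 1 \<le> L - 1" using \<nu>L by simp
      have "1 * (2 - L) \<le> 1 / L" using \<Lambda>0 by (simp add: \<Lambda>_def)
      then show "- (\<nu> j - 1) \<le> L - 1" using L\<nu>[of j] by simp
    qed
    then have k: "\<bar>\<nu> j - 1\<bar> \<le> L - 1" for j by (auto simp: abs_le_iff)
    have "congr_diag W \<nu> $ i $ l - congr_diag W (\<lambda>_. 1) $ i $ l = (\<Sum>j\<in>UNIV. (\<nu> j - 1) * (W $ i $ j * W $ l $ j))"
      by (simp add: algebra_simps sum_subtractf)
    then have "\<bar>congr_diag W \<nu> $ i $ l - congr_diag W (\<lambda>_. 1) $ i $ l\<bar> \<le> (\<Sum>j\<in>UNIV. \<bar>(\<nu> j - 1) * (W $ i $ j * W $ l $ j)\<bar>)"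
      by (simp only: sum_abs)
    also have "\<dots> \<le> (\<Sum>j\<in>UNIV. (L - 1) * (\<bar>W $ i $ j\<bar> * \<bar>W $ l $ j\<bar>))"
      unfolding abs_mult by (intro sum_mono mult_right_mono k) auto
    also have "\<dots> \<le> (L - 1) * (d1 i * d1 l)"
      using L2_set_mult_ineq[of "\<lambda>j. W $ i $ j" "\<lambda>j. W $ l $ j" UNIV] L1 d1[of i] d1[of l]
      unfolding sum_distrib_left[symmetric] L2_set_def sq1 by (intro mult_left_mono) auto
    finally have "\<bar>R2 $ i $ l * d2 i * d2 l - R1 $ i $ l * d1 i * d1 l\<bar> \<le> (L - 1) * (d1 i * d1 l)"
      unfolding e1 e2 .
    then have "\<bar>R2 $ i $ l * d2 i * d2 l - R1 $ i $ l * d1 i * d1 l\<bar> / (d1 i * d1 l) \<le> L - 1"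
      using d1[of i] d1[of l] by (simp add: divide_le_eq)
    moreover have "\<bar>R2 $ i $ l * d2 i * d2 l - R1 $ i $ l * d1 i * d1 l\<bar> / (d1 i * d1 l)
        = \<bar>(R2 $ i $ l * d2 i * d2 l - R1 $ i $ l * d1 i * d1 l) / (d1 i * d1 l)\<bar>"
      using d1[of i] d1[of l] by (simp add: abs_mult)
    moreover have "(R2 $ i $ l * d2 i * d2 l - R1 $ i $ l * d1 i * d1 l) / (d1 i * d1 l) = R2 $ i $ l * (\<rho> i * \<rho> l) - R1 $ i $ l"
      using d1[of i] d1[of l] by (simp add: \<rho>_def diff_divide_distrib)
    ultimately show ?thesis by simp
  qed
  \<comment> \<open>Undoing the scaling by \<open>\<rho> i * \<rho> l\<close> costs another
    \<open>L - 1\<close>, whence the factor \<open>2\<close>. The constant bound \<open>2\<close>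
    serves for large \<open>L\<close>.\<close>
  have R_diff: "\<bar>\<bar>R2 $ i $ l\<bar> - \<bar>R1 $ i $ l\<bar>\<bar> \<le> 2" "\<bar>\<bar>R2 $ i $ l\<bar> - \<bar>R1 $ i $ l\<bar>\<bar> \<le> 2 * (L - 1)" for i l
  proof -
    have b: "\<bar>R1 $ i $ l\<bar> \<le> 1" "\<bar>R2 $ i $ l\<bar> \<le> 1" using R S_pp1_entry_le_1 by auto
    then show "\<bar>\<bar>R2 $ i $ l\<bar> - \<bar>R1 $ i $ l\<bar>\<bar> \<le> 2" by linarith
    have "2 - L \<le> 1 / L" using \<Lambda>0 by (simp add: \<Lambda>_def)
    then have "2 - L \<le> \<rho> i * \<rho> l" using w(1)[of i l] by (rule order_trans)
    then have "\<bar>\<rho> i * \<rho> l - 1\<bar> \<le> L - 1" using w(2)[of i l] by (simp add: abs_le_iff)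
    then have "\<bar>R2 $ i $ l\<bar> * \<bar>\<rho> i * \<rho> l - 1\<bar> \<le> 1 * (L - 1)"
      using b L1 by (intro mult_mono) auto
    then have "\<bar>R2 $ i $ l * (\<rho> i * \<rho> l) - R2 $ i $ l\<bar> \<le> L - 1"
      by (simp add: abs_mult[symmetric] right_diff_distrib)
    moreover have "\<bar>\<bar>b\<bar> - \<bar>c\<bar>\<bar> \<le> 2 * e" if "\<bar>a - b\<bar> \<le> e" "\<bar>a - c\<bar> \<le> e" for a b c e :: real
      using that by linarith
    ultimately show "\<bar>\<bar>R2 $ i $ l\<bar> - \<bar>R1 $ i $ l\<bar>\<bar> \<le> 2 * (L - 1)"
      using S_diff[of i l] by blast
  qed
  let ?b = "\<lambda>R d. bil (hadamard C R) d d"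
  define t1 where "t1 i l = (if i = l then 0 else \<bar>R2 $ i $ l\<bar> * \<rho> i * \<rho> l - \<bar>R1 $ i $ l\<bar> * ((\<rho> i)\<^sup>2 + (\<rho> l)\<^sup>2) / 2)" for i l
  define t2 where "t2 i l = (if i = l then 0 else \<bar>R1 $ i $ l\<bar> * (1 / \<rho> i) * (1 / \<rho> l) - \<bar>R2 $ i $ l\<bar> * ((1 / \<rho> i)\<^sup>2 + (1 / \<rho> l)\<^sup>2) / 2)" for i l
  have i1: "0 \<le> - (\<Sum>j\<in>UNIV. (\<nu> j - 1) / 1) + \<alpha> * (\<Sum>i\<in>UNIV. (\<rho> i)\<^sup>2 - 1) + (?b R2 d2 - ?b R1 d1)
      + lam * (\<Sum>i\<in>UNIV. \<Sum>l\<in>UNIV. t1 i l)"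
    unfolding t1_def \<rho>_def
    by (rule local_minimum_S_direction[OF lm1 R(2) e1 e2 W _ \<nu> d1 d2 lam]) simp
  have i2: "0 \<le> - (\<Sum>j\<in>UNIV. (1 - \<nu> j) / \<nu> j) + \<alpha> * (\<Sum>i\<in>UNIV. (1 / \<rho> i)\<^sup>2 - 1) + (?b R1 d1 - ?b R2 d2)
      + lam * (\<Sum>i\<in>UNIV. \<Sum>l\<in>UNIV. t2 i l)"
    unfolding t2_def \<rho>inv[symmetric]
    by (rule local_minimum_S_direction[OF lm2 R(1) e2 e1 W \<nu> _ d2 d1 lam]) simp
  have tt: "(\<Sum>i\<in>UNIV. \<Sum>l\<in>UNIV. t1 i l) + (\<Sum>i\<in>UNIV. \<Sum>l\<in>UNIV. t2 i l) \<le> ?p\<^sup>2 * (6 * \<Lambda>)"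
  proof -
    have "t1 i l + t2 i l \<le> 6 * \<Lambda>" for i l
    proof (cases "i = l")
      case True
      then show ?thesis using \<Lambda>0 by (simp add: t1_def t2_def)
    next
      case False
      then have "t1 i l + t2 i l \<le> (\<bar>R2 $ i $ l\<bar> - \<bar>R1 $ i $ l\<bar>) * (\<rho> i * \<rho> l - 1 / (\<rho> i * \<rho> l))"
        unfolding t1_def t2_def
        using penalty_symmetrized_bound[of "\<bar>R1 $ i $ l\<bar>" "\<bar>R2 $ i $ l\<bar>" "\<rho> i" "\<rho> l"] \<rho> by simp
      also have "\<dots> \<le> \<bar>\<bar>R2 $ i $ l\<bar> - \<bar>R1 $ i $ l\<bar>\<bar> * \<bar>\<rho> i * \<rho> l - 1 / (\<rho> i * \<rho> l)\<bar>"
        unfolding abs_mult[symmetric] by (rule abs_ge_self)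
      also have "\<dots> \<le> 6 * \<Lambda>"
        unfolding \<Lambda>_def by (rule correlation_change_bound[OF L1 w R_diff])
      finally show ?thesis .
    qed
    then have "(\<Sum>i\<in>UNIV. \<Sum>l\<in>UNIV. t1 i l + t2 i l) \<le> (\<Sum>i\<in>(UNIV::'p set). \<Sum>l\<in>(UNIV::'p set). 6 * \<Lambda>)"
      by (intro sum_mono)
    then show ?thesis by (simp add: sum.distrib power2_eq_square)
  qed
  \<comment> \<open>The bracket is a sum of terms between \<open>0\<close> and
    \<open>\<Lambda>\<close>; for \<open>\<alpha> \<le> 0\<close> its contribution has the
    favourable sign.\<close>
  have \<omega>\<omega>: "\<alpha> * ((\<Sum>i\<in>UNIV. (\<rho> i)\<^sup>2 - 1) + (\<Sum>i\<in>UNIV. (1 / \<rho> i)\<^sup>2 - 1)) \<le> max \<alpha> 0 * (?p * \<Lambda>)"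
  proof -
    let ?s = "\<Sum>i\<in>UNIV. (\<rho> i)\<^sup>2 + 1 / (\<rho> i)\<^sup>2 - 2"
    have e: "(\<Sum>i\<in>UNIV. (\<rho> i)\<^sup>2 - 1) + (\<Sum>i\<in>UNIV. (1 / \<rho> i)\<^sup>2 - 1) = ?s"
      unfolding sum.distrib[symmetric] by (intro sum.cong) (auto simp: power_divide)
    have s: "0 \<le> (\<rho> i)\<^sup>2 + 1 / (\<rho> i)\<^sup>2 - 2" "(\<rho> i)\<^sup>2 + 1 / (\<rho> i)\<^sup>2 - 2 \<le> \<Lambda>" for i
      unfolding \<Lambda>_def using L1 \<omega>[of i] by (intro ratio_gap_mono; simp)+
    have "0 \<le> ?s" by (intro sum_nonneg s)
    moreover have "?s \<le> (\<Sum>i\<in>(UNIV::'p set). \<Lambda>)" by (intro sum_mono s)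
    ultimately have "\<alpha> * ?s \<le> max \<alpha> 0 * ?s" "max \<alpha> 0 * ?s \<le> max \<alpha> 0 * (?p * \<Lambda>)"
      by (intro mult_right_mono mult_left_mono; simp)+
    then show ?thesis unfolding e by linarith
  qed
  have "\<Lambda> \<le> (\<Sum>j\<in>UNIV. (\<nu> j - 1) / 1) + (\<Sum>j\<in>UNIV. (1 - \<nu> j) / \<nu> j)"
  proof -
    have "\<nu> j0 + 1 / \<nu> j0 - 2 \<le> (\<Sum>j\<in>UNIV. \<nu> j + 1 / \<nu> j - 2)"
      using L1 L\<nu> \<nu>L by (intro member_le_sum ratio_gap_mono(1)[of L]) auto
    moreover have "\<Lambda> = \<nu> j0 + 1 / \<nu> j0 - 2" by (auto simp: \<Lambda>_def j0 max_def)
    moreover have "(\<nu> j - 1) / 1 + (1 - \<nu> j) / \<nu> j = \<nu> j + 1 / \<nu> j - 2" for j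
      using \<nu>[of j] by (simp add: diff_divide_distrib)
    ultimately show ?thesis by (simp only: sum.distrib[symmetric])
  qed
  moreover have "lam * ((\<Sum>i\<in>UNIV. \<Sum>l\<in>UNIV. t1 i l) + (\<Sum>i\<in>UNIV. \<Sum>l\<in>UNIV. t2 i l)) \<le> lam * (?p\<^sup>2 * (6 * \<Lambda>))"
    using tt lam by (intro mult_left_mono)
  \<comment> \<open>The trace terms of \<open>i1\<close> and \<open>i2\<close> are affine in
    \<open>D R D\<close> and cancel in the sum.\<close>
  ultimately have "\<Lambda> \<le> max \<alpha> 0 * (?p * \<Lambda>) + lam * (?p\<^sup>2 * (6 * \<Lambda>))"
    using i1 i2 \<omega>\<omega> unfolding distrib_left by linarith
  then have "\<Lambda> \<le> (max \<alpha> 0 * ?p + 6 * lam * ?p\<^sup>2) * \<Lambda>" by (simp add: algebra_simps)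
  then have "\<Lambda> = 0"
    using \<Lambda>0 small mult_strict_right_mono[OF small, of \<Lambda>] by (cases "\<Lambda> = 0") auto
  then have "(L - 1)\<^sup>2 = 0" using L1 by (simp add: \<Lambda>_def power2_eq_square field_simps)
  then have L: "L = 1" by simp
  have "\<nu> j = 1" for j using \<nu>L(1)[of j] L\<nu>[of j] by (simp add: L)
  then have "\<nu> = (\<lambda>_. 1)" by auto
  then have e: "R1 $ i $ l * d1 i * d1 l = R2 $ i $ l * d2 i * d2 l" for i l
    using e1[of i l] e2[of i l] by simp
  have dd: "d1 i = d2 i" for i
    using e[of i i] d1[of i] d2[of i] by (simp add: diag) (metis abs_of_pos power2_eq_square power2_eq_iff_nonneg less_imp_le)
  moreover have "R1 $ i $ l = R2 $ i $ l" for i l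
    using e[of i l] d2[of i] d2[of l] by (simp add: dd)
  ultimately show ?thesis by (auto simp: vec_eq_iff)
qed

lemma S_pp1_coercive:
  assumes "C \<in> S_pp1"
  obtains c where "0 < c" "\<And>x. c * (\<Sum>i\<in>UNIV. (x i)\<^sup>2) \<le> bil C x x"
proof -
  obtain U k where U: "orthogonal_matrix U" "C = congr_diag U k" "\<And>j. 0 < k j"
    using S_pp1_spectral[OF assms] by blast
  have "Min (range k) \<in> range k" by (intro Min_in) auto
  then have c: "0 < Min (range k)" using U(3) by auto
  have "Min (range k) * (\<Sum>i\<in>UNIV. (x i)\<^sup>2) \<le> bil C x x" for x
  proof -
    have "(\<Sum>i\<in>UNIV. (x i)\<^sup>2) = bil (congr_diag U (\<lambda>_. 1)) x x"
      by (simp add: congr_diag_orthogonal_1[OF U(1)] bil_mat_1 power2_eq_square)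
    then show ?thesis
      unfolding U(2) bil_eq_inner congr_diag_quadratic
      by (simp only: sum_distrib_left mult_1) (intro sum_mono mult_right_mono Min_le; simp)
  qed
  then show ?thesis using that c by blast
qed

section \<open>Choice of the constants\<close>

lemma max_entry_norm_ge: "\<bar>A $ i $ l\<bar> \<le> max_entry_norm A"
proof -
  have "(case (i, l) of (i, l) \<Rightarrow> \<bar>A $ i $ l\<bar>) \<le> max_entry_norm A"
    unfolding max_entry_norm_def by (intro Max_ge imageI) auto
  then show ?thesis by simp
qed

theorem theorem2:
  fixes C :: "real^'p^'p"
  assumes "correlation_matrix C"
  shows "(\<forall>\<alpha><1. max_entry_norm (C - mat 1) \<le> (2 * (1 - \<alpha>) * real CARD('p) ^ 3) powr (-1/2)
            \<longrightarrow> (\<forall>lam\<ge>0. unique_local_minimum C lam \<alpha>)) \<and>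
         (C \<in> S_pp1 \<longrightarrow>
            (\<exists>lam0>0. \<exists>\<alpha>0>0. \<forall>lam \<alpha>. 0 < lam \<and> lam < lam0 \<and> \<alpha> < \<alpha>0 \<and> \<alpha> < 1
               \<longrightarrow> unique_local_minimum C lam \<alpha>))"
proof (intro conjI allI impI)
  fix \<alpha> lam :: real
  let ?p = "real CARD('p)"
  assume a: "\<alpha> < 1" and le: "max_entry_norm (C - mat 1) \<le> (2 * (1 - \<alpha>) * ?p ^ 3) powr (-1/2)" and lam: "0 \<le> lam"
  define \<kappa> where "\<kappa> = ?p * (1 - \<alpha>)"
  show "unique_local_minimum C lam \<alpha>"
  \<comment> \<open>In the second case \<open>1 \<le> 2 * \<kappa>\<close> turns the entry bound,
    which reads \<open>2 \<kappa> (\<epsilon> p)^2 \<le> 1\<close>, into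
    \<open>\<epsilon> p \<le> 1\<close>.\<close>
  proof (cases "2 * \<kappa> < 1")
    case True
    then show ?thesis by (intro unique_local_minimum_small[OF assms a lam]) (simp add: \<kappa>_def)
  next
    case False
    define \<epsilon> where "\<epsilon> = max_entry_norm (C - mat 1)"
    define y where "y = 2 * (1 - \<alpha>) * ?p ^ 3"
    have p1: "1 \<le> ?p" by (simp add: Suc_leI)
    have y: "0 < y" using a by (simp add: y_def)
    have e0: "0 \<le> \<epsilon>" using max_entry_norm_ge[of "C - mat 1"] by (metis \<epsilon>_def abs_ge_zero order_trans)
    have eps: "\<bar>C $ i $ l\<bar> \<le> \<epsilon>" if "i \<noteq> l" for i l
      using max_entry_norm_ge[of "C - mat 1" i l] that by (simp add: \<epsilon>_def mat_def)
    have "\<epsilon>\<^sup>2 \<le> (y powr (-1/2))\<^sup>2" using le e0 by (intro power_mono) (simp_all add: \<epsilon>_def y_def)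
    also have "\<dots> = y powr (-1)" by (simp add: power2_eq_square flip: powr_add)
    also have "\<dots> = 1 / y" using y by (simp add: powr_minus divide_inverse)
    finally have "\<epsilon>\<^sup>2 * y \<le> 1" using y by (simp add: le_divide_eq)
    moreover have "\<epsilon>\<^sup>2 * y = 2 * \<kappa> * (\<epsilon> * ?p)\<^sup>2"
      by (simp add: y_def \<kappa>_def power2_eq_square power3_eq_cube)
    ultimately have ek: "2 * \<kappa> * (\<epsilon> * ?p)\<^sup>2 \<le> 1" by simp
    have "1 * (\<epsilon> * ?p)\<^sup>2 \<le> 2 * \<kappa> * (\<epsilon> * ?p)\<^sup>2" using False by (intro mult_right_mono) auto
    then have "(\<epsilon> * ?p)\<^sup>2 \<le> 1" using ek by simp
    then have ep: "\<epsilon> * ?p \<le> 1" using e0 p1 by (simp add: abs_square_le_1 abs_le_iff)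
    show ?thesis
    proof (rule unique_local_minimum_large[OF assms a lam eps e0])
      \<comment> \<open>Strictness comes from passing from \<open>p\<close> to \<open>p - 1\<close>;
        the case \<open>\<epsilon> = 0\<close> is immediate.\<close>
      show "\<epsilon> * (?p - 1) < 1" using ep e0 by (cases "\<epsilon> = 0") (auto simp: algebra_simps)
      show "2 * (?p * (1 - \<alpha>)) * (\<epsilon> * (?p - 1))\<^sup>2 < 1"
      proof (cases "\<epsilon> = 0")
        case True
        then show ?thesis by simp
      next
        case False
        then have "\<epsilon> * (?p - 1) < \<epsilon> * ?p" using e0 by simp
        then have "(\<epsilon> * (?p - 1))\<^sup>2 < (\<epsilon> * ?p)\<^sup>2" using e0 p1 by (intro power_strict_mono) auto
        then have "2 * \<kappa> * (\<epsilon> * (?p - 1))\<^sup>2 < 2 * \<kappa> * (\<epsilon> * ?p)\<^sup>2"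
          using \<open>\<not> 2 * \<kappa> < 1\<close> by (intro mult_strict_left_mono) auto
        then show ?thesis using ek unfolding \<kappa>_def by linarith
      qed
    qed auto
  qed
next
  let ?p = "real CARD('p)"
  assume C: "C \<in> S_pp1"
  have p: "0 < ?p" by simp
  show "\<exists>lam0>0. \<exists>\<alpha>0>0. \<forall>lam \<alpha>. 0 < lam \<and> lam < lam0 \<and> \<alpha> < \<alpha>0 \<and> \<alpha> < 1 \<longrightarrow> unique_local_minimum C lam \<alpha>"
  proof (intro exI conjI allI impI)
    \<comment> \<open>Each threshold keeps one of the two summands of the smallness condition below
      \<open>1 / 2\<close>.\<close>
    show "0 < 1 / (12 * ?p\<^sup>2)" "0 < 1 / (2 * ?p)" using p by simp_all
    fix lam \<alpha> :: real
    assume *: "0 < lam \<and> lam < 1 / (12 * ?p\<^sup>2) \<and> \<alpha> < 1 / (2 * ?p) \<and> \<alpha> < 1"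
    then have lam: "0 \<le> lam" and a: "\<alpha> < 1" by auto
    have "max \<alpha> 0 < 1 / (2 * ?p)" using * p by auto
    then have "max \<alpha> 0 * ?p < 1 / 2" using p by (simp add: less_divide_eq)
    moreover have "6 * lam * ?p\<^sup>2 < 1 / 2" using * p by (simp add: less_divide_eq)
    ultimately have small: "max \<alpha> 0 * ?p + 6 * lam * ?p\<^sup>2 < 1" by linarith
    obtain c where "0 < c" "\<And>x. c * (\<Sum>i\<in>UNIV. (x i)\<^sup>2) \<le> bil C x x"
      using S_pp1_coercive[OF C] by blast
    then show "unique_local_minimum C lam \<alpha>"
      by (intro unique_local_minimumI exists_minimum_definite[OF a lam] local_minima_coincide[OF lam small])
  qed
qed

end
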